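(* Let $c \colon \mathbb{N} \to [0,+\infty)$ be a bounded function which is not identically zero, and for each $u/v=[a_1,\ldots,a_n] \in (0,1) \cap \mathbb{Q}$ with $a_n \geq 2$ define $C(u/v):=\sum_{k=1}^n c(a_k)$. Then there exist constants $\mu,\sigma^2>0$ (with $\sigma>0$ the positive square root of $\sigma^2$) such that for all $t \in \mathbb{R}$ \[\lim_{n \to \infty} \mathbb{P}_n\left(\left\{(u,v) \in \Omega_n \colon \frac{ C(u/v)-\mu\log n}{\sigma\sqrt{\log n}} \leq t\right\}\right) = \frac{1}{\sqrt{2\pi}}\int_{-\infty}^t e^{-\frac{x^2}{2}}dx\] and, with the same constants $\mu,\sigma^2$, \[\lim_{n \to \infty} \tilde{\mathbb{P}}_n\left(\left\{(u,v) \in \tilde{\Omega}_n \colon \frac{ C(u/v)-\mu\log n}{\sigma\sqrt{\log n}} \leq t\right\}\right) = \frac{1}{\sqrt{2\pi}}\int_{-\infty}^t e^{-\frac{x^2}{2}}dx.\] The constant $\mu$ satisfies \[\mu=\frac{2}{\mathfrak{h}(T)}\sum_{n=1}^\infty c(n)\int_{\frac{1}{n+1}}^{\frac{1}{n}}\xi(x)\,dx,\] where $\mathfrak{h}(T):=\int_0^1\log|T'(x)|\,\xi(x)\,dx=\frac{\pi^2}{6\log2}$. If we define $\psi(x):=c(n)+\mu\log x$ for all $x \in (\frac{1}{n+1},\frac{1}{n}]$, $n \geq 1$, and $\psi(0):=0$, then $\sigma^2$ satisfies \[\sigma^2=\frac{2}{\mathfrak{h}(T)}\left(\lim_{n \to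 \infty} \frac{1}{n}\int_0^1\left(\sum_{k=0}^{n-1} \psi(T^kx)\right)^2\xi(x)\,dx\right)>0.\]
   Context: $\mathbb{N}=\{1,2,3,\ldots\}$. Every rational $u/v \in (0,1)$ has a unique finite continued fraction expansion $u/v=[a_1,\ldots,a_n]=\cfrac{1}{a_1+\cfrac{1}{a_2+\cdots+\cfrac{1}{a_n}}}$ with integers $a_i\geq 1$ and last digit $a_n\geq 2$; $C(u/v)$ depends only on the rational number $u/v$. $T$ is the Gauss map on $[0,1]$: $T(x):=\frac1x-\lfloor \frac1x\rfloor$ for $x\in(0,1]$, and $T(0):=0$; $T'$ denotes its derivative, $|T'(x)|=x^{-2}$ for almost every $x\in[0,1]$. $\xi\colon[0,1]\to\mathbb{R}$ is the function $\xi(x):=\frac{1}{(\log 2)(1+x)}$. For each $n$, $\tilde{\Omega}_n$ is the set of all pairs $(u,v)\in\mathbb{N}^2$ with $1 \leq u < v \leq n$, and $\Omega_n$ is the set of all $(u,v)\in\tilde{\Omega}_n$ with $\gcd(u,v)=1$. For $n\ge 2$, $\mathbb{P}_n$ (resp. $\tilde{\mathbb{P}}_n$) is the uniform probability measure on the finite set $\Omega_n$ (resp. $\tilde{\Omega}_n$). *)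

theory Defs
  imports "HOL-Probability.Probability"
begin

fun cf_value :: "nat list \<Rightarrow> real" where
  "cf_value [] = 0"
| "cf_value (a # as) = 1 / (real a + cf_value as)"

definition cf_expansion :: "nat list \<Rightarrow> real \<Rightarrow> bool" where
  "cf_expansion as x \<longleftrightarrow>
     as \<noteq> [] \<and> (\<forall>a\<in>set as. 1 \<le> a) \<and> 2 \<le> last as \<and> cf_value as = x"

text \<open>
  Meaningful for rational \<^term>\<open>x\<close> strictly between 0 and 1 only; existence and uniqueness of the
  expansion for such \<^term>\<open>x\<close> are shown below (\<open>cf_expansion_ex1\<close>).
\<close>
definition cf_digits :: "real \<Rightarrow> nat list" where
  "cf_digits x = (THE as. cf_expansion as x)"

definition total_cost :: "(nat \<Rightarrow> real) \<Rightarrow> real \<Rightarrow> real" where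
  "total_cost c x = (\<Sum>a\<leftarrow>cf_digits x. c a)"

lemma cf_value_bounds:
  assumes "as \<noteq> []" "\<forall>a\<in>set as. 1 \<le> a" "2 \<le> last as"
  shows "0 < cf_value as \<and> cf_value as < 1"
  using assms
proof (induction as)
  case (Cons a as)
  show ?case
  proof (cases "as = []")
    case True
    then show ?thesis using Cons.prems by simp
  next
    case False
    then have "0 < cf_value as \<and> cf_value as < 1" using Cons by simp
    moreover have "1 \<le> real a" using Cons.prems by simp
    ultimately show ?thesis by simp
  qed
qed simp

lemma cf_expansion_unique:
  assumes "cf_expansion as x" "cf_expansion bs x"
  shows "as = bs"
  using assms
proof (induction as arbitrary: bs x)
  case Nil
  then show ?case by (simp add: cf_expansion_def)
next
  case (Cons a as)
  from Cons.prems obtain b bs' where bs: "bs = b # bs'"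
    by (cases bs) (auto simp: cf_expansion_def)
  have tl: "0 \<le> cf_value es \<and> cf_value es < 1 \<and> (cf_value es = 0 \<longleftrightarrow> es = [])
      \<and> (es \<noteq> [] \<longrightarrow> cf_expansion es (cf_value es))"
    if "cf_expansion (e # es) x" for e es
    using that cf_value_bounds[of es] by (cases "es = []") (auto simp: cf_expansion_def)
  note ta = tl[OF Cons.prems(1)] and tb = tl[OF Cons.prems(2)[unfolded bs]]
  have "1 / (real a + cf_value as) = 1 / (real b + cf_value bs')"
    using Cons.prems by (simp add: cf_expansion_def bs)
  then have eq: "real a + cf_value as = real b + cf_value bs'"
    by (metis inverse_eq_divide inverse_eq_iff_eq)
  have "a = b" using eq ta tb by linarith
  moreover have "as = bs'"
    using Cons.IH[of "cf_value as" bs'] ta tb eq \<open>a = b\<close> by (cases "as = []") auto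
  ultimately show ?case by (simp add: bs)
qed

lemma cf_expansion_exists:
  fixes u v :: nat
  assumes "1 \<le> u" "u < v"
  shows "\<exists>as. cf_expansion as (real u / real v)"
  using assms
proof (induction u arbitrary: v rule: less_induct)
  case (less u)
  define q r where "q = v div u" and "r = v mod u"
  have v: "real v = real q * real u + real r"
    unfolding q_def r_def by (metis div_mult_mod_eq of_nat_add of_nat_mult)
  have "r < u" and q: "1 \<le> q"
    using less.prems by (auto simp: q_def r_def div_greater_zero_iff Suc_le_eq)
  have x: "real u / real v = 1 / (real q + real r / real u)"
    using less.prems v by (simp add: field_simps)
  show ?case
  proof (cases "r = 0")
    case True
    then have "real v = real (q * u)" using v by simp
    then have "v = q * u" using of_nat_eq_iff by blast
    then have "q \<noteq> 1" using less.prems by auto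
    then have "cf_expansion [q] (real u / real v)"
      using q x True by (simp add: cf_expansion_def)
    then show ?thesis by blast
  next
    case False
    then obtain as where "cf_expansion as (real r / real u)"
      using less.IH[of r u] \<open>r < u\<close> by auto
    then have "cf_expansion (q # as) (real u / real v)"
      using q x by (simp add: cf_expansion_def)
    then show ?thesis by blast
  qed
qed

lemma cf_expansion_ex1:
  fixes u v :: nat
  assumes "1 \<le> u" "u < v"
  shows "\<exists>!as. cf_expansion as (real u / real v)"
  using cf_expansion_exists[OF assms] cf_expansion_unique by blast

definition gauss_map :: "real \<Rightarrow> real" where
  "gauss_map x = (if x = 0 then 0 else 1 / x - real_of_int \<lfloor>1 / x\<rfloor>)"

definition gauss_density :: "real \<Rightarrow> real" where
  "gauss_density x = 1 / (ln 2 * (1 + x))"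

text \<open>The derivative is a junk value on the null set where the map is not differentiable.\<close>
definition gauss_entropy :: real where
  "gauss_entropy = (LBINT x:{0..1}. ln \<bar>deriv gauss_map x\<bar> * gauss_density x)"

text \<open>
  For \<open>0 < x \<le> 1\<close>, \<open>n = \<lfloor>1 / x\<rfloor>\<close> is the unique \<open>n\<close> with \<open>1 / (n + 1) < x \<le> 1 / n\<close>
  (\<open>psi_eq\<close> below).
\<close>
definition psi :: "(nat \<Rightarrow> real) \<Rightarrow> real \<Rightarrow> real \<Rightarrow> real" where
  "psi c \<mu> x = (if x = 0 then 0 else c (nat \<lfloor>1 / x\<rfloor>) + \<mu> * ln x)"

lemma psi_eq:
  assumes "1 \<le> n" "x \<in> {1 / (real n + 1)<..1 / real n}"
  shows "psi c \<mu> x = c n + \<mu> * ln x"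
proof -
  have "0 < 1 / (real n + 1)" by (simp add: add_pos_nonneg)
  also have "\<dots> < x" using assms by simp
  finally have x: "0 < x" .
  then have "real n \<le> 1 / x" "1 / x < real n + 1"
    using assms by (auto simp: field_simps)
  then have "\<lfloor>1 / x\<rfloor> = int n" by (simp add: floor_eq_iff)
  then show ?thesis using x by (simp add: psi_def)
qed

definition all_pairs :: "nat \<Rightarrow> (nat \<times> nat) set" where
  "all_pairs n = {(u, v). 1 \<le> u \<and> u < v \<and> v \<le> n}"

definition coprime_pairs :: "nat \<Rightarrow> (nat \<times> nat) set" where
  "coprime_pairs n = {(u, v) \<in> all_pairs n. gcd u v = 1}"

end

theory Submission
  imports Defs "HOL-Real_Asymp.Real_Asymp" "HOL-Computational_Algebra.Squarefree"
begin

text \<open>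
  Let a pair \<open>(u, v)\<close> be drawn with \<open>v \<le> n\<close>. A word of digits with last two continuant
  denominators \<open>q\<close> and \<open>q'\<close> is a prefix of \<open>u / v\<close> for as many pairs as there are \<open>(u', v')\<close>, \<open>u' < v'\<close>, with
  \<open>q v' + q' u' \<le> n\<close>; as long as \<open>q\<close> is smaller than \<open>n\<close> by a large factor, this number is asymptotically
  \<open>n\<^sup>2 / 2\<close> times the Lebesgue measure of the cylinder. Stopping the expansion when \<open>q\<close> first exceeds a small
  fraction of \<open>n\<close> leaves boundedly many digits unread, so the theorem becomes a central limit theorem for the
  digits of a Lebesgue random number, stopped at that time.

  Under Lebesgue measure the quotients \<open>q' / q\<close> form a Markov chain whose kernel is the normalised Gauss transfer
  operator, which contracts Lipschitz seminorms by the factor \<open>7 / 8\<close>. Solving two Poisson equations yields \<open>g\<close>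
  and \<open>u\<close> such that \<open>exp (i t (C - \<mu> log q)) q powr (\<sigma>2 t\<^sup>2 / 2) (1 + i t g + t\<^sup>2 u)\<close> is a martingale up to an error
  \<open>O(t\<^sup>3)\<close> per step. Optional stopping after \<open>O(log n)\<close> steps with \<open>t\<close> of order \<open>1 / sqrt (log n)\<close> gives the
  characteristic function. The variance is positive because a coboundary would be bounded,
  while \<open>c - \<mu> log\<close> is not. Coprime pairs follow from all pairs by Moebius inversion.
\<close>

subsection \<open>The digit kernel and its contraction\<close>

text \<open>One kernel, \<open>digit_wgt\<close>, plays two roles: it is the transition law of the
  quotient of the last two denominators under Lebesgue measure, and it is the time reversal of the
  Gauss map. For x distributed by \<open>gauss\<close> and k by \<open>digit_pmf x\<close>, the
  point \<open>branch k x\<close> is again distributed by \<open>gauss\<close>, and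
  \<open>gauss_map\<close> returns it to x. Hence the variance produced by the martingale is the one
  defined by Birkhoff sums.

  Words are stopped by size and not by length, so mean and variance are measured per unit of
  \<open>ln q\<close> rather than per digit. No analytic perturbation theory enters: an approximate
  eigenfunction, correct to second order in t, suffices, because log n errors of size t^3 add up to
  the order of 1 / sqrt (log n).

  The logarithm is unbounded; this forces the growth classes \<open>sqrt_lip\<close> and
  \<open>log_lip\<close> and a separate estimate for the step that crosses the level. Counting is
  one-sided: cylinders are only bounded from below, and upper bounds come from the complementary
  event.\<close>

definition branch :: "nat \<Rightarrow> real \<Rightarrow> real" where
  "branch k x = 1 / (real k + 1 + x)"

text \<open>The branch weight 1 / (k + 1 + x)^2 of the Gauss transfer operator, multiplied by
  \<open>gauss_density (branch k x) / gauss_density x\<close> so that the weights sum to 1. The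
  index k stands for the digit k + 1.\<close>

definition digit_wgt :: "nat \<Rightarrow> real \<Rightarrow> real" where
  "digit_wgt k x = (1 + x) / ((real k + 1 + x) * (real k + 2 + x))"

text \<open>The weights are the successive differences of this closed form, so normalisation, tail
  probabilities and summation by parts all become explicit.\<close>

definition digit_tail :: "nat \<Rightarrow> real \<Rightarrow> real" where
  "digit_tail k x = (1 + x) / (real k + 1 + x)"

definition digit_pmf :: "real \<Rightarrow> nat pmf" where
  "digit_pmf x = embed_pmf (\<lambda>k. digit_wgt k x)"

lemma branch_bounds:
  assumes "0 \<le> x"
  shows "0 < branch k x" "branch k x \<le> 1"
  using assms by (auto simp: branch_def divide_simps)

lemma branch_mem: "0 \<le> x \<Longrightarrow> branch k x \<in> {0..1}"
  using branch_bounds[of x k] by auto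

lemma digit_wgt_nonneg: "0 \<le> x \<Longrightarrow> 0 \<le> digit_wgt k x"
  by (simp add: digit_wgt_def)

lemma digit_wgt_pos: "0 \<le> x \<Longrightarrow> 0 < digit_wgt k x"
  by (simp add: digit_wgt_def)

lemma digit_wgt_digit_tail: "0 \<le> x \<Longrightarrow> digit_wgt k x = digit_tail k x - digit_tail (Suc k) x"
  by (simp add: digit_wgt_def digit_tail_def divide_simps) (simp add: algebra_simps)

lemma digit_tail_0: "0 \<le> x \<Longrightarrow> digit_tail 0 x = 1"
  by (simp add: digit_tail_def)

lemma digit_tail_tendsto: "(\<lambda>k. digit_tail k x) \<longlonglongrightarrow> 0"
  unfolding digit_tail_def by real_asymp

lemma digit_wgt_sums_shift:
  assumes "0 \<le> x"
  shows "(\<lambda>k. digit_wgt (k + j) x) sums digit_tail j x"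
proof -
  have "(\<lambda>k. digit_tail (k + j) x) \<longlonglongrightarrow> 0"
    using digit_tail_tendsto LIMSEQ_ignore_initial_segment by blast
  from telescope_sums'[OF this] show ?thesis
    using assms by (simp add: digit_wgt_digit_tail)
qed

lemma digit_wgt_sums: "0 \<le> x \<Longrightarrow> (\<lambda>k. digit_wgt k x) sums 1"
  using digit_wgt_sums_shift[of x 0] by (simp add: digit_tail_0)

lemma pmf_digit_pmf:
  assumes "0 \<le> x"
  shows "pmf (digit_pmf x) k = digit_wgt k x"
  unfolding digit_pmf_def
proof (rule pmf_embed_pmf)
  show "0 \<le> digit_wgt k x" for k using assms by (rule digit_wgt_nonneg)
  have "(\<Sum>k. ennreal (digit_wgt k x)) = ennreal (\<Sum>k. digit_wgt k x)"
    using digit_wgt_sums[OF assms] by (intro suminf_ennreal2 digit_wgt_nonneg assms) (simp add: sums_iff)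
  then show "(\<integral>\<^sup>+k. ennreal (digit_wgt k x) \<partial>count_space UNIV) = 1"
    using digit_wgt_sums[OF assms] by (simp add: nn_integral_count_space_nat sums_iff)
qed

lemma nn_integral_digit_pmf:
  assumes "0 \<le> x"
  shows "(\<integral>\<^sup>+k. f k \<partial>digit_pmf x) = (\<Sum>k. ennreal (digit_wgt k x) * f k)"
  using assms by (simp add: nn_integral_measure_pmf nn_integral_count_space_nat pmf_digit_pmf)

lemma digit_pmf_expectation_sums:
  fixes f :: "nat \<Rightarrow> 'b::{banach, second_countable_topology}"
  assumes "0 \<le> x" "integrable (digit_pmf x) f"
  shows "(\<lambda>k. digit_wgt k x *\<^sub>R f k) sums measure_pmf.expectation (digit_pmf x) f"
proof -
  have "integrable (count_space UNIV) (\<lambda>k. pmf (digit_pmf x) k *\<^sub>R f k)"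
    using assms(2) unfolding measure_pmf_eq_density by (subst (asm) integrable_density) auto
  from sums_integral_count_space_nat[OF this] show ?thesis
    unfolding measure_pmf_eq_density by (subst integral_density) (auto simp: pmf_digit_pmf digit_wgt_nonneg assms(1))
qed

lemma digit_pmf_prob_ge:
  assumes "0 \<le> x"
  shows "measure_pmf.prob (digit_pmf x) {j..} = digit_tail j x"
proof -
  have "(\<lambda>k. digit_wgt k x * indicator {j..} k) sums measure_pmf.expectation (digit_pmf x) (indicator {j..})"
    using digit_pmf_expectation_sums[of x "indicat_real {j..}"] assms
    by (simp add: measure_pmf.integrable_const_bound[where B=1])
  moreover have "(\<lambda>k. digit_wgt k x * indicat_real {j..} k) sums digit_tail j x"
    using digit_wgt_sums_shift[OF assms, of j]
    by (subst sums_iff_shift'[of _ j, symmetric]) (simp add: sums_iff_shift)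
  ultimately show ?thesis by (simp add: sums_iff)
qed

text \<open>For the two square roots a < b one has \<open>(b - a) * (a + b) = 1\<close>; bounding a
  + b by 2 b turns the weighted square root into a telescoping difference, so that the tail of this
  moment is bounded in closed form.\<close>

lemma digit_wgt_sqrt_le:
  assumes "0 \<le> x"
  shows "digit_wgt k x * sqrt (real k + 1 + x) \<le>
    2 * (1 + x) * (1 / sqrt (real k + 1 + x) - 1 / sqrt (real (Suc k) + 1 + x))"
proof -
  define a b where "a = sqrt (real k + 1 + x)" and "b = sqrt (real k + 2 + x)"
  have a: "0 < a" "a < b" and ab: "a\<^sup>2 = real k + 1 + x" "b\<^sup>2 = real k + 2 + x"
    using assms by (auto simp: a_def b_def)
  have d: "(b - a) * (a + b) = 1" using ab by (simp add: power2_eq_square algebra_simps)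
  have "digit_wgt k x * sqrt (real k + 1 + x) = (1 + x) / (a\<^sup>2 * b\<^sup>2) * a"
    unfolding ab by (simp add: digit_wgt_def a_def)
  also have "\<dots> = (1 + x) * ((b - a) * (a + b)) / (a * b * b)"
    unfolding d using a by (simp add: power2_eq_square)
  also have "\<dots> \<le> (1 + x) * ((b - a) * (2 * b)) / (a * b * b)"
    using a assms by (intro divide_right_mono mult_left_mono) auto
  also have "\<dots> = 2 * (1 + x) * (1 / a - 1 / b)"
    using a by (simp add: field_simps)
  finally show ?thesis by (simp add: a_def b_def add_ac)
qed

lemma sqrt_tail_sums:
  assumes "0 \<le> x"
  shows "(\<lambda>k. 2 * (1 + x) * (1 / sqrt (real (k + j) + 1 + x) - 1 / sqrt (real (Suc (k + j)) + 1 + x)))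
    sums (2 * (1 + x) / sqrt (real j + 1 + x))"
proof -
  have "(\<lambda>k. 1 / sqrt (real (k + j) + 1 + x)) \<longlonglongrightarrow> 0" by real_asymp
  from sums_mult[OF telescope_sums'[OF this], of "2 * (1 + x)"] show ?thesis
    by (simp)
qed

text \<open>The square root serves as the universal integrable majorant of the unbounded observables.\<close>
lemma nn_integral_digit_pmf_sqrt_tail:
  assumes "0 \<le> x"
  shows "(\<integral>\<^sup>+k. ennreal (sqrt (real k + 1 + x)) * indicator {j..} k \<partial>digit_pmf x)
    \<le> ennreal (2 * (1 + x) / sqrt (real j + 1 + x))"
proof -
  let ?g = "\<lambda>k. 2 * (1 + x) * (1 / sqrt (real k + 1 + x) - 1 / sqrt (real (Suc k) + 1 + x))"
  have nn: "0 \<le> ?g k" for k using assms by (simp add: frac_le)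
  have "(\<integral>\<^sup>+k. ennreal (sqrt (real k + 1 + x)) * indicator {j..} k \<partial>digit_pmf x)
      = (\<Sum>k. ennreal (digit_wgt k x * sqrt (real k + 1 + x)) * indicator {j..} k)"
    using assms by (simp add: nn_integral_digit_pmf ennreal_mult digit_wgt_nonneg mult_ac)
  also have "\<dots> = (\<Sum>k. ennreal (digit_wgt (k + j) x * sqrt (real (k + j) + 1 + x)) * indicator {j..} (k + j))
      + (\<Sum>k<j. ennreal (digit_wgt k x * sqrt (real k + 1 + x)) * indicator {j..} k)"
    by (rule suminf_offset) simp
  also have "\<dots> = (\<Sum>k. ennreal (digit_wgt (k + j) x * sqrt (real (k + j) + 1 + x)))"
    by simp
  also have "\<dots> \<le> (\<Sum>k. ennreal (?g (k + j)))"
    by (intro suminf_le ennreal_leI digit_wgt_sqrt_le[OF assms]) auto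
  also have "\<dots> = ennreal (\<Sum>k. ?g (k + j))"
    using sums_summable[OF sqrt_tail_sums[OF assms, of j]] by (intro suminf_ennreal2 nn)
  also have "(\<Sum>k. ?g (k + j)) = 2 * (1 + x) / sqrt (real j + 1 + x)"
    using sqrt_tail_sums[OF assms, of j] by (simp add: sums_iff)
  finally show ?thesis .
qed

lemma digit_pmf_sqrt:
  assumes "x \<in> {0..1}"
  shows "integrable (digit_pmf x) (\<lambda>k. sqrt (real k + 1 + x))"
    "measure_pmf.expectation (digit_pmf x) (\<lambda>k. sqrt (real k + 1 + x)) \<le> 3"
proof -
  have "2 * (1 + x) / sqrt (1 + x) = 2 * sqrt (1 + x)"
    using assms real_div_sqrt[of "1 + x"] by (metis atLeastAtMost_iff add_nonneg_nonneg times_divide_eq_right mult.assoc zero_le_one)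
  \<comment> \<open>Here 1 + x is at most 2 and 2 is below (3/2)^2. This is the origin of the
    constant 3 in all later moment bounds.\<close>
  also have "\<dots> \<le> 2 * sqrt ((3/2)\<^sup>2)" using assms by (intro mult_left_mono real_sqrt_le_mono) (auto simp: power2_eq_square)
  finally have "2 * (1 + x) / sqrt (1 + x) \<le> 3" by simp
  then have le: "(\<integral>\<^sup>+k. ennreal (sqrt (real k + 1 + x)) \<partial>digit_pmf x) \<le> ennreal 3"
    using nn_integral_digit_pmf_sqrt_tail[of x 0] assms
    by (intro order_trans[OF _ ennreal_leI[of "2 * (1 + x) / sqrt (1 + x)" 3]]) simp_all
  show int: "integrable (digit_pmf x) (\<lambda>k. sqrt (real k + 1 + x))"
    using le assms by (intro integrableI_bounded) (auto simp: order_le_less_trans)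
  show "measure_pmf.expectation (digit_pmf x) (\<lambda>k. sqrt (real k + 1 + x)) \<le> 3"
    using le assms by (subst integral_eq_nn_integral) (auto intro!: enn2real_leI)
qed

lemma digit_pmf_integrable:
  fixes f :: "nat \<Rightarrow> 'b::{banach, second_countable_topology}"
  assumes "x \<in> {0..1}" "\<And>k. norm (f k) \<le> A * sqrt (real k + 1 + x)"
  shows "integrable (digit_pmf x) f"
  by (rule Bochner_Integration.integrable_bound[OF integrable_mult_right[OF digit_pmf_sqrt(1)[OF assms(1)], of A]])
     (use assms in \<open>auto intro: order_trans[OF _ abs_ge_self]\<close>)

lemma digit_pmf_expectation_bound:
  fixes f :: "nat \<Rightarrow> 'b::{banach, second_countable_topology}"
  assumes "x \<in> {0..1}" "\<And>k. norm (f k) \<le> A * sqrt (real k + 1 + x)"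
  shows "norm (measure_pmf.expectation (digit_pmf x) f) \<le> 3 * A"
proof -
  have "0 \<le> A * sqrt (real 0 + 1 + x)" using assms(2)[of 0] norm_ge_zero order_trans by blast
  then have A: "0 \<le> A" using assms(1) by (auto simp: zero_le_mult_iff)
  have "norm (measure_pmf.expectation (digit_pmf x) f) \<le> measure_pmf.expectation (digit_pmf x) (\<lambda>k. norm (f k))"
    by simp
  also have "\<dots> \<le> measure_pmf.expectation (digit_pmf x) (\<lambda>k. A * sqrt (real k + 1 + x))"
    using assms digit_pmf_integrable[OF assms] digit_pmf_sqrt(1)[OF assms(1)] by (intro integral_mono) auto
  also have "\<dots> \<le> A * 3"
    using digit_pmf_sqrt(2)[OF assms(1)] A by (simp add: mult_left_mono)
  finally show ?thesis by simp
qed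

lemma digit_pmf_integrable_bounded:
  fixes f :: "nat \<Rightarrow> 'b::{banach, second_countable_topology}"
  assumes "\<And>k. norm (f k) \<le> B"
  shows "integrable (digit_pmf x) f"
  using assms by (intro measure_pmf.integrable_const_bound[where B=B]) auto

lemma digit_pmf_expectation_bounded:
  fixes f :: "nat \<Rightarrow> real"
  assumes "\<And>k. \<bar>f k\<bar> \<le> B"
  shows "\<bar>measure_pmf.expectation (digit_pmf x) f\<bar> \<le> B"
proof -
  have "\<bar>measure_pmf.expectation (digit_pmf x) f\<bar> \<le> measure_pmf.expectation (digit_pmf x) (\<lambda>k. \<bar>f k\<bar>)"
    using integral_norm_bound[of "digit_pmf x" f] by simp
  also have "\<dots> \<le> measure_pmf.expectation (digit_pmf x) (\<lambda>k. B)"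
    using assms digit_pmf_integrable_bounded[of "\<lambda>k. \<bar>f k\<bar>" B x] by (intro integral_mono) auto
  finally show ?thesis by simp
qed

text \<open>Summation by parts. The boundary term at index 0 vanishes because every tail equals 1
  there, and only increments of f remain, apart from the boundary term at n.\<close>

lemma digit_wgt_diff_abel:
  assumes "0 \<le> x" "0 \<le> y"
  shows "(\<Sum>k<n. (digit_wgt k x - digit_wgt k y) * f k) =
    (\<Sum>k<n. (digit_tail (Suc k) x - digit_tail (Suc k) y) * (f (Suc k) - f k)) - (digit_tail n x - digit_tail n y) * f n"
  by (induction n) (use assms in \<open>auto simp: digit_tail_0 digit_wgt_digit_tail algebra_simps\<close>)

lemma digit_tail_diff:
  assumes "0 \<le> x" "0 \<le> y"
  shows "digit_tail k x - digit_tail k y = real k * (x - y) / ((real k + 1 + x) * (real k + 1 + y))"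
  using assms by (simp add: digit_tail_def divide_simps) (simp add: algebra_simps)

text \<open>Telescoping against 1 / (2 (n + 1) (n + 2)). The value 1/4 becomes the share of the
  varying weights in the contraction factor.\<close>

lemma sum_inverse_cubes_le: "(\<Sum>k<n. 1 / (real k + 2) ^ 3) \<le> 1 / 4"
proof -
  have "(\<Sum>k<n. 1 / (real k + 2) ^ 3) \<le> 1/4 - 1 / (2 * (real n + 1) * (real n + 2))"
  proof (induction n)
    case (Suc n)
    have "1 / (real n + 2) ^ 3 \<le> 1 / (2 * (real n + 1) * (real n + 2)) - 1 / (2 * (real (Suc n) + 1) * (real (Suc n) + 2))"
      by (simp add: divide_simps) (simp add: algebra_simps power3_eq_cube)
    with Suc show ?case by simp
  qed simp
  also have "\<dots> \<le> 1/4" by simp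
  finally show ?thesis .
qed

text \<open>The integrand is the factor by which \<open>branch k\<close> contracts the distance of x
  and y. Index 0, of probability 1 / (2 + x), is kept apart with the bound 1 / (1 + x); all larger
  indices are bounded through k = 1. The resulting majorant takes its largest value 5/8 at x =
  0.\<close>

lemma digit_pmf_two_point_bound:
  assumes "x \<in> {0..1}" "y \<in> {0..1}"
  shows "measure_pmf.expectation (digit_pmf x) (\<lambda>k. 1 / ((real k + 1 + x) * (real k + 1 + y))) \<le> 5 / 8"
proof -
  let ?f = "\<lambda>k. 1 / ((real k + 1 + x) * (real k + 1 + y))"
  let ?g = "\<lambda>k. 1 / (2 * (2 + x)) + (1 / (1 + x) - 1 / (2 * (2 + x))) * indicat_real {0} k"
  have le: "?f k \<le> ?g k" for k
  proof (cases k)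
    case 0
    then show ?thesis using assms by (simp add: frac_le mult_left_mono)
  next
    case (Suc j)
    have "(2 + x) * 2 \<le> (real k + 1 + x) * (real k + 1 + y)"
      using assms Suc by (intro mult_mono) auto
    then show ?thesis using assms Suc by (simp add: frac_le mult_ac)
  qed
  have "measure_pmf.expectation (digit_pmf x) ?f \<le> measure_pmf.expectation (digit_pmf x) ?g"
  proof (intro integral_mono le)
    show "integrable (digit_pmf x) ?f"
      by (rule digit_pmf_integrable_bounded[where B=1])
        (use assms in \<open>auto simp: divide_simps intro!: mult_ge1_I[of _ _] mult_mono[of 1 _ 1, simplified]\<close>)
    show "integrable (digit_pmf x) ?g"
      by (intro Bochner_Integration.integrable_add integrable_mult_right measure_pmf.integrable_const
          measure_pmf.integrable_const_bound[where B=1]) auto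
  qed
  also have "\<dots> = 1 / (2 * (2 + x)) + (1 / (1 + x) - 1 / (2 * (2 + x))) * digit_wgt 0 x"
  proof -
    have "integrable (digit_pmf x) (indicat_real {0})"
      by (rule measure_pmf.integrable_const_bound[where B=1]) auto
    then show ?thesis using assms by (simp add: pmf_digit_pmf measure_pmf_single)
  qed
  also have "\<dots> \<le> 5/8"
  proof -
    have eq: "1 / (2 * (2 + x)) + (1 / (1 + x) - 1 / (2 * (2 + x))) * digit_wgt 0 x
      = (2 + x + (3 + x) / (2 + x) * 1 + (1 + x) - (2 + x)) / (2 * (2 + x) * 1 * (1 + x))"
      using assms by (simp add: digit_wgt_def divide_simps)
    have "(2 + x + (3 + x) / (2 + x) * 1 + (1 + x) - (2 + x)) \<le> 1 + x + 3 / 2"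
      using assms by (simp add: divide_simps) (simp add: algebra_simps)
    also have "\<dots> \<le> 5 / 8 * (2 * (2 + x) * 1 * (1 + x))"
    proof -
      have "5 / 8 * (2 * (2 + x) * 1 * (1 + x)) = 5 / 2 + 15 / 4 * x + 5 / 4 * (x * x)"
        by (simp add: algebra_simps)
      moreover have "0 \<le> x * x" by simp
      ultimately show ?thesis using assms by auto
    qed
    finally show ?thesis unfolding eq using assms by (simp add: pos_divide_le_eq)
  qed
  finally show ?thesis .
qed


section \<open>The Lipschitz contraction of the normalised transfer operator\<close>

lemma LIMSEQ_bound_add_null:
  fixes s :: "nat \<Rightarrow> real"
  assumes "s \<longlonglongrightarrow> l" "e \<longlonglongrightarrow> 0" "\<And>n. \<bar>s n\<bar> \<le> b + e n"
  shows "\<bar>l\<bar> \<le> b"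
proof (rule LIMSEQ_le)
  show "(\<lambda>n. \<bar>s n\<bar>) \<longlonglongrightarrow> \<bar>l\<bar>" using assms(1) by (rule tendsto_rabs)
  show "(\<lambda>n. b + e n) \<longlonglongrightarrow> b" using tendsto_add[OF tendsto_const assms(2), of b] by simp
qed (use assms(3) in auto)

lemma branch_diff:
  assumes "0 \<le> x" "0 \<le> y"
  shows "\<bar>branch k x - branch k y\<bar> = \<bar>x - y\<bar> * (1 / ((real k + 1 + x) * (real k + 1 + y)))"
proof -
  have "branch k x - branch k y = (y - x) * (1 / ((real k + 1 + x) * (real k + 1 + y)))"
    using assms by (simp add: branch_def divide_simps)
  then show ?thesis using assms by (simp add: abs_mult abs_minus_commute)
qed

lemma lipschitz_bounded:
  fixes f :: "real \<Rightarrow> real"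
  assumes "\<And>a b. a \<in> {0..1} \<Longrightarrow> b \<in> {0..1} \<Longrightarrow> \<bar>f a - f b\<bar> \<le> L * \<bar>a - b\<bar>" "a \<in> {0..1}"
  shows "\<bar>f a\<bar> \<le> \<bar>f 0\<bar> + L"
proof -
  have "0 \<le> L" using assms(1)[of 0 1] by simp
  then have "L * \<bar>a - 0\<bar> \<le> L * 1" using assms(2) by (intro mult_left_mono) auto
  then show ?thesis using assms(1)[of a 0] assms(2) by auto
qed

definition gauss_op :: "(real \<Rightarrow> real) \<Rightarrow> real \<Rightarrow> real" where
  "gauss_op f x = measure_pmf.expectation (digit_pmf x) (\<lambda>k. f (branch k x))"

text \<open>Two effects are separated. Moving the branch points under fixed weights contributes 5/8;
  moving the weights at fixed points contributes 1/4. The second is estimated after summation by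
  parts: a termwise estimate of the weights would bring in the sup norm of f, whereas increments of
  f along neighbouring branches only involve its Lipschitz constant.\<close>

lemma gauss_op_lipschitz:
  assumes lip: "\<And>a b. a \<in> {0..1} \<Longrightarrow> b \<in> {0..1} \<Longrightarrow> \<bar>f a - f b\<bar> \<le> L * \<bar>a - b\<bar>"
    and x: "x \<in> {0..1}" and y: "y \<in> {0..1}"
  shows "\<bar>gauss_op f x - gauss_op f y\<bar> \<le> 7 / 8 * L * \<bar>x - y\<bar>"
proof -
  have L: "0 \<le> L" using lip[of 0 1] by simp
  define B where "B = \<bar>f 0\<bar> + L"
  have bd: "\<bar>f a\<bar> \<le> B" if "a \<in> {0..1}" for a
    unfolding B_def using lipschitz_bounded[of f L, OF lip that] .
  have B: "0 \<le> B" using bd[of 0] by simp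
  have int: "integrable (digit_pmf z) (\<lambda>k. f (branch k w))" if "w \<in> {0..1}" for z w
    using that bd branch_mem by (intro digit_pmf_integrable_bounded[where B=B]) auto
  have 1: "\<bar>measure_pmf.expectation (digit_pmf x) (\<lambda>k. f (branch k x)) - measure_pmf.expectation (digit_pmf x) (\<lambda>k. f (branch k y))\<bar>
    \<le> 5 / 8 * L * \<bar>x - y\<bar>"
  proof -
    have "\<bar>measure_pmf.expectation (digit_pmf x) (\<lambda>k. f (branch k x)) - measure_pmf.expectation (digit_pmf x) (\<lambda>k. f (branch k y))\<bar>
        = \<bar>measure_pmf.expectation (digit_pmf x) (\<lambda>k. f (branch k x) - f (branch k y))\<bar>"
      using x y by (simp add: int)
    also have "\<dots> \<le> measure_pmf.expectation (digit_pmf x) (\<lambda>k. \<bar>f (branch k x) - f (branch k y)\<bar>)"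
      using integral_norm_bound[of "digit_pmf x" "\<lambda>k. f (branch k x) - f (branch k y)"] by simp
    also have "\<dots> \<le> measure_pmf.expectation (digit_pmf x)
        (\<lambda>k. (L * \<bar>x - y\<bar>) * (1 / ((real k + 1 + x) * (real k + 1 + y))))"
    proof (rule integral_mono)
      show "integrable (digit_pmf x) (\<lambda>k. \<bar>f (branch k x) - f (branch k y)\<bar>)"
        using x y by (intro integrable_abs Bochner_Integration.integrable_diff int)
      have "1 \<le> (real k + 1 + x) * (real k + 1 + y)" for k
        using x y by (intro mult_ge1_I) auto
      then have "norm (1 / ((real k + 1 + x) * (real k + 1 + y))) \<le> 1" for k
        by (smt (verit) divide_le_eq_1 divide_nonneg_pos real_norm_def)
      then show "integrable (digit_pmf x) (\<lambda>k. (L * \<bar>x - y\<bar>) * (1 / ((real k + 1 + x) * (real k + 1 + y))))"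
        by (intro integrable_mult_right digit_pmf_integrable_bounded[where B=1])
      show "\<bar>f (branch k x) - f (branch k y)\<bar> \<le> (L * \<bar>x - y\<bar>) * (1 / ((real k + 1 + x) * (real k + 1 + y)))" for k
        using lip[OF branch_mem branch_mem, of x y k k] x y branch_diff[of x y k] by (simp add: mult.assoc)
    qed
    also have "\<dots> \<le> (L * \<bar>x - y\<bar>) * (5 / 8)"
      unfolding integral_mult_right_zero
      using digit_pmf_two_point_bound[OF x y] L by (intro mult_left_mono) auto
    finally show ?thesis by (simp add: mult_ac)
  qed
  have 2: "\<bar>measure_pmf.expectation (digit_pmf x) (\<lambda>k. f (branch k y)) - measure_pmf.expectation (digit_pmf y) (\<lambda>k. f (branch k y))\<bar>
    \<le> 1 / 4 * L * \<bar>x - y\<bar>"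
  proof (rule LIMSEQ_bound_add_null)
    show "(\<lambda>n. \<Sum>k<n. (digit_wgt k x - digit_wgt k y) * f (branch k y)) \<longlonglongrightarrow>
      measure_pmf.expectation (digit_pmf x) (\<lambda>k. f (branch k y)) - measure_pmf.expectation (digit_pmf y) (\<lambda>k. f (branch k y))"
      using sums_diff[OF digit_pmf_expectation_sums[OF _ int] digit_pmf_expectation_sums[OF _ int], of x y y y] x y
      by (simp add: sums_def left_diff_distrib)
    show "(\<lambda>n. B * (1 / (real n + 1))) \<longlonglongrightarrow> 0" by real_asymp
    fix n
    have d: "\<bar>digit_tail n x - digit_tail n y\<bar> \<le> real n * \<bar>x - y\<bar> / ((real n + 1) * (real n + 1))" for n
    proof -
      have "\<bar>digit_tail n x - digit_tail n y\<bar> = real n * \<bar>x - y\<bar> / ((real n + 1 + x) * (real n + 1 + y))"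
        using x y digit_tail_diff[of x y n] by (simp add: abs_mult)
      also have "\<dots> \<le> real n * \<bar>x - y\<bar> / ((real n + 1) * (real n + 1))"
        using x y by (intro divide_left_mono mult_mono mult_pos_pos) auto
      finally show ?thesis .
    qed
    have t1: "\<bar>\<Sum>k<n. (digit_tail (Suc k) x - digit_tail (Suc k) y) * (f (branch (Suc k) y) - f (branch k y))\<bar> \<le> 1 / 4 * L * \<bar>x - y\<bar>"
    proof -
      have "\<bar>\<Sum>k<n. (digit_tail (Suc k) x - digit_tail (Suc k) y) * (f (branch (Suc k) y) - f (branch k y))\<bar>
        \<le> (\<Sum>k<n. \<bar>(digit_tail (Suc k) x - digit_tail (Suc k) y) * (f (branch (Suc k) y) - f (branch k y))\<bar>)"
        by (rule sum_abs)
      also have "\<dots> \<le> (\<Sum>k<n. (L * \<bar>x - y\<bar>) * (1 / (real k + 2) ^ 3))"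
      proof (rule sum_mono)
        fix k
        have "\<bar>branch (Suc k) y - branch k y\<bar> = 1 / ((real k + 1 + y) * (real k + 2 + y))"
          using y by (simp add: branch_def divide_simps)
        also have "\<dots> \<le> 1 / ((real k + 1) * (real k + 2))"
          using y by (intro divide_left_mono mult_mono mult_pos_pos) auto
        finally have "\<bar>f (branch (Suc k) y) - f (branch k y)\<bar> \<le> L * (1 / ((real k + 1) * (real k + 2)))"
          using lip[OF branch_mem branch_mem, of y y "Suc k" k] y L by (meson atLeastAtMost_iff mult_left_mono order_trans)
        moreover have "\<bar>digit_tail (Suc k) x - digit_tail (Suc k) y\<bar> \<le> (real k + 1) * \<bar>x - y\<bar> / ((real k + 2) * (real k + 2))"
          using d[of "Suc k"] by (simp add: add_ac)
        ultimately have "\<bar>(digit_tail (Suc k) x - digit_tail (Suc k) y) * (f (branch (Suc k) y) - f (branch k y))\<bar>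
          \<le> (real k + 1) * \<bar>x - y\<bar> / ((real k + 2) * (real k + 2)) * (L * (1 / ((real k + 1) * (real k + 2))))"
          unfolding abs_mult by (intro mult_mono) auto
        also have "\<dots> = (L * \<bar>x - y\<bar>) * (1 / (real k + 2) ^ 3)"
          by (simp add: divide_simps power3_eq_cube)
        finally show "\<bar>(digit_tail (Suc k) x - digit_tail (Suc k) y) * (f (branch (Suc k) y) - f (branch k y))\<bar>
          \<le> (L * \<bar>x - y\<bar>) * (1 / (real k + 2) ^ 3)" .
      qed
      also have "\<dots> \<le> (L * \<bar>x - y\<bar>) * (1 / 4)"
        unfolding sum_distrib_left[symmetric] using sum_inverse_cubes_le L by (intro mult_left_mono) auto
      finally show ?thesis by (simp add: mult_ac)
    qed
    \<comment> \<open>The boundary term is controlled by the sup norm B only, but it is of order 1 /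
      n and disappears in the limit.\<close>
    have t2: "\<bar>(digit_tail n x - digit_tail n y) * f (branch n y)\<bar> \<le> B * (1 / (real n + 1))"
    proof -
      have "real n * \<bar>x - y\<bar> / ((real n + 1) * (real n + 1)) \<le> (real n + 1) * 1 / ((real n + 1) * (real n + 1))"
        using x y by (intro divide_right_mono mult_mono) auto
      then have "\<bar>digit_tail n x - digit_tail n y\<bar> \<le> 1 / (real n + 1)"
        using d[of n] by simp
      then have "\<bar>(digit_tail n x - digit_tail n y) * f (branch n y)\<bar> \<le> 1 / (real n + 1) * B"
        unfolding abs_mult using bd[OF branch_mem[of y n]] y B by (intro mult_mono) auto
      then show ?thesis by simp
    qed
    show "\<bar>\<Sum>k<n. (digit_wgt k x - digit_wgt k y) * f (branch k y)\<bar> \<le> 1 / 4 * L * \<bar>x - y\<bar> + B * (1 / (real n + 1))"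
      using t1 t2 digit_wgt_diff_abel[of x y "\<lambda>k. f (branch k y)" n] x y by auto
  qed
  show ?thesis using 1 2 unfolding gauss_op_def by linarith
qed


section \<open>Unbounded observables and their averages over one digit\<close>

definition branch_mean :: "(nat \<Rightarrow> real \<Rightarrow> real) \<Rightarrow> real \<Rightarrow> real" where
  "branch_mean F x = measure_pmf.expectation (digit_pmf x) (\<lambda>k. F k x)"

text \<open>Both the size and the Lipschitz constant may grow with the digit, but no faster than the
  square root, whose mean under the digit law is at most 3 uniformly in x.\<close>

definition sqrt_lip :: "(nat \<Rightarrow> real \<Rightarrow> real) \<Rightarrow> real \<Rightarrow> bool" where
  "sqrt_lip F A \<longleftrightarrow> (\<forall>k. \<forall>x\<in>{0..1}. \<bar>F k x\<bar> \<le> A * sqrt (real k + 1)) \<and>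
     (\<forall>k. \<forall>x\<in>{0..1}. \<forall>y\<in>{0..1}. \<bar>F k x - F k y\<bar> \<le> A * sqrt (real k + 1) * \<bar>x - y\<bar>)"

text \<open>A relative Lipschitz bound: the error is proportional to the weight itself and can
  therefore be summed against unbounded observables.\<close>

lemma digit_wgt_diff_le:
  assumes "x \<in> {0..1}" "y \<in> {0..1}"
  shows "\<bar>digit_wgt k x - digit_wgt k y\<bar> \<le> 2 * \<bar>x - y\<bar> * digit_wgt k y"
proof -
  define a where "a = real k + 1"
  have a: "1 \<le> a" by (simp add: a_def)
  have xy: "0 \<le> x" "x \<le> 1" "0 \<le> y" "y \<le> 1" using assms by auto
  \<comment> \<open>The cofactor of x - y when the difference of the two weights is written over a
    common denominator.\<close>
  define N where "N = a * (a + 1) - (2 * a + 1) - (x + y) - x * y"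
  have P: "0 < (a + x) * (a + 1 + x)" "0 < (a + y) * (a + 1 + y)" using xy a by simp_all
  have w: "digit_wgt k z = (1 + z) / ((a + z) * (a + 1 + z))" for z
    by (simp add: digit_wgt_def a_def add_ac)
  have "(1 + x) * ((a + y) * (a + 1 + y)) - (1 + y) * ((a + x) * (a + 1 + x)) = (x - y) * N"
    unfolding N_def by (simp only: algebra_simps)
  then have "digit_wgt k x - digit_wgt k y = (x - y) * N / (((a + x) * (a + 1 + x)) * ((a + y) * (a + 1 + y)))"
    unfolding w diff_frac_eq[OF less_imp_neq[OF P(1), symmetric] less_imp_neq[OF P(2), symmetric]] by (simp only:)
  then have eq: "\<bar>digit_wgt k x - digit_wgt k y\<bar> = \<bar>x - y\<bar> * \<bar>N\<bar> / (((a + x) * (a + 1 + x)) * ((a + y) * (a + 1 + y)))"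
    using xy a by (simp add: abs_mult)
  have "x * y \<le> 1" using xy by (simp add: mult_le_one)
  have "1 * a \<le> a * a" using a by (intro mult_right_mono) auto
  define t p where "t = a * a" and "p = x * y"
  have tp: "a \<le> t" "0 \<le> p" "p \<le> 1"
    using xy \<open>1 * a \<le> a * a\<close> \<open>x * y \<le> 1\<close> by (auto simp: t_def p_def)
  have N': "N = t + a - 2 * a - 1 - (x + y) - p" by (simp add: N_def t_def p_def algebra_simps)
  have "\<bar>N\<bar> \<le> 2 * (t + a)"
    unfolding N' abs_le_iff using xy a tp by auto
  then have "\<bar>N\<bar> \<le> 2 * (a * (a + 1))" by (simp add: t_def algebra_simps)
  also have "\<dots> \<le> 2 * ((a + x) * (a + 1 + x))"
    using xy a by (intro mult_left_mono mult_mono) auto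
  finally have N: "\<bar>N\<bar> \<le> 2 * ((a + x) * (a + 1 + x))" .
  have "\<bar>digit_wgt k x - digit_wgt k y\<bar> \<le> \<bar>x - y\<bar> * (2 * ((a + x) * (a + 1 + x))) / (((a + x) * (a + 1 + x)) * ((a + y) * (a + 1 + y)))"
    unfolding eq using N xy a by (intro divide_right_mono mult_left_mono) auto
  also have "\<dots> = 2 * \<bar>x - y\<bar> * (1 / ((a + y) * (a + 1 + y)))"
    using P(1) nonzero_mult_divide_mult_cancel_left[of "(a + x) * (a + 1 + x)" "2 * \<bar>x - y\<bar>" "(a + y) * (a + 1 + y)"]
    by (simp only: mult_ac mult_1_right times_divide_eq_right less_irrefl)
  also have "\<dots> \<le> 2 * \<bar>x - y\<bar> * digit_wgt k y"
    unfolding digit_wgt_def a_def using xy by (intro mult_left_mono) (auto simp: add_ac divide_right_mono)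
  finally show ?thesis .
qed

lemma sqrt_lipD:
  assumes "sqrt_lip F A" "x \<in> {0..1}"
  shows "\<bar>F k x\<bar> \<le> A * sqrt (real k + 1)" "0 \<le> A"
proof -
  show *: "\<bar>F k x\<bar> \<le> A * sqrt (real k + 1)" for k using assms by (auto simp: sqrt_lip_def)
  show "0 \<le> A" using *[of 0] abs_ge_zero[of "F 0 x"] by (simp del: abs_ge_zero)
qed

lemma sqrt_lipD_digit_pmf:
  assumes "sqrt_lip F A" "x \<in> {0..1}" "y \<in> {0..1}"
  shows "\<bar>F k x\<bar> \<le> A * sqrt (real k + 1 + y)"
proof -
  have "A * sqrt (real k + 1) \<le> A * sqrt (real k + 1 + y)"
    using sqrt_lipD(2)[OF assms(1,2)] assms(3) by (intro mult_left_mono real_sqrt_le_mono) auto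
  then show ?thesis using sqrt_lipD(1)[OF assms(1,2), of k] by simp
qed

lemma sqrt_lip_lip_digit_pmf:
  assumes "sqrt_lip F A" "x \<in> {0..1}" "y \<in> {0..1}" "z \<in> {0..1}"
  shows "\<bar>F k x - F k y\<bar> \<le> (A * \<bar>x - y\<bar>) * sqrt (real k + 1 + z)"
proof -
  have "\<bar>F k x - F k y\<bar> \<le> A * sqrt (real k + 1) * \<bar>x - y\<bar>"
    using assms by (auto simp: sqrt_lip_def)
  also have "\<dots> \<le> A * sqrt (real k + 1 + z) * \<bar>x - y\<bar>"
    using sqrt_lipD(2)[OF assms(1,2)] assms(4) by (intro mult_right_mono mult_left_mono real_sqrt_le_mono) auto
  finally show ?thesis by (simp add: mult_ac)
qed

lemma sqrt_lip_integrable: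
  assumes "sqrt_lip F A" "x \<in> {0..1}" "y \<in> {0..1}"
  shows "integrable (digit_pmf y) (\<lambda>k. F k x)"
  using assms sqrt_lipD_digit_pmf[OF assms] by (intro digit_pmf_integrable[where A=A]) auto

text \<open>Averaging over one digit turns an unbounded observable into a Lipschitz function. The
  variation of F under a fixed law gives 3 A, and the variation of the law gives twice the moment
  bound 3 A.\<close>

lemma branch_mean_lipschitz:
  assumes F: "sqrt_lip F A" and x: "x \<in> {0..1}" and y: "y \<in> {0..1}"
  shows "\<bar>branch_mean F x - branch_mean F y\<bar> \<le> 9 * A * \<bar>x - y\<bar>"
proof -
  note int = sqrt_lip_integrable[OF F]
  have 1: "\<bar>measure_pmf.expectation (digit_pmf x) (\<lambda>k. F k x - F k y)\<bar> \<le> 3 * (A * \<bar>x - y\<bar>)"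
    using digit_pmf_expectation_bound[of x "\<lambda>k. F k x - F k y" "A * \<bar>x - y\<bar>"] x y sqrt_lip_lip_digit_pmf[OF F x y x] by simp
  have s: "(\<lambda>k. (digit_wgt k x - digit_wgt k y) * F k y) sums
    (measure_pmf.expectation (digit_pmf x) (\<lambda>k. F k y) - measure_pmf.expectation (digit_pmf y) (\<lambda>k. F k y))"
    using sums_diff[OF digit_pmf_expectation_sums[OF _ int[OF y x]] digit_pmf_expectation_sums[OF _ int[OF y y]]] x y
    by (simp add: left_diff_distrib)
  have s': "(\<lambda>k. 2 * \<bar>x - y\<bar> * (digit_wgt k y * \<bar>F k y\<bar>)) sums
    (2 * \<bar>x - y\<bar> * measure_pmf.expectation (digit_pmf y) (\<lambda>k. \<bar>F k y\<bar>))"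
    using sums_mult[OF digit_pmf_expectation_sums[OF _ integrable_abs[OF int[OF y y]]]] y by simp
  have "\<bar>measure_pmf.expectation (digit_pmf x) (\<lambda>k. F k y) - measure_pmf.expectation (digit_pmf y) (\<lambda>k. F k y)\<bar>
    \<le> 2 * \<bar>x - y\<bar> * measure_pmf.expectation (digit_pmf y) (\<lambda>k. \<bar>F k y\<bar>)"
  proof -
    have "\<bar>(digit_wgt k x - digit_wgt k y) * F k y\<bar> \<le> 2 * \<bar>x - y\<bar> * (digit_wgt k y * \<bar>F k y\<bar>)" for k
      using mult_right_mono[OF digit_wgt_diff_le[OF x y, of k], of "\<bar>F k y\<bar>"] by (simp add: abs_mult mult_ac)
    then have "norm (\<Sum>k. (digit_wgt k x - digit_wgt k y) * F k y) \<le> (\<Sum>k. 2 * \<bar>x - y\<bar> * (digit_wgt k y * \<bar>F k y\<bar>))"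
      using s' by (intro norm_suminf_le) (auto simp: sums_iff)
    then show ?thesis using s s' by (simp add: sums_iff)
  qed
  also have "\<dots> \<le> 2 * \<bar>x - y\<bar> * (3 * A)"
    using digit_pmf_expectation_bound[of y "\<lambda>k. \<bar>F k y\<bar>" A] y sqrt_lipD_digit_pmf[OF F y y]
    by (intro mult_left_mono) auto
  also have "\<dots> = 6 * (A * \<bar>x - y\<bar>)" by simp
  finally have 2: "\<bar>measure_pmf.expectation (digit_pmf x) (\<lambda>k. F k y) - measure_pmf.expectation (digit_pmf y) (\<lambda>k. F k y)\<bar>
    \<le> 6 * (A * \<bar>x - y\<bar>)" .
  have "branch_mean F x - branch_mean F y = measure_pmf.expectation (digit_pmf x) (\<lambda>k. F k x - F k y) +
    (measure_pmf.expectation (digit_pmf x) (\<lambda>k. F k y) - measure_pmf.expectation (digit_pmf y) (\<lambda>k. F k y))"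
    using int x y by (simp add: branch_mean_def)
  then show ?thesis using 1 2 by linarith
qed

section \<open>Neumann series for the transfer operator\<close>

lemma gauss_op_diff_le:
  assumes "x \<in> {0..1}" "\<And>a. a \<in> {0..1} \<Longrightarrow> \<bar>f a - h a\<bar> \<le> e"
    "\<And>a. a \<in> {0..1} \<Longrightarrow> \<bar>f a\<bar> \<le> B" "\<And>a. a \<in> {0..1} \<Longrightarrow> \<bar>h a\<bar> \<le> B'"
  shows "\<bar>gauss_op f x - gauss_op h x\<bar> \<le> e"
proof -
  have "gauss_op f x - gauss_op h x = measure_pmf.expectation (digit_pmf x) (\<lambda>k. f (branch k x) - h (branch k x))"
    unfolding gauss_op_def using assms(1,3,4) branch_mem[of x] digit_pmf_integrable_bounded[of "\<lambda>k. f (branch k x)" B x]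
      digit_pmf_integrable_bounded[of "\<lambda>k. h (branch k x)" B' x] by simp
  also have "\<bar>\<dots>\<bar> \<le> e" using assms branch_mem[of x] by (intro digit_pmf_expectation_bounded) auto
  finally show ?thesis .
qed

lemma gauss_op_add:
  assumes "x \<in> {0..1}" "\<And>a. a \<in> {0..1} \<Longrightarrow> \<bar>f a\<bar> \<le> B" "\<And>a. a \<in> {0..1} \<Longrightarrow> \<bar>h a\<bar> \<le> B'"
  shows "gauss_op (\<lambda>a. f a + h a) x = gauss_op f x + gauss_op h x"
  unfolding gauss_op_def using assms branch_mem[of x] digit_pmf_integrable_bounded[of "\<lambda>k. f (branch k x)" B x]
      digit_pmf_integrable_bounded[of "\<lambda>k. h (branch k x)" B' x] by simp

lemma gauss_op_iter_lipschitz: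
  assumes "\<And>a b. a \<in> {0..1} \<Longrightarrow> b \<in> {0..1} \<Longrightarrow> \<bar>f a - f b\<bar> \<le> L * \<bar>a - b\<bar>"
    "x \<in> {0..1}" "y \<in> {0..1}"
  shows "\<bar>(gauss_op ^^ j) f x - (gauss_op ^^ j) f y\<bar> \<le> L * (7 / 8) ^ j * \<bar>x - y\<bar>"
  using assms(2,3)
proof (induction j arbitrary: x y)
  case (Suc j)
  then show ?case using gauss_op_lipschitz[of "(gauss_op ^^ j) f" "L * (7 / 8) ^ j" x y] by (simp add: mult_ac)
qed (use assms(1) in simp)

text \<open>The solution is the sum of all iterates of f, and 8 is the sum of the geometric series
  with ratio 7/8. Decay in sup norm is a separate assumption, because constants are fixed by the
  operator and invisible to the seminorm; it will be supplied by mean zero.\<close>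

lemma neumann_series:
  assumes lip: "\<And>a b. a \<in> {0..1} \<Longrightarrow> b \<in> {0..1} \<Longrightarrow> \<bar>f a - f b\<bar> \<le> L * \<bar>a - b\<bar>"
    and bd: "\<And>j a. a \<in> {0..1} \<Longrightarrow> \<bar>(gauss_op ^^ j) f a\<bar> \<le> L * (7 / 8) ^ j"
  obtains g where "\<And>x. x \<in> {0..1} \<Longrightarrow> g x = f x + gauss_op g x"
    "\<And>x. x \<in> {0..1} \<Longrightarrow> \<bar>g x\<bar> \<le> 8 * L"
    "\<And>x y. x \<in> {0..1} \<Longrightarrow> y \<in> {0..1} \<Longrightarrow> \<bar>g x - g y\<bar> \<le> 8 * L * \<bar>x - y\<bar>"
proof
  have L: "0 \<le> L" using lip[of 0 1] by simp
  define g where "g x = (\<Sum>j. (gauss_op ^^ j) f x)" for x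
  define gn where "gn n x = (\<Sum>j<n. (gauss_op ^^ j) f x)" for n x
  have geo: "summable (\<lambda>j. L * (7 / 8 :: real) ^ j)" "(\<Sum>j. L * (7 / 8 :: real) ^ j) = 8 * L"
    using sums_mult[OF geometric_sums[of "7/8::real"], of L] by (auto simp: sums_iff)
  have summ: "summable (\<lambda>j. (gauss_op ^^ j) f x)" if "x \<in> {0..1}" for x
    using bd[OF that] by (intro summable_comparison_test[OF _ geo(1)]) auto
  show g8: "\<bar>g x\<bar> \<le> 8 * L" if "x \<in> {0..1}" for x
    using norm_suminf_le[of "\<lambda>j. (gauss_op ^^ j) f x" "\<lambda>j. L * (7/8)^j"] bd[OF that] geo by (simp add: g_def)
  have gn8: "\<bar>gn n x\<bar> \<le> 8 * L" if "x \<in> {0..1}" for n x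
  proof -
    have "\<bar>gn n x\<bar> \<le> (\<Sum>j<n. L * (7/8)^j)"
      unfolding gn_def using bd[OF that] by (intro order_trans[OF sum_abs] sum_mono)
    also have "\<dots> \<le> 8 * L" using sum_le_suminf[OF geo(1), of "{..<n}"] L geo(2) by auto
    finally show ?thesis .
  qed
  have tail: "\<bar>g x - gn n x\<bar> \<le> 8 * L * (7 / 8) ^ n" if "x \<in> {0..1}" for n x
  proof -
    have "g x - gn n x = (\<Sum>j. (gauss_op ^^ (j + n)) f x)"
      unfolding g_def gn_def using suminf_minus_initial_segment[OF summ[OF that], of n] by simp
    also have "norm \<dots> \<le> (\<Sum>j. L * (7/8)^j * (7/8)^n)"
    proof (intro norm_suminf_le summable_mult2 geo(1))
      show "norm ((gauss_op ^^ (j + n)) f x) \<le> L * (7/8)^j * (7/8)^n" for j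
        using bd[OF that, of "j + n"] by (simp only: power_add mult.assoc real_norm_def)
    qed
    also have "\<dots> = 8 * L * (7 / 8) ^ n" using suminf_mult2[OF geo(1), of "(7/8)^n"] geo(2) by simp
    finally show ?thesis by simp
  qed
  \<comment> \<open>For partial sums the equation holds exactly, up to a shift of the index. The
    limit is then taken with the uniform tail bound, so that the operator is never exchanged with an
    infinite sum.\<close>
  have step: "f x + gauss_op (gn n) x = gn (Suc n) x" if "x \<in> {0..1}" for n x
  proof (induction n)
    case 0
    then show ?case by (simp add: gn_def gauss_op_def)
  next
    case (Suc n)
    have "gauss_op (gn (Suc n)) x = gauss_op (\<lambda>a. gn n a + (gauss_op ^^ n) f a) x" by (simp add: gn_def[abs_def])
    also have "\<dots> = gauss_op (gn n) x + (gauss_op ^^ (Suc n)) f x"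
      using gauss_op_add[where f="gn n" and h="(gauss_op ^^ n) f", OF that gn8 bd] by simp
    finally have "f x + gauss_op (gn (Suc n)) x = gn (Suc n) x + (gauss_op ^^ (Suc n)) f x" using Suc by simp
    moreover have "gn (Suc (Suc n)) x = gn (Suc n) x + (gauss_op ^^ (Suc n)) f x" unfolding gn_def by (rule sum.lessThan_Suc)
    ultimately show ?case by (simp only:)
  qed
  show "g x = f x + gauss_op g x" if "x \<in> {0..1}" for x
  proof -
    have lb: "\<bar>g x - (f x + gauss_op g x)\<bar> \<le> 0 + 16 * L * (7 / 8) ^ n" for n
    proof -
      have "\<bar>gauss_op g x - gauss_op (gn n) x\<bar> \<le> 8 * L * (7 / 8) ^ n"
        by (rule gauss_op_diff_le[OF that tail g8 gn8])
      moreover have "\<bar>g x - gn (Suc n) x\<bar> \<le> 8 * L * (7 / 8) ^ n"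
      proof -
        have "8 * L * (7 / 8) ^ Suc n \<le> 8 * L * (7 / 8) ^ n" using L by simp
        then show ?thesis using tail[OF that, of "Suc n"] by simp
      qed
      ultimately show ?thesis using step[OF that, of n] by linarith
    qed
    have "(\<lambda>n. 16 * L * (7 / 8) ^ n) \<longlonglongrightarrow> 0" by real_asymp
    from LIMSEQ_bound_add_null[OF tendsto_const this lb] have "\<bar>g x - (f x + gauss_op g x)\<bar> \<le> 0" .
    then show ?thesis by simp
  qed
  show "\<bar>g x - g y\<bar> \<le> 8 * L * \<bar>x - y\<bar>" if "x \<in> {0..1}" "y \<in> {0..1}" for x y
  proof -
    have "g x - g y = (\<Sum>j. (gauss_op ^^ j) f x - (gauss_op ^^ j) f y)"
      unfolding g_def using suminf_diff[OF summ summ] that by simp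
    also have "norm \<dots> \<le> (\<Sum>j. L * (7/8)^j * \<bar>x - y\<bar>)"
      using gauss_op_iter_lipschitz[OF lip] that geo by (intro norm_suminf_le summable_mult2) auto
    also have "\<dots> = 8 * L * \<bar>x - y\<bar>" using suminf_mult2[OF geo(1), of "\<bar>x - y\<bar>"] geo(2) by simp
    finally show ?thesis by simp
  qed
qed

subsection \<open>The Gauss measure\<close>

text \<open>A measure on all Borel sets of the line, concentrated on the unit interval. Functions
  that are controlled on \<open>{0..1}\<close> only are multiplied by an indicator below, to make
  them measurable and bounded.\<close>

definition gauss :: "real measure" where
  "gauss = density lborel (\<lambda>x. ennreal (gauss_density x) * indicator {0..1} x)"

lemma gauss_density_measurable [measurable]: "gauss_density \<in> borel_measurable borel"
  unfolding gauss_density_def by measurable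

lemma gauss_density_nonneg: "0 \<le> x \<Longrightarrow> 0 \<le> gauss_density x"
  by (simp add: gauss_density_def)

lemma sets_gauss [measurable_cong, simp]: "sets gauss = sets borel"
  by (simp add: gauss_def)

lemma space_gauss [simp]: "space gauss = UNIV"
  by (simp add: gauss_def)

lemma nn_integral_gauss:
  assumes [measurable]: "f \<in> borel_measurable borel"
  shows "(\<integral>\<^sup>+x. f x \<partial>gauss) = (\<integral>\<^sup>+x. ennreal (gauss_density x) * indicator {0..1} x * f x \<partial>lborel)"
  unfolding gauss_def by (subst nn_integral_density) (auto simp: mult_ac)

lemma gauss_real_density: "gauss = density lborel (\<lambda>x. ennreal (gauss_density x * indicator {0..1} x))"
  unfolding gauss_def by (intro density_cong) (auto split: split_indicator)

lemma LBINT_gauss: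
  fixes f :: "real \<Rightarrow> real"
  assumes [measurable]: "f \<in> borel_measurable borel"
  shows "(LBINT x:{0..1}. f x * gauss_density x) = (LINT x|gauss. f x)"
  unfolding gauss_real_density set_lebesgue_integral_def
  by (subst integral_density) (auto simp: gauss_density_nonneg mult_ac split: split_indicator)

lemma gauss_AE_I:
  assumes "\<And>x. x \<in> {0<..<1} \<Longrightarrow> P x"
  shows "AE x in gauss. P x"
  unfolding gauss_def
proof (subst AE_density)
  have "AE x in lborel. x \<noteq> (0::real)" "AE x in lborel. x \<noteq> (1::real)"
    by (rule AE_lborel_singleton)+
  then show "AE x in lborel. 0 < ennreal (gauss_density x) * indicator {0..1} x \<longrightarrow> P x"
    by eventually_elim (use assms in \<open>auto split: split_indicator\<close>)
qed simp

lemma emeasure_gauss_le: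
  assumes "0 \<le> a" "a \<le> b" "b \<le> 1"
  shows "(\<integral>\<^sup>+x. ennreal (gauss_density x) * indicator {a..b} x \<partial>lborel) = ennreal ((ln (1 + b) - ln (1 + a)) / ln 2)"
proof -
  have "(gauss_density has_integral (ln (1 + b) / ln 2 - ln (1 + a) / ln 2)) {a..b}"
  proof (rule fundamental_theorem_of_calculus)
    show "((\<lambda>x. ln (1 + x) / ln 2) has_vector_derivative gauss_density x) (at x within {a..b})" if "x \<in> {a..b}" for x
      unfolding has_real_derivative_iff_has_vector_derivative[symmetric]
      using that assms by (auto intro!: derivative_eq_intros simp: gauss_density_def)
  qed (use assms in auto)
  then have "(\<integral>\<^sup>+x. ennreal (gauss_density x) * indicator {a..b} x \<partial>lborel) = ennreal (ln (1 + b) / ln 2 - ln (1 + a) / ln 2)"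
    using assms by (intro nn_integral_has_integral_lebesgue') (auto simp: gauss_density_nonneg)
  then show ?thesis by (simp add: diff_divide_distrib)
qed

lemma prob_space_gauss: "prob_space gauss"
proof
  show "emeasure gauss (space gauss) = 1"
    using emeasure_gauss_le[of 0 1] by (simp add: gauss_def emeasure_density)
qed

interpretation gauss: prob_space gauss by (rule prob_space_gauss)

text \<open>Change of variables on one branch: the density at \<open>branch k x\<close> times the
  Jacobian 1 / (k + 1 + x)^2 equals the density at x times \<open>digit_wgt k x\<close>.\<close>

lemma gauss_branch:
  assumes [measurable]: "H \<in> borel_measurable borel"
  shows "(\<integral>\<^sup>+y. ennreal (gauss_density y) * H y * indicator {1 / (real k + 2)..1 / (real k + 1)} y \<partial>lborel)
    = (\<integral>\<^sup>+x. ennreal (gauss_density x) * indicator {0..1} x * (ennreal (digit_wgt k x) * H (branch k x)) \<partial>lborel)"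
proof -
  \<comment> \<open>\<open>branch k\<close> is decreasing while the substitution rule asks for an
    increasing map, so the branch is traversed backwards with z = 1 - x and reflected
    afterwards.\<close>
  let ?g = "\<lambda>z. 1 / (real k + 2 - z)" and ?g' = "\<lambda>z. 1 / (real k + 2 - z)\<^sup>2"
  have "(\<integral>\<^sup>+y. ennreal (gauss_density y) * H y * indicator {1 / (real k + 2)..1 / (real k + 1)} y \<partial>lborel)
    = (\<integral>\<^sup>+y. ennreal (gauss_density y) * H y * indicator {?g 0..?g 1} y \<partial>lborel)"
    by (simp add: add.commute)
  also have "\<dots> = (\<integral>\<^sup>+z. ennreal (gauss_density (?g z)) * H (?g z) * ?g' z * indicator {0..1} z \<partial>lborel)"
  proof (rule nn_integral_substitution_aux)
    show "(?g has_real_derivative ?g' z) (at z)" if "z \<in> {0..1}" for z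
      using that by (auto intro!: derivative_eq_intros simp: power2_eq_square)
    show "continuous_on {0..1} ?g'" by (intro continuous_intros) auto
  qed auto
  also have "\<dots> = (\<integral>\<^sup>+x. ennreal (gauss_density (?g (1 + (-1) * x))) * H (?g (1 + (-1) * x)) * ?g' (1 + (-1) * x) * indicator {0..1} (1 + (-1) * x) \<partial>lborel)"
    by (subst nn_integral_real_affine[where c="-1" and t=1]) auto
  also have "\<dots> = (\<integral>\<^sup>+x. ennreal (gauss_density x) * indicator {0..1} x * (ennreal (digit_wgt k x) * H (branch k x)) \<partial>lborel)"
  proof (rule nn_integral_cong)
    fix x :: real
    show "ennreal (gauss_density (?g (1 + (-1) * x))) * H (?g (1 + (-1) * x)) * ?g' (1 + (-1) * x) * indicator {0..1} (1 + (-1) * x)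
      = ennreal (gauss_density x) * indicator {0..1} x * (ennreal (digit_wgt k x) * H (branch k x))"
    proof (cases "x \<in> {0..1}")
      case True
      then have x: "0 \<le> x" "x \<le> 1" by auto
      have e: "real k + 2 - (1 + (-1) * x) = real k + 1 + x" by simp
      have "gauss_density (1 / (real k + 1 + x)) * (1 / (real k + 1 + x)\<^sup>2) = gauss_density x * digit_wgt k x"
        using x unfolding gauss_density_def digit_wgt_def
        by (simp add: divide_simps power2_eq_square)
      then have "ennreal (gauss_density (1 / (real k + 1 + x))) * ennreal (1 / (real k + 1 + x)\<^sup>2)
        = ennreal (gauss_density x) * ennreal (digit_wgt k x)"
        using x by (simp add: gauss_density_nonneg digit_wgt_nonneg flip: ennreal_mult)
      then show ?thesis unfolding e using x by (simp add: branch_def) (metis mult.assoc mult.commute)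
    qed (auto simp: indicator_def)
  qed
  finally show ?thesis .
qed

lemma digit_wgt_measurable [measurable]: "digit_wgt k \<in> borel_measurable borel"
  unfolding digit_wgt_def by measurable

lemma branch_measurable [measurable]: "branch k \<in> borel_measurable borel"
  unfolding branch_def by measurable

text \<open>Closed cells overlap only at reciprocals of integers. These are excluded here and form a
  null set in the application.\<close>

lemma gauss_cover:
  assumes "y \<in> {0<..<1}" "\<And>n. y \<noteq> 1 / (real n + 1)"
  shows "(\<Sum>k. indicator {1 / (real k + 2)..1 / (real k + 1)} y :: ennreal) = 1"
proof -
  define m where "m = nat \<lfloor>1 / y\<rfloor> - 1"
  have "1 \<le> \<lfloor>1 / y\<rfloor>" using assms(1) by (simp add: le_floor_iff)
  then have "\<lfloor>1 / y\<rfloor> = int m + 1" unfolding m_def by linarith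
  then have m: "real_of_int \<lfloor>1 / y\<rfloor> = real m + 1" by simp
  have "real m + 1 \<le> 1 / y" "1 / y < real m + 2" using m by linarith+
  then have ym: "1 / (real m + 2) < y" "y \<le> 1 / (real m + 1)" using assms(1) by (auto simp: field_simps)
  have "(indicator {1 / (real k + 2)..1 / (real k + 1)} y :: ennreal) = (if k = m then 1 else 0)" for k
  proof (cases "k = m")
    case False
    have "y \<notin> {1 / (real k + 2)..1 / (real k + 1)}"
    proof
      assume "y \<in> {1 / (real k + 2)..1 / (real k + 1)}"
      then have "1 / (real k + 2) \<le> y" "y < 1 / (real k + 1)" using assms(2)[of k] by auto
      then have "real k + 1 < 1 / y" "1 / y \<le> real k + 2" using assms(1) by (auto simp: field_simps)
      then have "1 / y < real k + 2" using assms(2)[of "Suc k"] assms(1) by (auto simp: field_simps order.order_iff_strict)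
      with \<open>real k + 1 < 1 / y\<close> have "\<lfloor>1 / y\<rfloor> = int k + 1" by (simp add: floor_eq_iff)
      with m False show False by simp
    qed
    with False show ?thesis by simp
  qed (use ym in auto)
  then show ?thesis using suminf_finite[of "{m}" "\<lambda>k. indicator {1 / (real k + 2)..1 / (real k + 1)} y :: ennreal"] by simp
qed

lemma gauss_cells:
  assumes [measurable]: "H \<in> borel_measurable borel"
  shows "(\<integral>\<^sup>+y. H y \<partial>gauss) =
    (\<Sum>k. \<integral>\<^sup>+y. ennreal (gauss_density y) * H y * indicator {1 / (real k + 2)..1 / (real k + 1)} y \<partial>lborel)"
proof -
  have "countable (range (\<lambda>n. 1 / (real n + 1)))" by simp
  then have "AE y in lborel. y \<notin> range (\<lambda>n. 1 / (real n + 1))"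
    by (intro AE_not_in countable_imp_null_set_lborel)
  moreover have "AE y in lborel. y \<noteq> 0 \<and> y \<noteq> (1::real)" by (simp add: AE_lborel_singleton)
  ultimately have "AE y in lborel. ennreal (gauss_density y) * indicator {0..1} y * H y =
    (\<Sum>k. ennreal (gauss_density y) * H y * indicator {1 / (real k + 2)..1 / (real k + 1)} y)"
  proof eventually_elim
    case (elim y)
    have out: "indicator {1 / (real k + 2)..1 / (real k + 1)} y = (0::ennreal)" if "y \<notin> {0..1}" for k
      using that by (auto simp: indicator_def intro: order_trans[OF _ divide_le_eq_1[THEN iffD2]])
        (smt (verit) divide_le_eq_1 divide_nonneg_pos of_nat_0_le_iff)+
    show ?case
    proof (cases "y \<in> {0..1}")
      case True
      then have "(\<Sum>k. indicator {1 / (real k + 2)..1 / (real k + 1)} y :: ennreal) = 1"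
        using elim by (intro gauss_cover) auto
      then show ?thesis using True by simp
    qed (simp add: out)
  qed
  then have "(\<integral>\<^sup>+y. H y \<partial>gauss) = (\<integral>\<^sup>+y. (\<Sum>k. ennreal (gauss_density y) * H y * indicator {1 / (real k + 2)..1 / (real k + 1)} y) \<partial>lborel)"
    by (subst nn_integral_gauss) (auto intro: nn_integral_cong_AE)
  also have "\<dots> = (\<Sum>k. \<integral>\<^sup>+y. ennreal (gauss_density y) * H y * indicator {1 / (real k + 2)..1 / (real k + 1)} y \<partial>lborel)"
    by (rule nn_integral_suminf) auto
  finally show ?thesis .
qed

text \<open>Sum of \<open>gauss_branch\<close> over all cells. Beyond invariance under the Gauss map
  it identifies \<open>digit_pmf x\<close> as the conditional law of the first digit of y, given
  that the Gauss map takes y to x.\<close>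

lemma gauss_invariant:
  assumes [measurable]: "H \<in> borel_measurable borel"
  shows "(\<integral>\<^sup>+y. H y \<partial>gauss) = (\<integral>\<^sup>+x. (\<integral>\<^sup>+k. H (branch k x) \<partial>digit_pmf x) \<partial>gauss)"
proof -
  have "(\<integral>\<^sup>+y. H y \<partial>gauss) = (\<Sum>k. \<integral>\<^sup>+x. ennreal (gauss_density x) * indicator {0..1} x * (ennreal (digit_wgt k x) * H (branch k x)) \<partial>lborel)"
    by (simp only: gauss_branch gauss_cells assms)
  also have "\<dots> = (\<integral>\<^sup>+x. (\<Sum>k. ennreal (gauss_density x) * indicator {0..1} x * (ennreal (digit_wgt k x) * H (branch k x))) \<partial>lborel)"
    by (rule nn_integral_suminf[symmetric]) auto
  also have "\<dots> = (\<integral>\<^sup>+x. (\<Sum>k. ennreal (digit_wgt k x) * H (branch k x)) \<partial>gauss)"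
    by (subst nn_integral_gauss) auto
  also have "\<dots> = (\<integral>\<^sup>+x. (\<integral>\<^sup>+k. H (branch k x) \<partial>digit_pmf x) \<partial>gauss)"
    by (intro nn_integral_cong_AE gauss_AE_I) (simp add: nn_integral_digit_pmf)
  finally show ?thesis .
qed


section \<open>Integrating unbounded observables, and the Poisson equation\<close>

lemma lip_continuous:
  assumes "\<And>x y. x \<in> {0..1} \<Longrightarrow> y \<in> {0..1} \<Longrightarrow> \<bar>f x - f y\<bar> \<le> L * \<bar>x - y\<bar>"
  shows "continuous_on {0..1::real} (f :: real \<Rightarrow> real)"
proof (rule lipschitz_on_continuous_on)
  have "0 \<le> L" using assms[of 0 1] by simp
  then show "L-lipschitz_on {0..1} f"
    using assms by (intro lipschitz_onI) (auto simp: dist_real_def)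
qed

lemma lip_measurable:
  assumes "\<And>x y. x \<in> {0..1} \<Longrightarrow> y \<in> {0..1} \<Longrightarrow> \<bar>f x - f y\<bar> \<le> L * \<bar>x - y\<bar>"
  shows "(\<lambda>x. indicator {0..1::real} x * f x :: real) \<in> borel_measurable borel"
  using borel_measurable_continuous_on_indicator[OF _ lip_continuous[OF assms]] by simp

lemma sqrt_lip_max:
  assumes "sqrt_lip F A"
  shows "sqrt_lip (\<lambda>k x. max 0 (F k x)) A"
proof -
  have "\<bar>max 0 a\<bar> \<le> \<bar>a\<bar>" "\<bar>max 0 a - max 0 b\<bar> \<le> \<bar>a - b\<bar>" for a b :: real by auto
  then show ?thesis using assms unfolding sqrt_lip_def by (meson order_trans)
qed

lemma sqrt_lip_minus: "sqrt_lip F A \<Longrightarrow> sqrt_lip (\<lambda>k x. - F k x) A"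
  unfolding sqrt_lip_def by (simp add: abs_minus_commute)

lemma lip_integrable:
  assumes f: "\<And>x y. x \<in> {0..1} \<Longrightarrow> y \<in> {0..1} \<Longrightarrow> \<bar>f x - f y\<bar> \<le> L * \<bar>x - y\<bar>"
  shows "integrable gauss (\<lambda>x. indicator {0..1} x * f x)"
proof (rule gauss.integrable_const_bound)
  have "\<bar>indicator {0..1} x * f x\<bar> \<le> \<bar>f 0\<bar> + L" for x
    using lipschitz_bounded[of f L x, OF f] f[of 0 1] by (cases "x \<in> {0..1}") auto
  then show "AE x in gauss. norm (indicator {0..1} x * f x) \<le> \<bar>f 0\<bar> + L" by simp
qed (use lip_measurable[OF f] in simp)

lemma branch_mean_integrable:
  assumes "sqrt_lip F A"
  shows "integrable gauss (\<lambda>x. indicator {0..1} x * branch_mean F x)"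
  by (rule lip_integrable[OF branch_mean_lipschitz[OF assms]])

text \<open>Stationarity for an H that is prescribed along the branches only, which determines it
  almost everywhere. Integrability of H comes out as well, since the averaged function is Lipschitz
  and hence bounded.\<close>

lemma gauss_branch_mean_nonneg:
  assumes F: "sqrt_lip F A" and pos: "\<And>k x. x \<in> {0..1} \<Longrightarrow> 0 \<le> F k x"
    and [measurable]: "H \<in> borel_measurable borel" and Hpos: "\<And>x. 0 \<le> H x"
    and HF: "\<And>k x. x \<in> {0<..<1} \<Longrightarrow> H (branch k x) = F k x"
  shows "integrable gauss H" "(LINT x|gauss. H x) = (LINT x|gauss. indicator {0..1} x * branch_mean F x)"
proof -
  have m [measurable]: "(\<lambda>x. indicator {0..1} x * branch_mean F x) \<in> borel_measurable borel"
    by (rule lip_measurable[OF branch_mean_lipschitz[OF F]])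
  have "(\<integral>\<^sup>+x. ennreal (H x) \<partial>gauss) = (\<integral>\<^sup>+x. (\<integral>\<^sup>+k. ennreal (H (branch k x)) \<partial>digit_pmf x) \<partial>gauss)"
    by (rule gauss_invariant) simp
  also have "\<dots> = (\<integral>\<^sup>+x. ennreal (indicator {0..1} x * branch_mean F x) \<partial>gauss)"
  proof (intro nn_integral_cong_AE gauss_AE_I)
    fix x :: real assume x: "x \<in> {0<..<1}"
    then have "(\<integral>\<^sup>+k. ennreal (H (branch k x)) \<partial>digit_pmf x) = (\<integral>\<^sup>+k. ennreal (F k x) \<partial>digit_pmf x)"
      by (simp add: HF)
    also have "\<dots> = ennreal (branch_mean F x)"
      unfolding branch_mean_def using x pos sqrt_lip_integrable[OF F, of x x] by (intro nn_integral_eq_integral) auto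
    finally show "(\<integral>\<^sup>+k. ennreal (H (branch k x)) \<partial>digit_pmf x) = ennreal (indicator {0..1} x * branch_mean F x)" using x by simp
  qed
  finally have eq: "(\<integral>\<^sup>+x. ennreal (H x) \<partial>gauss) = (\<integral>\<^sup>+x. ennreal (indicator {0..1} x * branch_mean F x) \<partial>gauss)" .
  have EFpos: "0 \<le> indicator {0..1} x * branch_mean F x" for x
    using pos by (auto simp: branch_mean_def indicator_def)
  have int: "integrable gauss (\<lambda>x. indicator {0..1} x * branch_mean F x)"
    by (rule branch_mean_integrable[OF F])
  then have "(\<integral>\<^sup>+x. ennreal (H x) \<partial>gauss) < \<infinity>"
    unfolding eq using EFpos by (subst nn_integral_eq_integral) auto
  then show "integrable gauss H"
    using Hpos by (intro integrableI_bounded) auto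
  show "(LINT x|gauss. H x) = (LINT x|gauss. indicator {0..1} x * branch_mean F x)"
    using Hpos EFpos by (subst (1 2) integral_eq_nn_integral) (auto simp: eq)
qed

text \<open>Positive and negative parts are treated separately; the class \<open>sqrt_lip\<close> is
  stable under both.\<close>

lemma gauss_branch_mean:
  assumes F: "sqrt_lip F A" and [measurable]: "H \<in> borel_measurable borel"
    and HF: "\<And>k x. x \<in> {0<..<1} \<Longrightarrow> H (branch k x) = F k x"
  shows "integrable gauss H" "(LINT x|gauss. H x) = (LINT x|gauss. indicator {0..1} x * branch_mean F x)"
proof -
  let ?Fp = "\<lambda>k x. max 0 (F k x)" and ?Fm = "\<lambda>k x. max 0 (- F k x)"
  let ?Hp = "\<lambda>x. max 0 (H x)" and ?Hm = "\<lambda>x. max 0 (- H x)"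
  note np = sqrt_lip_max[OF F] and nm = sqrt_lip_max[OF sqrt_lip_minus[OF F]]
  have p: "integrable gauss ?Hp" "(LINT x|gauss. ?Hp x) = (LINT x|gauss. indicator {0..1} x * branch_mean ?Fp x)"
    using gauss_branch_mean_nonneg[OF np, of ?Hp] HF by auto
  have m: "integrable gauss ?Hm" "(LINT x|gauss. ?Hm x) = (LINT x|gauss. indicator {0..1} x * branch_mean ?Fm x)"
    using gauss_branch_mean_nonneg[OF nm, of ?Hm] HF by auto
  have H: "H = (\<lambda>x. ?Hp x - ?Hm x)" by (auto simp: fun_eq_iff)
  show "integrable gauss H"
    by (subst H) (intro Bochner_Integration.integrable_diff p m)
  have EFd: "branch_mean F x = branch_mean ?Fp x - branch_mean ?Fm x" if "x \<in> {0..1}" for x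
  proof -
    have "(\<lambda>k. F k x) = (\<lambda>k. ?Fp k x - ?Fm k x)" by (auto simp: fun_eq_iff)
    then show ?thesis
      unfolding branch_mean_def using Bochner_Integration.integral_diff[OF sqrt_lip_integrable[OF np that that] sqrt_lip_integrable[OF nm that that]]
      by metis
  qed
  have i: "integrable gauss (\<lambda>x. indicator {0..1} x * branch_mean G x)" if "sqrt_lip G A" for G
    by (rule branch_mean_integrable[OF that])
  have "(LINT x|gauss. H x) = (LINT x|gauss. ?Hp x) - (LINT x|gauss. ?Hm x)"
    by (subst H) (intro Bochner_Integration.integral_diff p m)
  also have "\<dots> = (LINT x|gauss. indicator {0..1} x * branch_mean ?Fp x - indicator {0..1} x * branch_mean ?Fm x)"
    unfolding p(2) m(2) using i[OF np] i[OF nm] by (rule Bochner_Integration.integral_diff[symmetric])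
  also have "\<dots> = (LINT x|gauss. indicator {0..1} x * branch_mean F x)"
    by (intro Bochner_Integration.integral_cong refl) (auto simp: EFd indicator_def)
  finally show "(LINT x|gauss. H x) = (LINT x|gauss. indicator {0..1} x * branch_mean F x)" .
qed

lemma lip_sqrt_lip:
  assumes f: "\<And>x y. x \<in> {0..1} \<Longrightarrow> y \<in> {0..1} \<Longrightarrow> \<bar>f x - f y\<bar> \<le> L * \<bar>x - y\<bar>"
  shows "sqrt_lip (\<lambda>k x. f (branch k x)) (\<bar>f 0\<bar> + L)"
proof -
  have L: "0 \<le> L" using f[of 0 1] by simp
  show ?thesis unfolding sqrt_lip_def
  proof (intro conjI allI ballI)
    fix k and x :: real assume x: "x \<in> {0..1}"
    have "(\<bar>f 0\<bar> + L) * 1 \<le> (\<bar>f 0\<bar> + L) * sqrt (real k + 1)" using L by (intro mult_left_mono) auto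
    then show "\<bar>f (branch k x)\<bar> \<le> (\<bar>f 0\<bar> + L) * sqrt (real k + 1)"
      using lipschitz_bounded[of f L "branch k x", OF f] branch_mem[of x k] x by simp
    fix y :: real assume y: "y \<in> {0..1}"
    have "1 \<le> (real k + 1 + x) * (real k + 1 + y)" using x y by (intro mult_ge1_I) auto
    then have "\<bar>x - y\<bar> * (1 / ((real k + 1 + x) * (real k + 1 + y))) \<le> \<bar>x - y\<bar> * 1"
      by (intro mult_left_mono) (auto simp: divide_le_eq_1)
    then have "\<bar>branch k x - branch k y\<bar> \<le> \<bar>x - y\<bar>"
      using branch_diff[of x y k] x y by simp
    then have "\<bar>f (branch k x) - f (branch k y)\<bar> \<le> L * \<bar>x - y\<bar>"
      using f[OF branch_mem branch_mem, of x y k k] x y L by (meson atLeastAtMost_iff mult_left_mono order_trans)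
    also have "\<dots> \<le> ((\<bar>f 0\<bar> + L) * sqrt (real k + 1)) * \<bar>x - y\<bar>"
      using \<open>(\<bar>f 0\<bar> + L) * 1 \<le> _\<close> by (intro mult_right_mono) auto
    finally show "\<bar>f (branch k x) - f (branch k y)\<bar> \<le> (\<bar>f 0\<bar> + L) * sqrt (real k + 1) * \<bar>x - y\<bar>" .
  qed
qed

definition gauss_mean :: "(real \<Rightarrow> real) \<Rightarrow> real" where
  "gauss_mean f = (LINT x|gauss. indicator {0..1} x * f x)"

lemma gauss_mean_gauss_op:
  assumes f: "\<And>x y. x \<in> {0..1} \<Longrightarrow> y \<in> {0..1} \<Longrightarrow> \<bar>f x - f y\<bar> \<le> L * \<bar>x - y\<bar>"
  shows "gauss_mean (gauss_op f) = gauss_mean f"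
proof -
  have "(LINT x|gauss. indicator {0..1} x * f x) = (LINT x|gauss. indicator {0..1} x * branch_mean (\<lambda>k x. f (branch k x)) x)"
  proof (rule gauss_branch_mean(2)[OF lip_sqrt_lip])
    show "(\<lambda>x. indicator {0..1} x * f x) \<in> borel_measurable borel" by (rule lip_measurable[OF f])
    show "indicator {0..1} (branch k x) * f (branch k x) = f (branch k x)" if "x \<in> {0<..<1}" for k x
      using that branch_mem[of x k] by auto
  qed (use f in auto)
  then show ?thesis by (simp add: gauss_mean_def gauss_op_def branch_mean_def)
qed

text \<open>A function of mean zero satisfies f x = mean of f x - f y over y, and on the unit
  interval each such difference is at most L. This converts decay of seminorms into the decay in sup
  norm that \<open>neumann_series\<close> asks for.\<close>

lemma gauss_mean_zero_bound:
  assumes f: "\<And>x y. x \<in> {0..1} \<Longrightarrow> y \<in> {0..1} \<Longrightarrow> \<bar>f x - f y\<bar> \<le> L * \<bar>x - y\<bar>"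
    and z: "gauss_mean f = 0" and x: "x \<in> {0..1}"
  shows "\<bar>f x\<bar> \<le> L"
proof -
  have L: "0 \<le> L" using f[of 0 1] by simp
  note int = lip_integrable[OF f]
  have "f x = (LINT y|gauss. f x - indicator {0..1} y * f y)"
    using int z gauss.prob_space by (simp add: gauss_mean_def)
  also have "\<bar>\<dots>\<bar> \<le> (LINT y|gauss. \<bar>f x - indicator {0..1} y * f y\<bar>)"
    using integral_norm_bound[of gauss "\<lambda>y. f x - indicator {0..1} y * f y"] by simp
  also have "\<dots> \<le> (LINT y|gauss. L)"
  proof (rule integral_mono_AE)
    show "AE y in gauss. \<bar>f x - indicator {0..1} y * f y\<bar> \<le> L"
    proof (rule gauss_AE_I)
      fix y :: real assume y: "y \<in> {0<..<1}"
      have "L * \<bar>x - y\<bar> \<le> L * 1" using x y L by (intro mult_left_mono) auto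
      then show "\<bar>f x - indicator {0..1} y * f y\<bar> \<le> L" using f[of x y] x y by auto
    qed
  qed (use int in auto)
  also have "\<dots> = L" using gauss.prob_space by simp
  finally show ?thesis .
qed

text \<open>The Neumann series starts from \<open>branch_mean F\<close>, the first function that is
  Lipschitz. Its mean is that of H, and applying the operator preserves it, so all iterates have
  mean zero.\<close>

lemma poisson_equation:
  assumes F: "sqrt_lip F A" and H: "H \<in> borel_measurable borel"
    and HF: "\<And>k x. x \<in> {0<..<1} \<Longrightarrow> H (branch k x) = F k x"
    and z: "(LINT x|gauss. H x) = 0"
  obtains g L where "\<And>x. x \<in> {0..1} \<Longrightarrow> g x = branch_mean F x + gauss_op g x"
    "\<And>x. x \<in> {0..1} \<Longrightarrow> \<bar>g x\<bar> \<le> L"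
    "\<And>x y. x \<in> {0..1} \<Longrightarrow> y \<in> {0..1} \<Longrightarrow> \<bar>g x - g y\<bar> \<le> L * \<bar>x - y\<bar>"
proof -
  note lip = branch_mean_lipschitz[OF F]
  have "gauss_mean ((gauss_op ^^ j) (branch_mean F)) = 0" for j
  proof (induction j)
    case 0
    then show ?case using gauss_branch_mean(2)[OF F H HF] z by (simp add: gauss_mean_def)
  next
    case (Suc j)
    then show ?case using gauss_mean_gauss_op[OF gauss_op_iter_lipschitz[OF lip], of j] by simp
  qed
  then have bd: "\<bar>(gauss_op ^^ j) (branch_mean F) a\<bar> \<le> 9 * A * (7 / 8) ^ j" if "a \<in> {0..1}" for j a
    using gauss_mean_zero_bound[OF gauss_op_iter_lipschitz[OF lip] _ that] by blast
  obtain g where "\<And>x. x \<in> {0..1} \<Longrightarrow> g x = branch_mean F x + gauss_op g x"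
    "\<And>x. x \<in> {0..1} \<Longrightarrow> \<bar>g x\<bar> \<le> 8 * (9 * A)"
    "\<And>x y. x \<in> {0..1} \<Longrightarrow> y \<in> {0..1} \<Longrightarrow> \<bar>g x - g y\<bar> \<le> 8 * (9 * A) * \<bar>x - y\<bar>"
    using neumann_series[of "branch_mean F" "9 * A", OF lip bd] by blast
  then show ?thesis by (rule that)
qed

subsection \<open>Entropy and mean cost\<close>

lemma power_ln_integral:
  "((\<lambda>x. x ^ n * (- ln x)) has_integral 1 / (real n + 1)\<^sup>2) {0..1::real}"
proof -
  let ?F = "\<lambda>x::real. - (x ^ (n + 1) * ln x) / (real n + 1) + x ^ (n + 1) / (real n + 1)\<^sup>2"
  have "((\<lambda>x. x ^ n * (- ln x)) has_integral (?F 1 - ?F 0)) {0..1}"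
  proof (rule fundamental_theorem_of_calculus_interior)
    \<comment> \<open>At 0 the product evaluates to 0, which is also its limit from the right; hence
      the antiderivative is continuous on the closed interval.\<close>
    have c: "continuous (at x within {0..1}) (\<lambda>x. x ^ (n + 1) * ln x)" if "x \<in> {0..1}" for x :: real
    proof (cases "x = 0")
      case True
      have "((\<lambda>x::real. x ^ (n + 1) * ln x) \<longlongrightarrow> 0) (at_right 0)" by real_asymp
      then have "((\<lambda>x::real. x ^ (n + 1) * ln x) \<longlongrightarrow> 0) (at 0 within {0..1})"
        by (rule tendsto_mono[rotated]) (simp add: at_within_Icc_at_right)
      then show ?thesis by (simp add: continuous_within True)
    next
      case False
      then show ?thesis by (auto intro!: continuous_intros)
    qed
    then have "continuous_on {0..1} (\<lambda>x::real. x ^ (n + 1) * ln x)"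
      unfolding continuous_on_eq_continuous_within by blast
    then show "continuous_on {0..1} ?F"
      by (intro continuous_on_add continuous_on_divide[OF continuous_on_minus] continuous_on_const)
        (auto intro!: continuous_intros)
    show "(?F has_vector_derivative (x ^ n * (- ln x))) (at x)" if "x \<in> {0<..<1}" for x
    proof -
      have x: "0 < x" using that by simp
      have d: "((\<lambda>x. x ^ (n + 1)) has_real_derivative (real n + 1) * x ^ n) (at x)"
        using DERIV_pow[of "n + 1" x] by (simp add: add.commute)
      have "(?F has_real_derivative (- ((real n + 1) * x ^ n * ln x + 1 / x * x ^ (n + 1)) / (real n + 1)
          + (real n + 1) * x ^ n / (real n + 1)\<^sup>2)) (at x)"
        by (rule DERIV_add[OF DERIV_cdivide[OF DERIV_minus[OF DERIV_mult[OF d DERIV_ln_divide[OF x]]]] DERIV_cdivide[OF d]])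
      moreover have "- ((real n + 1) * x ^ n * ln x + 1 / x * x ^ (n + 1)) / (real n + 1)
          + (real n + 1) * x ^ n / (real n + 1)\<^sup>2 = x ^ n * (- ln x)"
      proof -
        have "1 / x * x ^ (n + 1) = x ^ n" using x by simp
        then show ?thesis by (simp add: divide_simps power2_eq_square)
      qed
      ultimately show ?thesis
        by (simp only: has_real_derivative_iff_has_vector_derivative)
    qed
  qed auto
  then show ?thesis by simp
qed

text \<open>The even squares carry a quarter of pi^2 / 6; subtracting them twice from the full sum
  leaves half of it.\<close>

lemma alternating_inverse_squares:
  "(\<lambda>j. 1 / (2 * real j + 1)\<^sup>2 - 1 / (2 * real j + 2)\<^sup>2) sums (pi\<^sup>2 / 12)"
proof -
  have s: "(\<lambda>n. 1 / (real n + 1)\<^sup>2) sums (pi\<^sup>2 / 6)" using inverse_squares_sums by (simp add: add.commute)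
  have "(\<lambda>j. \<Sum>n\<in>{j * 2..<j * 2 + 2}. 1 / (real n + 1)\<^sup>2) sums (pi\<^sup>2 / 6)"
    by (rule sums_group[OF s]) simp
  then have 1: "(\<lambda>j. 1 / (2 * real j + 1)\<^sup>2 + 1 / (2 * real j + 2)\<^sup>2) sums (pi\<^sup>2 / 6)"
    by (simp add: numeral_2_eq_2 mult.commute add_ac)
  have "(\<lambda>j. 1 / 2 * (1 / (real j + 1)\<^sup>2)) sums (1 / 2 * (pi\<^sup>2 / 6))"
    by (rule sums_mult[OF s])
  moreover have "1 / 2 * (1 / (real j + 1)\<^sup>2) = 2 * (1 / (2 * real j + 2)\<^sup>2)" for j
  proof -
    have "(2 * real j + 2)\<^sup>2 = 4 * (real j + 1)\<^sup>2" by (simp add: power2_eq_square algebra_simps)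
    then show ?thesis by simp
  qed
  ultimately have 2: "(\<lambda>j. 2 * (1 / (2 * real j + 2)\<^sup>2)) sums (pi\<^sup>2 / 12)" by simp
  from sums_diff[OF 1 2] show ?thesis by simp
qed

text \<open>The factor 1 / (1 + x) is expanded into alternating powers of x taken in consecutive
  pairs. Each pair times - ln x is nonnegative, so sum and integral may be exchanged without a
  majorant.\<close>

lemma nn_integral_ln_over: "(\<integral>\<^sup>+x. ennreal (- ln x / (1 + x)) * indicator {0..1} x \<partial>lborel) = ennreal (pi\<^sup>2 / 12)"
proof -
  let ?f = "\<lambda>j x::real. (x ^ (2 * j) * (- ln x) - x ^ (2 * j + 1) * (- ln x))"
  have pos: "0 \<le> ?f j x" if "x \<in> {0..1}" for j x
  proof -
    have "?f j x = x ^ (2 * j) * (1 - x) * (- ln x)" by (simp add: algebra_simps)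
    also have "\<dots> \<ge> 0"
    proof (cases "x = 0")
      case False
      then show ?thesis using that by (intro mult_nonneg_nonneg) auto
    qed simp
    finally show ?thesis .
  qed
  have "(?f j has_integral (1 / (real (2 * j) + 1)\<^sup>2 - 1 / (real (2 * j + 1) + 1)\<^sup>2)) {0..1}" for j
    by (intro has_integral_diff power_ln_integral)
  then have int: "(\<integral>\<^sup>+x. ennreal (?f j x) * indicator {0..1} x \<partial>lborel) = ennreal (1 / (2 * real j + 1)\<^sup>2 - 1 / (2 * real j + 2)\<^sup>2)" for j
    using pos nn_integral_has_integral_lebesgue'[of "{0..1}" "?f j"] by (simp add: add_ac)
  have "AE x in lborel. x \<noteq> (0::real)" "AE x in lborel. x \<noteq> (1::real)" by (rule AE_lborel_singleton)+
  then have "AE x in lborel. ennreal (- ln x / (1 + x)) * indicator {0..1} x = (\<Sum>j. ennreal (?f j x) * indicator {0..1} x)"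
  proof eventually_elim
    case (elim x)
    show ?case
    proof (cases "x \<in> {0..1}")
      case True
      then have x: "0 < x" "x < 1" using elim by auto
      have "(\<lambda>j. (x\<^sup>2) ^ j) sums (1 / (1 - x\<^sup>2))"
        using x by (intro geometric_sums) (simp add: power_less_one_iff abs_square_less_1)
      from sums_mult[OF this, of "(1 - x) * (- ln x)"]
      moreover have "?f j x = (1 - x) * (- ln x) * (x\<^sup>2) ^ j" for j
        by (simp add: power_mult[symmetric] algebra_simps)
      ultimately have "(\<lambda>j. ?f j x) sums ((1 - x) * (- ln x) * (1 / (1 - x\<^sup>2)))"
        by (simp only:)
      moreover have "(1 - x) * (- ln x) * (1 / (1 - x\<^sup>2)) = - ln x / (1 + x)"
      proof -
        have "1 - x\<^sup>2 = (1 - x) * (1 + x)" by (simp add: power2_eq_square algebra_simps)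
        then show ?thesis using x by simp
      qed
      ultimately have "(\<lambda>j. ?f j x) sums (- ln x / (1 + x))" by simp
      then have "(\<Sum>j. ennreal (?f j x)) = ennreal (- ln x / (1 + x))"
        using pos[OF True] by (simp add: sums_iff suminf_ennreal2)
      then show ?thesis using True by simp
    qed simp
  qed
  then have "(\<integral>\<^sup>+x. ennreal (- ln x / (1 + x)) * indicator {0..1} x \<partial>lborel) = (\<integral>\<^sup>+x. (\<Sum>j. ennreal (?f j x) * indicator {0..1} x) \<partial>lborel)"
    by (rule nn_integral_cong_AE)
  also have "\<dots> = (\<Sum>j. \<integral>\<^sup>+x. ennreal (?f j x) * indicator {0..1} x \<partial>lborel)"
    by (rule nn_integral_suminf) measurable
  also have "\<dots> = (\<Sum>j. ennreal (1 / (2 * real j + 1)\<^sup>2 - 1 / (2 * real j + 2)\<^sup>2))"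
    by (simp only: int)
  also have "\<dots> = ennreal (\<Sum>j. 1 / (2 * real j + 1)\<^sup>2 - 1 / (2 * real j + 2)\<^sup>2)"
  proof (rule suminf_ennreal2)
    show "0 \<le> 1 / (2 * real j + 1)\<^sup>2 - 1 / (2 * real j + 2)\<^sup>2" for j
      by (simp add: frac_le power_mono)
    show "summable (\<lambda>j. 1 / (2 * real j + 1)\<^sup>2 - 1 / (2 * real j + 2)\<^sup>2)"
      using alternating_inverse_squares by (rule sums_summable)
  qed
  also have "(\<Sum>j. 1 / (2 * real j + 1)\<^sup>2 - 1 / (2 * real j + 2)\<^sup>2) = pi\<^sup>2 / 12"
    using alternating_inverse_squares by (simp add: sums_iff)
  finally show ?thesis .
qed

text \<open>The mean growth of \<open>ln q\<close> per digit (Levy's constant), equal to half of the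
  entropy of the Gauss map.\<close>

definition mean_log :: real where "mean_log = pi\<^sup>2 / (12 * ln 2)"

lemma mean_log_pos: "0 < mean_log"
  by (simp add: mean_log_def)

lemma nn_integral_gauss_ln: "(\<integral>\<^sup>+x. ennreal (- ln x) \<partial>gauss) = ennreal mean_log"
proof -
  have "(\<integral>\<^sup>+x. ennreal (- ln x) \<partial>gauss) = (\<integral>\<^sup>+x. ennreal (1 / ln 2) * (ennreal (- ln x / (1 + x)) * indicator {0..1} x) \<partial>lborel)"
  proof (subst nn_integral_gauss)
    have "ennreal (gauss_density x) * indicator {0..1} x * ennreal (- ln x) =
        ennreal (1 / ln 2) * (ennreal (- ln x / (1 + x)) * indicator {0..1} x)" for x
    proof (cases "x \<in> {0<..1}")
      case True
      then have "0 \<le> - ln x" by simp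
      then have "ennreal (gauss_density x) * ennreal (- ln x) = ennreal (gauss_density x * - ln x)"
        using True by (intro ennreal_mult[symmetric] gauss_density_nonneg) auto
      also have "gauss_density x * - ln x = (1 / ln 2) * (- ln x / (1 + x))"
        by (simp add: gauss_density_def)
      also have "ennreal \<dots> = ennreal (1 / ln 2) * ennreal (- ln x / (1 + x))"
        using True \<open>0 \<le> - ln x\<close> by (intro ennreal_mult divide_nonneg_nonneg) auto
      finally show ?thesis using True by simp
    next
      case False
      then have "x \<notin> {0..1} \<or> x = 0" by auto
      then show ?thesis by auto
    qed
    then show "(\<integral>\<^sup>+x. ennreal (gauss_density x) * indicator {0..1} x * ennreal (- ln x) \<partial>lborel) =
      (\<integral>\<^sup>+x. ennreal (1 / ln 2) * (ennreal (- ln x / (1 + x)) * indicator {0..1} x) \<partial>lborel)"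
      by (intro nn_integral_cong)
  qed simp
  also have "\<dots> = ennreal (1 / ln 2) * ennreal (pi\<^sup>2 / 12)"
    by (subst nn_integral_cmult, simp, simp only: nn_integral_ln_over)
  also have "\<dots> = ennreal mean_log" by (simp add: mean_log_def ennreal_mult[symmetric] mult_ac)
  finally show ?thesis .
qed

lemma gauss_AE_bounds: "AE x in gauss. 0 < x \<and> x < 1"
  by (rule gauss_AE_I) auto

lemma integral_gauss_ln: "(LINT x|gauss. - ln x) = mean_log"
proof -
  have "AE x in gauss. 0 \<le> - ln x" using gauss_AE_bounds by eventually_elim simp
  then show ?thesis
    using mean_log_pos by (subst integral_eq_nn_integral) (auto simp: nn_integral_gauss_ln)
qed

lemma gauss_map_deriv:
  assumes "x \<in> {0<..<1}" "\<And>n. x \<noteq> 1 / (real n + 1)"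
  shows "deriv gauss_map x = - (1 / x\<^sup>2)"
proof (rule DERIV_imp_deriv)
  define m where "m = \<lfloor>1 / x\<rfloor>"
  have m1: "1 \<le> m" using assms(1) by (simp add: m_def le_floor_iff)
  have "real_of_int m \<noteq> 1 / x"
  proof
    assume *: "real_of_int m = 1 / x"
    have "x = 1 / real_of_int m" unfolding * by simp
    also have "real_of_int m = real (nat (m - 1)) + 1" using m1 by simp
    finally show False using assms(2) by blast
  qed
  then have b: "real_of_int m < 1 / x" "1 / x < real_of_int m + 1"
    unfolding m_def by (linarith, linarith)
  have o: "open {1 / (real_of_int m + 1)<..<1 / real_of_int m}" by simp
  have xin: "x \<in> {1 / (real_of_int m + 1)<..<1 / real_of_int m}"
    using b assms(1) m1 by (auto simp: field_simps)
  have ev: "gauss_map y = 1 / y - real_of_int m" if "y \<in> {1 / (real_of_int m + 1)<..<1 / real_of_int m}" for y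
  proof -
    have "0 < 1 / (real_of_int m + 1)" using m1 by simp
    then have "0 < y" using that less_trans greaterThanLessThan_iff by blast
    then have "real_of_int m < 1 / y" "1 / y < real_of_int m + 1"
      using that m1 by (auto simp: field_simps)
    then have "\<lfloor>1 / y\<rfloor> = m" by (simp add: floor_eq_iff)
    then show ?thesis using \<open>0 < y\<close> by (simp add: gauss_map_def)
  qed
  have "((\<lambda>y. 1 / y - real_of_int m) has_real_derivative - (1 / x\<^sup>2)) (at x)"
    using assms(1) by (auto intro!: derivative_eq_intros simp: power2_eq_square)
  then show "(gauss_map has_real_derivative - (1 / x\<^sup>2)) (at x)"
    by (rule has_field_derivative_transform_within_open[OF _ o xin]) (simp add: ev)
qed

lemma gauss_entropy_eq: "gauss_entropy = pi\<^sup>2 / (6 * ln 2)"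
proof -
  have "gauss_entropy = (LBINT x:{0..1}. (2 * - ln x) * gauss_density x)"
    unfolding gauss_entropy_def set_lebesgue_integral_def
  \<comment> \<open>The derivative is known off 0 and the reciprocals of the positive integers; this
    countable exceptional set also contains the endpoint 1.\<close>
  proof (rule integral_discrete_difference[where X="insert 0 (range (\<lambda>n. 1 / (real n + 1)))"])
    fix x :: real assume x: "x \<notin> insert 0 (range (\<lambda>n. 1 / (real n + 1)))"
    show "indicator {0..1} x *\<^sub>R (ln \<bar>deriv gauss_map x\<bar> * gauss_density x)
      = indicator {0..1} x *\<^sub>R ((2 * - ln x) * gauss_density x)"
    proof (cases "x \<in> {0..1}")
      case True
      have "x \<noteq> 1" using x by (auto intro: rev_image_eqI[of 0])
      then have "deriv gauss_map x = - (1 / x\<^sup>2)" "0 < x"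
        using x True by (auto intro!: gauss_map_deriv)
      then show ?thesis by (simp add: ln_div ln_realpow)
    qed simp
  qed auto
  also have "\<dots> = (LINT x|gauss. 2 * - ln x)" by (rule LBINT_gauss) measurable
  also have "\<dots> = 2 * mean_log" using integral_gauss_ln by (simp only: integral_mult_right_zero)
  finally show ?thesis by (simp add: mean_log_def)
qed


section \<open>The centred observable and the mean cost\<close>

lemma psi_branch:
  assumes "x \<in> {0<..<1}"
  shows "psi c \<mu> (branch k x) = c (Suc k) - \<mu> * ln (real k + 1 + x)"
proof -
  have "branch k x \<in> {1 / (real (Suc k) + 1)<..1 / real (Suc k)}"
    using assms by (auto simp: branch_def divide_simps)
  then have "psi c \<mu> (branch k x) = c (Suc k) + \<mu> * ln (branch k x)" by (intro psi_eq) auto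
  also have "ln (branch k x) = - ln (real k + 1 + x)"
    using assms by (simp add: branch_def ln_div)
  finally show ?thesis by simp
qed

lemma digit_cell:
  assumes "y \<in> {1 / (real k + 2)<..1 / (real k + 1)}"
  shows "nat \<lfloor>1 / y\<rfloor> = Suc k"
proof -
  have "0 < 1 / (real k + 2)" by simp
  then have "0 < y" using assms less_trans greaterThanAtMost_iff by blast
  then have "real k + 1 \<le> 1 / y" "1 / y < real k + 2"
    using assms by (auto simp: field_simps)
  then have "\<lfloor>1 / y\<rfloor> = int (Suc k)" by (simp add: floor_eq_iff)
  then show ?thesis by simp
qed

lemma digit_measurable [measurable]: "(\<lambda>y. c (nat \<lfloor>1 / y :: real\<rfloor>) :: real) \<in> borel_measurable borel"
proof -
  have "(\<lambda>y::real. nat \<lfloor>1 / y\<rfloor>) \<in> borel \<rightarrow>\<^sub>M count_space UNIV" by measurable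
  then show ?thesis by (rule measurable_compose) simp
qed

lemma psi_measurable [measurable]: "psi c \<mu> \<in> borel_measurable borel"
  unfolding psi_def by measurable

lemma gauss_map_measurable [measurable]: "gauss_map \<in> borel_measurable borel"
  unfolding gauss_map_def by measurable

lemma cell_integral:
  "(LBINT x:{1 / (real (Suc k) + 1)..1 / real (Suc k)}. gauss_density x)
    = (ln (1 + 1 / (real k + 1)) - ln (1 + 1 / (real k + 2))) / ln 2"
  "0 < (ln (1 + 1 / (real k + 1)) - ln (1 + 1 / (real k + 2))) / ln 2"
proof -
  let ?I = "(LBINT x:{1 / (real (Suc k) + 1)..1 / real (Suc k)}. gauss_density x)" and ?w = "(ln (1 + 1 / (real k + 1)) - ln (1 + 1 / (real k + 2))) / ln 2"
  have le: "1 / (real k + 2) \<le> 1 / (real k + 1)" "0 < 1 / (real k + 2)" by (auto simp: frac_le)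
  have "1 / (real k + 2) < 1 / (real k + 1)" by (simp add: frac_less2)
  then have "ln (1 + 1 / (real k + 2)) < ln (1 + 1 / (real k + 1))"
    by (subst ln_less_cancel_iff) (simp_all add: add_pos_pos)
  then show w: "0 < ?w" by simp
  have e: "{1 / (real (Suc k) + 1)..1 / real (Suc k)} = {1 / (real k + 2)..1 / (real k + 1)}"
    by (simp add: add_ac)
  have "?I = enn2real (\<integral>\<^sup>+x. ennreal (gauss_density x) * indicator {1 / (real k + 2)..1 / (real k + 1)} x \<partial>lborel)"
    unfolding set_lebesgue_integral_def e nn_integral_set_ennreal
  proof (subst integral_eq_nn_integral)
    have "0 \<le> x" if "1 / (real k + 2) \<le> x" for x using le(2) that by linarith
    then show "AE x in lborel. 0 \<le> indicat_real {1 / (real k + 2)..1 / (real k + 1)} x *\<^sub>R gauss_density x"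
      by (intro AE_I2) (auto simp: indicator_def gauss_density_nonneg)
  qed (auto simp: mult.commute)
  also have "\<dots> = ?w"
    using le w emeasure_gauss_le[of "1 / (real k + 2)" "1 / (real k + 1)"] by (simp add: divide_le_eq_1)
  finally show "?I = ?w" .
qed

definition cell_weight :: "nat \<Rightarrow> real" where
  "cell_weight k = (LBINT x:{1 / (real (Suc k) + 1)..1 / real (Suc k)}. gauss_density x)"

lemma digit_mean:
  assumes c: "\<And>n. 1 \<le> n \<Longrightarrow> 0 \<le> c n" and bd: "\<And>n. 1 \<le> n \<Longrightarrow> c n \<le> B"
  shows "(\<lambda>k. c (Suc k) * cell_weight k) sums (LINT y|gauss. c (nat \<lfloor>1 / y\<rfloor>))"
proof -
  \<comment> \<open>The integrand is cut off outside the open unit interval: there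
    \<open>nat \<lfloor>1 / y\<rfloor>\<close> may be 0, and c is controlled from 1 onwards
    only.\<close>
  let ?H = "\<lambda>y::real. if 0 < y \<and> y < 1 then c (nat \<lfloor>1 / y\<rfloor>) else 0"
  have n1: "1 \<le> nat \<lfloor>1 / y\<rfloor>" if "0 < y" "y < 1" for y :: real
  proof -
    have "1 \<le> \<lfloor>1 / y\<rfloor>" using that by (simp add: le_floor_iff)
    then show ?thesis by linarith
  qed
  have B: "0 \<le> B" using c[of 1] bd[of 1] by simp
  have Hb: "0 \<le> ?H y" "?H y \<le> B" for y using c bd n1 B by auto
  have Hm [measurable]: "?H \<in> borel_measurable borel" by measurable
  have cell: "(\<integral>\<^sup>+y. ennreal (gauss_density y) * ennreal (?H y) * indicator {1 / (real k + 2)..1 / (real k + 1)} y \<partial>lborel)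
     = ennreal (c (Suc k) * cell_weight k)" for k
  proof -
    have "AE y in lborel. y \<noteq> 1 / (real k + 2)" "AE x in lborel. x \<noteq> (1::real)" by (rule AE_lborel_singleton)+
    then have "AE y in lborel. ennreal (gauss_density y) * ennreal (?H y) * indicator {1 / (real k + 2)..1 / (real k + 1)} y
       = ennreal (c (Suc k)) * (ennreal (gauss_density y) * indicator {1 / (real k + 2)..1 / (real k + 1)} y)"
    proof eventually_elim
      case (elim y)
      show ?case
      proof (cases "y \<in> {1 / (real k + 2)..1 / (real k + 1)}")
        case True
        then have y: "y \<in> {1 / (real k + 2)<..1 / (real k + 1)}" using elim by auto
        have "0 < 1 / (real k + 2)" "1 / (real k + 1) \<le> 1" by auto
        then have "0 < y" "y < 1" using y elim(2) unfolding greaterThanAtMost_iff by linarith+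
        then have "?H y = c (Suc k)" using digit_cell[OF y] by simp
        then show ?thesis by (simp add: mult_ac)
      qed simp
    qed
    then have "(\<integral>\<^sup>+y. ennreal (gauss_density y) * ennreal (?H y) * indicator {1 / (real k + 2)..1 / (real k + 1)} y \<partial>lborel)
       = ennreal (c (Suc k)) * (\<integral>\<^sup>+y. ennreal (gauss_density y) * indicator {1 / (real k + 2)..1 / (real k + 1)} y \<partial>lborel)"
      by (subst nn_integral_cmult[symmetric]) (auto intro: nn_integral_cong_AE)
    also have "(\<integral>\<^sup>+y. ennreal (gauss_density y) * indicator {1 / (real k + 2)..1 / (real k + 1)} y \<partial>lborel) = ennreal (cell_weight k)"
      unfolding cell_weight_def cell_integral(1) by (rule emeasure_gauss_le) (auto simp: frac_le)
    finally show ?thesis using c by (simp add: ennreal_mult')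
  qed
  have nonneg: "0 \<le> c (Suc k) * cell_weight k" for k
    using c cell_integral(2)[of k] unfolding cell_weight_def cell_integral(1) by (intro mult_nonneg_nonneg) auto
  have eq: "(\<Sum>k. ennreal (c (Suc k) * cell_weight k)) = (\<integral>\<^sup>+y. ennreal (?H y) \<partial>gauss)"
    by (subst gauss_cells) (simp_all add: cell)
  have int: "integrable gauss ?H"
    using Hb by (intro gauss.integrable_const_bound[where B=B]) auto
  then have nn: "(\<integral>\<^sup>+y. ennreal (?H y) \<partial>gauss) = ennreal (LINT y|gauss. ?H y)"
    using Hb by (intro nn_integral_eq_integral) auto
  have "(\<lambda>k. ennreal (c (Suc k) * cell_weight k)) sums ennreal (LINT y|gauss. ?H y)"
    using eq nn by (metis summableI summable_sums)
  then have "(\<lambda>k. c (Suc k) * cell_weight k) sums (LINT y|gauss. ?H y)"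
    using nonneg Hb by (subst (asm) sums_ennreal) (auto intro!: integral_nonneg)
  moreover have "(LINT y|gauss. ?H y) = (LINT y|gauss. c (nat \<lfloor>1 / y\<rfloor>))"
    by (rule integral_cong_AE) (auto intro: gauss_AE_I)
  ultimately show ?thesis by simp
qed

subsection \<open>Poisson equations\<close>

text \<open>The summand 1 keeps the value at least 1, so that its powers increase with the
  exponent.\<close>

definition log_size :: "nat \<Rightarrow> real" where
  "log_size k = 1 + ln (real k + 2)"

lemma log_size_ge1: "1 \<le> log_size k"
  by (simp add: log_size_def)

text \<open>Since ln y is at most 16 y^(1/16) and 1 is at most y^(1/16), the constant is 17 = 16 +
  1. The exponent 1/4, rather than 1/2, leaves room for the factor \<open>exp (lam * l)\<close> in
  the perturbed kernel.\<close>

lemma log_power_bound: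
  fixes y :: real
  assumes "1 \<le> y"
  shows "(1 + ln y) ^ 4 \<le> 17 ^ 4 * y powr (1/4)"
proof -
  have "ln y \<le> y powr (1/16) / (1/16)" using assms by (intro ln_powr_bound) auto
  moreover have "1 \<le> y powr (1/16)" using assms by (simp add: ge_one_powr_ge_zero)
  ultimately have "1 + ln y \<le> 17 * y powr (1/16)" by simp
  then have "(1 + ln y) ^ 4 \<le> (17 * y powr (1/16)) ^ 4"
    using assms by (intro power_mono) auto
  also have "\<dots> = 17 ^ 4 * y powr (1/4)"
    using assms by (simp add: power_mult_distrib powr_realpow[symmetric] powr_powr)
  finally show ?thesis .
qed

lemma log_size_power_sqrt: "log_size k ^ 4 \<le> 2 * 17 ^ 4 * sqrt (real k + 1)"
proof -
  have "log_size k ^ 4 \<le> 17 ^ 4 * (real k + 2) powr (1/4)"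
    unfolding log_size_def by (rule log_power_bound) simp
  also have "\<dots> \<le> 17 ^ 4 * (real k + 2) powr (1/2)"
    by (intro mult_left_mono powr_mono) auto
  also have "(real k + 2) powr (1/2) = sqrt (real k + 2)" by (simp add: powr_half_sqrt)
  also have "\<dots> \<le> sqrt (4 * (real k + 1))" by (intro real_sqrt_le_mono) auto
  also have "\<dots> = 2 * sqrt (real k + 1)" by (simp only: real_sqrt_mult real_sqrt_four)
  finally show ?thesis by simp
qed

text \<open>The class \<open>sqrt_lip\<close> is not closed under products. Grading by powers of the
  logarithm is, the degrees adding up, and all degrees up to 4 embed into
  \<open>sqrt_lip\<close>.\<close>

definition log_lip :: "nat \<Rightarrow> (nat \<Rightarrow> real \<Rightarrow> real) \<Rightarrow> real \<Rightarrow> bool" where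
  "log_lip j F A \<longleftrightarrow> (\<forall>k. \<forall>x\<in>{0..1}. \<bar>F k x\<bar> \<le> A * log_size k ^ j) \<and>
     (\<forall>k. \<forall>x\<in>{0..1}. \<forall>y\<in>{0..1}. \<bar>F k x - F k y\<bar> \<le> A * log_size k ^ j * \<bar>x - y\<bar>)"

lemma log_lip_nonneg:
  assumes "log_lip j F A" shows "0 \<le> A"
proof -
  have "\<bar>F 0 0\<bar> \<le> A * log_size 0 ^ j" using assms by (auto simp: log_lip_def)
  then have "0 \<le> A * log_size 0 ^ j" by simp
  moreover have "0 < log_size 0 ^ j" using log_size_ge1[of 0] by (intro zero_less_power) simp
  ultimately show ?thesis by (simp add: zero_le_mult_iff)
qed

lemma log_lip_mono:
  assumes "log_lip i F A" "i \<le> j"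
  shows "log_lip j F A"
proof -
  have "A * log_size k ^ i \<le> A * log_size k ^ j" for k
    using assms log_size_ge1[of k] log_lip_nonneg[OF assms(1)] by (intro mult_left_mono power_increasing) auto
  then show ?thesis using assms(1) unfolding log_lip_def
    by (meson abs_ge_zero mult_right_mono order_trans)
qed

lemma log_lip_sqrt_lip:
  assumes "log_lip j F A" "j \<le> 4"
  shows "sqrt_lip F (2 * 17 ^ 4 * A)"
proof -
  have "A * log_size k ^ 4 \<le> (2 * 17 ^ 4 * A) * sqrt (real k + 1)" for k
    using mult_left_mono[OF log_size_power_sqrt[of k] log_lip_nonneg[OF assms(1)]] by (simp add: mult_ac)
  then show ?thesis using log_lip_mono[OF assms] unfolding log_lip_def sqrt_lip_def
    by (meson abs_ge_zero mult_right_mono order_trans)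
qed

lemma log_lip_add:
  assumes "log_lip j F A" "log_lip j G A'"
  shows "log_lip j (\<lambda>k x. F k x + G k x) (A + A')"
  unfolding log_lip_def
proof (intro conjI allI ballI)
  fix k and x y :: real assume x: "x \<in> {0..1}"
  have "\<bar>F k x\<bar> \<le> A * log_size k ^ j" "\<bar>G k x\<bar> \<le> A' * log_size k ^ j" using assms x by (auto simp: log_lip_def)
  then show "\<bar>F k x + G k x\<bar> \<le> (A + A') * log_size k ^ j"
    unfolding distrib_right by linarith
  assume y: "y \<in> {0..1}"
  have "\<bar>F k x + G k x - (F k y + G k y)\<bar> \<le> \<bar>F k x - F k y\<bar> + \<bar>G k x - G k y\<bar>" by simp
  also have "\<dots> \<le> (A + A') * log_size k ^ j * \<bar>x - y\<bar>"
    unfolding distrib_right using assms x y unfolding log_lip_def by (intro add_mono) auto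
  finally show "\<bar>F k x + G k x - (F k y + G k y)\<bar> \<le> (A + A') * log_size k ^ j * \<bar>x - y\<bar>" .
qed

text \<open>The factor 2 comes from the product rule, which splits a difference of products into two
  terms.\<close>

lemma log_lip_mult:
  assumes "log_lip i F A" "log_lip j G A'"
  shows "log_lip (i + j) (\<lambda>k x. F k x * G k x) (2 * (A * A'))"
  unfolding log_lip_def
proof (intro conjI allI ballI)
  fix k and x y :: real assume x: "x \<in> {0..1}"
  have nn: "0 \<le> A" "0 \<le> A'" "0 \<le> A * log_size k ^ i" "0 \<le> A' * log_size k ^ j"
    using log_lip_nonneg[OF assms(1)] log_lip_nonneg[OF assms(2)] log_size_ge1[of k] by auto
  have F: "\<bar>F k x\<bar> \<le> A * log_size k ^ i" if "x \<in> {0..1}" for x using assms(1) that by (auto simp: log_lip_def)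
  have G: "\<bar>G k x\<bar> \<le> A' * log_size k ^ j" if "x \<in> {0..1}" for x using assms(2) that by (auto simp: log_lip_def)
  have "\<bar>F k x * G k x\<bar> \<le> (A * log_size k ^ i) * (A' * log_size k ^ j)"
    unfolding abs_mult using F[OF x] G[OF x] nn by (intro mult_mono) auto
  also have "\<dots> \<le> 2 * ((A * log_size k ^ i) * (A' * log_size k ^ j))"
    using mult_nonneg_nonneg[OF nn(3,4)] by linarith
  also have "\<dots> = 2 * (A * A') * log_size k ^ (i + j)" by (simp add: power_add)
  finally show "\<bar>F k x * G k x\<bar> \<le> 2 * (A * A') * log_size k ^ (i + j)" .
  assume y: "y \<in> {0..1}"
  have "\<bar>F k x * G k x - F k y * G k y\<bar> = \<bar>F k x * (G k x - G k y) + (F k x - F k y) * G k y\<bar>"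
    by (simp add: algebra_simps)
  also have "\<dots> \<le> \<bar>F k x\<bar> * \<bar>G k x - G k y\<bar> + \<bar>F k x - F k y\<bar> * \<bar>G k y\<bar>"
    by (simp add: abs_mult[symmetric])
  also have "\<dots> \<le> (A * log_size k ^ i) * (A' * log_size k ^ j * \<bar>x - y\<bar>) + (A * log_size k ^ i * \<bar>x - y\<bar>) * (A' * log_size k ^ j)"
    using assms F[OF x] G[OF y] x y nn unfolding log_lip_def by (intro add_mono mult_mono) auto
  finally show "\<bar>F k x * G k x - F k y * G k y\<bar> \<le> 2 * (A * A') * log_size k ^ (i + j) * \<bar>x - y\<bar>"
    by (simp add: power_add mult_ac)
qed

lemma log_lip_const: "log_lip 0 (\<lambda>k x. a) \<bar>a\<bar>"
  by (simp add: log_lip_def)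

lemma log_lip_branch:
  assumes f: "\<And>x y. x \<in> {0..1} \<Longrightarrow> y \<in> {0..1} \<Longrightarrow> \<bar>f x - f y\<bar> \<le> L * \<bar>x - y\<bar>"
    and b: "\<And>x. x \<in> {0..1} \<Longrightarrow> \<bar>f x\<bar> \<le> L"
  shows "log_lip 0 (\<lambda>k x. f (branch k x)) L" "log_lip 0 (\<lambda>k x. f x) L"
proof -
  have L: "0 \<le> L" using b[of 0] by simp
  have "\<bar>f (branch k x) - f (branch k y)\<bar> \<le> L * \<bar>x - y\<bar>" if "x \<in> {0..1}" "y \<in> {0..1}" for k x y
  proof -
    have "1 \<le> (real k + 1 + x) * (real k + 1 + y)" using that by (intro mult_ge1_I) auto
    then have "\<bar>x - y\<bar> * (1 / ((real k + 1 + x) * (real k + 1 + y))) \<le> \<bar>x - y\<bar> * 1"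
      by (intro mult_left_mono) (auto simp: divide_le_eq_1)
    then have "\<bar>branch k x - branch k y\<bar> \<le> \<bar>x - y\<bar>"
      using branch_diff[of x y k] that by simp
    then show ?thesis
      using f[OF branch_mem branch_mem, of x y k k] that L by (meson atLeastAtMost_iff mult_left_mono order_trans)
  qed
  then show "log_lip 0 (\<lambda>k x. f (branch k x)) L"
    using b branch_mem by (auto simp: log_lip_def)
  show "log_lip 0 (\<lambda>k x. f x) L" using f b by (auto simp: log_lip_def)
qed

lemma log_lip_ln: "log_lip 1 (\<lambda>k x. ln (real k + 1 + x)) 1"
proof -
  have "\<bar>ln (real k + 1 + x)\<bar> \<le> log_size k" if "x \<in> {0..1}" for k x
  proof -
    have "ln (real k + 1 + x) \<le> ln (real k + 2)" using that by (subst ln_le_cancel_iff) auto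
    moreover have "0 \<le> ln (real k + 1 + x)" using that by (intro ln_ge_zero) auto
    ultimately show ?thesis by (simp add: log_size_def)
  qed
  moreover have "\<bar>ln (real k + 1 + x) - ln (real k + 1 + y)\<bar> \<le> \<bar>x - y\<bar>" if "x \<in> {0..1}" "y \<in> {0..1}" for k x y
  proof -
    have *: "ln (real k + 1 + b) - ln (real k + 1 + a) \<le> b - a" if "a \<in> {0..1}" "a \<le> b" for a b
    proof -
      have "ln (real k + 1 + b) - ln (real k + 1 + a) = ln ((real k + 1 + b) / (real k + 1 + a))"
        using that by (subst ln_div) auto
      also have "\<dots> \<le> (real k + 1 + b) / (real k + 1 + a) - 1"
        using that by (intro ln_le_minus_one divide_pos_pos) auto
      also have "\<dots> = (b - a) / (real k + 1 + a)" using that by (simp add: field_simps)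
      also have "\<dots> \<le> (b - a) / 1" using that by (intro divide_left_mono) auto
      finally show ?thesis by simp
    qed
    have m: "ln (real k + 1 + a) \<le> ln (real k + 1 + b)" if "a \<in> {0..1}" "a \<le> b" for a b
      using that by (subst ln_le_cancel_iff) auto
    show ?thesis
    proof (cases "x \<le> y")
      case True
      then show ?thesis using *[of x y] m[of x y] that by simp
    next
      case False
      then show ?thesis using *[of y x] m[of y x] that by simp
    qed
  qed
  moreover have "\<bar>x - y\<bar> \<le> log_size k * \<bar>x - y\<bar>" for k and x y :: real
    using mult_right_mono[OF log_size_ge1[of k], of "\<bar>x - y\<bar>"] by simp
  ultimately have "\<bar>ln (real k + 1 + x) - ln (real k + 1 + y)\<bar> \<le> log_size k * \<bar>x - y\<bar>" if "x \<in> {0..1}" "y \<in> {0..1}" for k x y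
    using that order_trans by blast
  with \<open>\<And>x k. x \<in> {0..1} \<Longrightarrow> \<bar>ln (real k + 1 + x)\<bar> \<le> log_size k\<close> show ?thesis unfolding log_lip_def by simp
qed

locale bounded_cost =
  fixes c :: "nat \<Rightarrow> real" and B :: real
  assumes c_nonneg: "\<And>n. 1 \<le> n \<Longrightarrow> 0 \<le> c n"
    and c_le: "\<And>n. 1 \<le> n \<Longrightarrow> c n \<le> B"
    and c_nz: "\<exists>n\<ge>1. c n \<noteq> 0"
begin

definition mean_cost :: real where "mean_cost = (LINT y|gauss. c (nat \<lfloor>1 / y\<rfloor>))"

text \<open>Mean cost per digit divided by mean growth of \<open>ln q\<close> per digit, that is,
  cost per unit of \<open>ln q\<close>. With this choice \<open>psi\<close> has mean zero.\<close>

definition mu :: real where "mu = mean_cost / mean_log"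

definition digit_psi :: "nat \<Rightarrow> real \<Rightarrow> real" where
  "digit_psi k x = c (Suc k) - mu * ln (real k + 1 + x)"

lemma B_nonneg: "0 \<le> B"
  using c_nonneg[of 1] c_le[of 1] by simp

lemma mean_cost_sums: "(\<lambda>k. c (Suc k) * cell_weight k) sums mean_cost"
  unfolding mean_cost_def by (rule digit_mean[OF c_nonneg c_le])

lemma mean_cost_pos: "0 < mean_cost"
proof -
  obtain n where n: "1 \<le> n" "c n \<noteq> 0" using c_nz by blast
  then have "0 < c n" using c_nonneg[of n] by simp
  have w: "0 < cell_weight k" for k
    unfolding cell_weight_def cell_integral(1) by (rule cell_integral(2))
  have "0 < (\<Sum>k. c (Suc k) * cell_weight k)"
  proof (rule suminf_pos2)
    show "summable (\<lambda>k. c (Suc k) * cell_weight k)" using mean_cost_sums by (rule sums_summable)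
    show "0 \<le> c (Suc k) * cell_weight k" for k using c_nonneg[of "Suc k"] w[of k] by simp
    show "0 < c (Suc (n - 1)) * cell_weight (n - 1)" using n \<open>0 < c n\<close> w[of "n - 1"] by simp
  qed
  then show ?thesis using mean_cost_sums by (simp add: sums_iff)
qed

lemma mu_pos: "0 < mu"
  using mean_cost_pos mean_log_pos by (simp add: mu_def)

lemma log_lip_digit_psi: "\<exists>A. log_lip 1 digit_psi A"
proof -
  have "log_lip 0 (\<lambda>k x. c (Suc k)) B"
    using c_nonneg c_le B_nonneg by (simp add: log_lip_def)
  then have "log_lip 1 (\<lambda>k x. c (Suc k)) B" by (rule log_lip_mono) simp
  moreover have "log_lip (0 + 1) (\<lambda>k x. (- mu) * ln (real k + 1 + x)) (2 * (\<bar>- mu\<bar> * 1))"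
    by (rule log_lip_mult[OF log_lip_const log_lip_ln])
  ultimately have "log_lip 1 (\<lambda>k x. c (Suc k) + (- mu) * ln (real k + 1 + x)) (B + 2 * (\<bar>- mu\<bar> * 1))"
    by (intro log_lip_add) simp_all
  then show ?thesis by (auto simp: digit_psi_def[abs_def])
qed

lemma psi_digit_psi: "x \<in> {0<..<1} \<Longrightarrow> psi c mu (branch k x) = digit_psi k x"
  by (simp add: psi_branch digit_psi_def)

lemma integrable_ln: "integrable gauss (\<lambda>x. ln x)"
proof -
  have "ln (branch k x) = - ln (real k + 1 + x)" if "x \<in> {0<..<1}" for k x
    using that by (simp add: branch_def ln_div)
  then show ?thesis
    using gauss_branch_mean(1)[OF sqrt_lip_minus[OF log_lip_sqrt_lip[OF log_lip_ln]], of ln] by auto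
qed

lemma integral_psi: "(LINT x|gauss. psi c mu x) = 0"
proof -
  have i: "integrable gauss (\<lambda>y. c (nat \<lfloor>1 / y\<rfloor>))"
  proof (rule gauss.integrable_const_bound)
    show "AE y in gauss. norm (c (nat \<lfloor>1 / y\<rfloor>)) \<le> B"
    proof (rule gauss_AE_I)
      fix y :: real assume "y \<in> {0<..<1}"
      then have "1 \<le> \<lfloor>1 / y\<rfloor>" by (simp add: le_floor_iff)
      then have "1 \<le> nat \<lfloor>1 / y\<rfloor>" by linarith
      then show "norm (c (nat \<lfloor>1 / y\<rfloor>)) \<le> B" using c_nonneg c_le by simp
    qed
  qed simp
  have "(LINT x|gauss. psi c mu x) = (LINT y|gauss. c (nat \<lfloor>1 / y\<rfloor>) + mu * ln y)"
    by (rule integral_cong_AE, measurable, rule gauss_AE_I) (simp add: psi_def)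
  also have "\<dots> = mean_cost + mu * (LINT y|gauss. ln y)"
    using i integrable_ln by (simp add: mean_cost_def)
  also have "(LINT y|gauss. ln y) = - mean_log" using integral_gauss_ln by simp
  also have "mean_cost + mu * (- mean_log) = 0" using mean_log_pos by (simp add: mu_def)
  finally show ?thesis .
qed

end

text \<open>The functions g and u are the coefficients of i t and of t^2 in the approximate
  eigenfunction \<open>char_eigen\<close>; the two equations say that the perturbed kernel
  reproduces both coefficients. The variance \<open>sig2\<close> is taken per unit of
  \<open>ln q\<close>, whence the factor \<open>mean_log\<close> that converts it into a variance
  per digit.\<close>

locale gauss_clt = bounded_cost +
  fixes g u :: "real \<Rightarrow> real" and L sig2 :: real
  assumes g_eq: "\<And>x. x \<in> {0..1} \<Longrightarrow> g x = branch_mean (\<lambda>k x. digit_psi k x + g (branch k x)) x"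
    and g_bd: "\<And>x. x \<in> {0..1} \<Longrightarrow> \<bar>g x\<bar> \<le> L"
    and g_lip: "\<And>x y. x \<in> {0..1} \<Longrightarrow> y \<in> {0..1} \<Longrightarrow> \<bar>g x - g y\<bar> \<le> L * \<bar>x - y\<bar>"
    and u_eq: "\<And>x. x \<in> {0..1} \<Longrightarrow> u x = branch_mean (\<lambda>k x. - (digit_psi k x)\<^sup>2 / 2 - digit_psi k x * g (branch k x)
        + sig2 / 2 * ln (real k + 1 + x) + u (branch k x)) x"
    and u_bd: "\<And>x. x \<in> {0..1} \<Longrightarrow> \<bar>u x\<bar> \<le> L"
    and u_lip: "\<And>x y. x \<in> {0..1} \<Longrightarrow> y \<in> {0..1} \<Longrightarrow> \<bar>u x - u y\<bar> \<le> L * \<bar>x - y\<bar>"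
    and sig2_pos: "0 < sig2"
    and sig2_eq: "sig2 * mean_log = gauss_mean (branch_mean (\<lambda>k x. (digit_psi k x + g (branch k x) - g x)\<^sup>2))"

lemma branch_mean_gauss_op_add:
  assumes "sqrt_lip F A" "x \<in> {0..1}" "\<And>a. a \<in> {0..1} \<Longrightarrow> \<bar>f a\<bar> \<le> L"
  shows "branch_mean (\<lambda>k x. F k x + f (branch k x)) x = branch_mean F x + gauss_op f x"
  unfolding branch_mean_def gauss_op_def
  using sqrt_lip_integrable[OF assms(1,2,2)] digit_pmf_integrable_bounded[of "\<lambda>k. f (branch k x)" L x] assms branch_mem[of x]
  by simp

context bounded_cost
begin

text \<open>A large digit makes the increment at most - 1, as the logarithm outweighs the bounded
  cost and the two values of g. Such digits have a probability bounded below uniformly in x, so the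
  mean square is at least that probability.\<close>

lemma variance_pos:
  assumes g_bd: "\<And>x. x \<in> {0..1} \<Longrightarrow> \<bar>g x\<bar> \<le> L"
    and m: "sqrt_lip (\<lambda>k x. (digit_psi k x + g (branch k x) - g x)\<^sup>2) A"
  shows "0 < gauss_mean (branch_mean (\<lambda>k x. (digit_psi k x + g (branch k x) - g x)\<^sup>2))"
proof -
  let ?m = "\<lambda>k x. (digit_psi k x + g (branch k x) - g x)\<^sup>2"
  \<comment> \<open>Beyond this index \<open>mu * ln (k + 1 + x)\<close> is at least B + 2 L + 1: B
    against the cost, 2 L against g, and 1 to spare.\<close>
  define K where "K = nat \<lceil>exp ((B + 2 * L + 1) / mu)\<rceil>"
  have big: "1 \<le> ?m k x" if "K \<le> k" "x \<in> {0..1}" for k x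
  proof -
    have "exp ((B + 2 * L + 1) / mu) \<le> real K" unfolding K_def by (rule real_nat_ceiling_ge)
    also have "\<dots> \<le> real k + 1 + x" using that by simp
    finally have "(B + 2 * L + 1) / mu \<le> ln (real k + 1 + x)"
      using that by (subst ln_ge_iff) auto
    then have "B + 2 * L + 1 \<le> mu * ln (real k + 1 + x)"
      using mu_pos by (simp add: divide_le_eq mult.commute)
    moreover have "\<bar>g (branch k x)\<bar> \<le> L" "\<bar>g x\<bar> \<le> L" using g_bd branch_mem[of x k] that by auto
    ultimately have "digit_psi k x + g (branch k x) - g x \<le> - 1"
      using c_le[of "Suc k"] unfolding digit_psi_def by simp
    then have "1 * 1 \<le> - (digit_psi k x + g (branch k x) - g x) * - (digit_psi k x + g (branch k x) - g x)"
      by (intro mult_mono) auto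
    then show ?thesis by (simp only: power2_eq_square minus_mult_minus mult_1)
  qed
  have lower: "1 / (real K + 2) \<le> branch_mean ?m x" if x: "x \<in> {0..1}" for x
  proof -
    have "1 / (real K + 2) \<le> digit_tail K x"
      using x unfolding digit_tail_def by (intro frac_le) auto
    also have "\<dots> = measure_pmf.expectation (digit_pmf x) (indicat_real {K..})"
      using digit_pmf_prob_ge[of x K] x by simp
    also have "\<dots> \<le> branch_mean ?m x"
      unfolding branch_mean_def using sqrt_lip_integrable[OF m x x] big x
      by (intro integral_mono) (auto simp: indicator_def intro: measure_pmf.integrable_const_bound[where B=1])
    finally show ?thesis .
  qed
  have "1 / (real K + 2) = (LINT x|gauss. 1 / (real K + 2))" using gauss.prob_space by simp
  also have "\<dots> \<le> gauss_mean (branch_mean ?m)"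
    unfolding gauss_mean_def
  proof (rule integral_mono_AE)
    show "AE x in gauss. 1 / (real K + 2) \<le> indicator {0..1} x * branch_mean ?m x"
      by (rule gauss_AE_I) (use lower in auto)
  qed (use branch_mean_integrable[OF m] in auto)
  finally show ?thesis by (rule less_le_trans[rotated]) simp
qed

lemma ex_gauss_clt: "\<exists>g u L sig2. gauss_clt c B g u L sig2"
proof -
  obtain A where A: "log_lip 1 digit_psi A" using log_lip_digit_psi by blast
  note npsi = log_lip_sqrt_lip[OF A]
  obtain g Lg where g: "\<And>x. x \<in> {0..1} \<Longrightarrow> g x = branch_mean digit_psi x + gauss_op g x"
    and gb: "\<And>x. x \<in> {0..1} \<Longrightarrow> \<bar>g x\<bar> \<le> Lg"
    and gl: "\<And>x y. x \<in> {0..1} \<Longrightarrow> y \<in> {0..1} \<Longrightarrow> \<bar>g x - g y\<bar> \<le> Lg * \<bar>x - y\<bar>"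
    using poisson_equation[OF npsi psi_measurable psi_digit_psi integral_psi] by auto
  have g_eq: "g x = branch_mean (\<lambda>k x. digit_psi k x + g (branch k x)) x" if "x \<in> {0..1}" for x
    using g[OF that] branch_mean_gauss_op_add[OF npsi that, of g Lg] gb by simp
  have lgb: "log_lip 0 (\<lambda>k x. g (branch k x)) Lg" "log_lip 0 (\<lambda>k x. g x) Lg"
    using log_lip_branch[of g Lg] gl gb by blast+
  let ?G = "\<lambda>x. indicator {0..1} x * g x"
  have G [measurable]: "?G \<in> borel_measurable borel" by (rule lip_measurable[OF gl])
  have Gbr: "?G (branch k x) = g (branch k x)" if "x \<in> {0<..<1}" for k x
    using that branch_mem[of x k] by simp
  define h where "h k x = digit_psi k x + g (branch k x)" for k x
  obtain Ah where h: "log_lip 1 h Ah"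
    unfolding h_def[abs_def] using log_lip_add[OF A log_lip_mono[OF lgb(1)]] by auto
  define m where "m k x = h k x - g x" for k x
  obtain Am where m: "log_lip 1 m Am"
  proof -
    have "log_lip (0 + 0) (\<lambda>k x. (-1) * g x) (2 * (\<bar>-1\<bar> * Lg))"
      by (rule log_lip_mult[OF log_lip_const lgb(2)])
    then have "log_lip 1 (\<lambda>k x. - g x) (2 * Lg)" using log_lip_mono[of 0 "\<lambda>k x. - g x" "2 * Lg" 1] by simp
    from log_lip_add[OF h this] show ?thesis using that by (auto simp: m_def[abs_def])
  qed
  obtain Am2 where m2: "sqrt_lip (\<lambda>k x. (m k x)\<^sup>2) Am2"
    using log_lip_sqrt_lip[OF log_lip_mult[OF m m]] by (auto simp: power2_eq_square)
  obtain Ah2 where h2: "sqrt_lip (\<lambda>k x. (h k x)\<^sup>2) Ah2"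
    using log_lip_sqrt_lip[OF log_lip_mult[OF h h]] by (auto simp: power2_eq_square)
  define asymp_var where "asymp_var = gauss_mean (branch_mean (\<lambda>k x. (digit_psi k x + g (branch k x) - g x)\<^sup>2))"
  have Vm: "asymp_var = gauss_mean (branch_mean (\<lambda>k x. (m k x)\<^sup>2))" by (simp add: asymp_var_def m_def h_def)
  have Vpos: "0 < asymp_var"
    unfolding asymp_var_def by (rule variance_pos[OF gb]) (use m2 in \<open>simp_all add: m_def h_def\<close>)
  \<comment> \<open>The value for which the right-hand side of the second Poisson equation has mean
    zero.\<close>
  define sig2 where "sig2 = asymp_var / mean_log"
  have sig2: "0 < sig2" "sig2 * mean_log = asymp_var" using Vpos mean_log_pos by (auto simp: sig2_def)
  \<comment> \<open>Conditional variance: since g is the conditional mean of h, the mean of (h -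
    g)^2 is the mean of h^2 minus that of g^2. Stationarity then rewrites the mean of h^2 as an
    integral over the interval.\<close>
  have V_h: "asymp_var = (LINT y|gauss. (psi c mu y + ?G y)\<^sup>2) - (LINT y|gauss. (?G y)\<^sup>2)"
  proof -
    have EFm: "branch_mean (\<lambda>k x. (m k x)\<^sup>2) x = branch_mean (\<lambda>k x. (h k x)\<^sup>2) x - (g x)\<^sup>2" if x: "x \<in> {0..1}" for x
    proof -
      note i1 = sqrt_lip_integrable[OF h2 x x] and i2 = sqrt_lip_integrable[OF log_lip_sqrt_lip[OF h] x x, simplified]
      have "branch_mean (\<lambda>k x. (m k x)\<^sup>2) x = measure_pmf.expectation (digit_pmf x) (\<lambda>k. (h k x)\<^sup>2 - 2 * g x * h k x + (g x)\<^sup>2)"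
        unfolding branch_mean_def m_def by (simp add: power2_eq_square algebra_simps)
      also have "\<dots> = branch_mean (\<lambda>k x. (h k x)\<^sup>2) x - 2 * g x * branch_mean h x + (g x)\<^sup>2"
        unfolding branch_mean_def using i1 i2 by simp
      also have "branch_mean h x = g x" using g_eq[OF x] by (simp add: h_def[abs_def])
      finally show ?thesis by (simp add: power2_eq_square)
    qed
    have ig: "integrable gauss (\<lambda>y. (?G y)\<^sup>2)"
    proof (rule gauss.integrable_const_bound)
      have "\<bar>?G y\<bar> \<le> Lg" for y using gb[of y] gb[of 0] by (auto simp: indicator_def)
      then have "(?G y)\<^sup>2 \<le> Lg\<^sup>2" for y by (metis abs_ge_zero power2_abs power_mono)
      then show "AE y in gauss. norm ((?G y)\<^sup>2) \<le> Lg\<^sup>2" by simp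
    qed simp
    have "asymp_var = (LINT x|gauss. indicator {0..1} x * branch_mean (\<lambda>k x. (h k x)\<^sup>2) x - (?G x)\<^sup>2)"
      unfolding Vm gauss_mean_def by (intro Bochner_Integration.integral_cong refl) (auto simp: EFm indicator_def)
    also have "\<dots> = (LINT x|gauss. indicator {0..1} x * branch_mean (\<lambda>k x. (h k x)\<^sup>2) x) - (LINT x|gauss. (?G x)\<^sup>2)"
      by (rule Bochner_Integration.integral_diff[OF branch_mean_integrable[OF h2] ig])
    also have "(LINT x|gauss. indicator {0..1} x * branch_mean (\<lambda>k x. (h k x)\<^sup>2) x) = (LINT y|gauss. (psi c mu y + ?G y)\<^sup>2)"
      using gauss_branch_mean(2)[OF h2, of "\<lambda>y. (psi c mu y + ?G y)\<^sup>2"] by (simp add: Gbr psi_digit_psi h_def)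
    finally show ?thesis .
  qed
  define F2 where "F2 k x = - (digit_psi k x)\<^sup>2 / 2 - digit_psi k x * g (branch k x) + sig2 / 2 * ln (real k + 1 + x)" for k x
  let ?H2 = "\<lambda>y. - (psi c mu y)\<^sup>2 / 2 - psi c mu y * ?G y - sig2 / 2 * ln y"
  obtain A2 where F2: "sqrt_lip F2 A2"
  proof -
    have 1: "log_lip 2 (\<lambda>k x. (-1/2) * (digit_psi k x * digit_psi k x)) (2 * (\<bar>-1/2\<bar> * (2 * (A * A))))"
      using log_lip_mult[OF log_lip_const log_lip_mult[OF A A], of "-1/2"] by (simp add: numeral_2_eq_2)
    have 2: "log_lip 2 (\<lambda>k x. (-1) * (digit_psi k x * g (branch k x))) (2 * (\<bar>-1\<bar> * (2 * (A * Lg))))"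
      using log_lip_mult[OF log_lip_const log_lip_mult[OF A lgb(1)], of "-1"] by (rule log_lip_mono) arith
    have 3: "log_lip 2 (\<lambda>k x. (sig2 / 2) * ln (real k + 1 + x)) (2 * (\<bar>sig2 / 2\<bar> * 1))"
      using log_lip_mult[OF log_lip_const log_lip_ln, of "sig2 / 2"] by (rule log_lip_mono) arith
    have "F2 = (\<lambda>k x. (-1/2) * (digit_psi k x * digit_psi k x) + (-1) * (digit_psi k x * g (branch k x)) + (sig2 / 2) * ln (real k + 1 + x))"
      by (auto simp: F2_def fun_eq_iff power2_eq_square)
    with log_lip_sqrt_lip[OF log_lip_add[OF log_lip_add[OF 1 2] 3]] show ?thesis using that by auto
  qed
  have H2F: "?H2 (branch k x) = F2 k x" if "x \<in> {0<..<1}" for k x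
    using that unfolding F2_def Gbr[OF that] psi_digit_psi[OF that] by (simp add: branch_def ln_div)
  \<comment> \<open>Completing the square, psi^2 + 2 psi g = (psi + g)^2 - g^2, makes
    \<open>V_h\<close> applicable. What remains cancels by the choice of
    \<open>sig2\<close>.\<close>
  have int0: "(LINT y|gauss. ?H2 y) = 0"
  proof -
    have i1: "integrable gauss (\<lambda>y. (psi c mu y + ?G y)\<^sup>2)"
      using gauss_branch_mean(1)[OF h2, of "\<lambda>y. (psi c mu y + ?G y)\<^sup>2"] by (simp add: Gbr psi_digit_psi h_def)
    have i2: "integrable gauss (\<lambda>y. (?G y)\<^sup>2)"
    proof (rule gauss.integrable_const_bound)
      have "\<bar>?G y\<bar> \<le> Lg" for y using gb[of y] gb[of 0] by (auto simp: indicator_def)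
      then have "(?G y)\<^sup>2 \<le> Lg\<^sup>2" for y by (metis abs_ge_zero power2_abs power_mono)
      then show "AE y in gauss. norm ((?G y)\<^sup>2) \<le> Lg\<^sup>2" by simp
    qed simp
    have "(LINT y|gauss. ?H2 y) = (LINT y|gauss. (-1/2) * ((psi c mu y + ?G y)\<^sup>2 - (?G y)\<^sup>2) - sig2 / 2 * ln y)"
      by (intro Bochner_Integration.integral_cong refl) (simp add: power2_eq_square field_simps)
    also have "\<dots> = (-1/2) * ((LINT y|gauss. (psi c mu y + ?G y)\<^sup>2) - (LINT y|gauss. (?G y)\<^sup>2)) - sig2 / 2 * (LINT y|gauss. ln y)"
      using i1 i2 integrable_ln by simp
    also have "\<dots> = (-1/2) * asymp_var + sig2 / 2 * mean_log"
    proof -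
      have "(LINT y|gauss. ln y) = - mean_log" using integral_gauss_ln by simp
      then show ?thesis unfolding V_h by simp
    qed
    also have "\<dots> = 0" using sig2(2) by simp
    finally show ?thesis .
  qed
  obtain u Lu where u: "\<And>x. x \<in> {0..1} \<Longrightarrow> u x = branch_mean F2 x + gauss_op u x"
    and ub: "\<And>x. x \<in> {0..1} \<Longrightarrow> \<bar>u x\<bar> \<le> Lu"
    and ul: "\<And>x y. x \<in> {0..1} \<Longrightarrow> y \<in> {0..1} \<Longrightarrow> \<bar>u x - u y\<bar> \<le> Lu * \<bar>x - y\<bar>"
    using poisson_equation[OF F2 _ H2F int0] by (auto simp: psi_measurable)
  have u_eq: "u x = branch_mean (\<lambda>k x. F2 k x + u (branch k x)) x" if "x \<in> {0..1}" for x
    using u[OF that] branch_mean_gauss_op_add[OF F2 that, of u Lu] ub by simp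
  have "gauss_clt c B g u (max Lg Lu) sig2"
  proof unfold_locales
    show "g x = branch_mean (\<lambda>k x. digit_psi k x + g (branch k x)) x" if "x \<in> {0..1}" for x by (rule g_eq[OF that])
    show "u x = branch_mean (\<lambda>k x. - (digit_psi k x)\<^sup>2 / 2 - digit_psi k x * g (branch k x) + sig2 / 2 * ln (real k + 1 + x) + u (branch k x)) x"
      if "x \<in> {0..1}" for x using u_eq[OF that] by (simp add: F2_def[abs_def])
    show "\<bar>g x\<bar> \<le> max Lg Lu" "\<bar>u x\<bar> \<le> max Lg Lu" if "x \<in> {0..1}" for x
      using gb[OF that] ub[OF that] by auto
    show "\<bar>g x - g y\<bar> \<le> max Lg Lu * \<bar>x - y\<bar>" "\<bar>u x - u y\<bar> \<le> max Lg Lu * \<bar>x - y\<bar>"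
      if "x \<in> {0..1}" "y \<in> {0..1}" for x y
      using order_trans[OF gl[OF that] mult_right_mono[of Lg "max Lg Lu"]]
        order_trans[OF ul[OF that] mult_right_mono[of Lu "max Lg Lu"]] by auto
    show "0 < sig2" by (rule sig2)
    show "sig2 * mean_log = gauss_mean (branch_mean (\<lambda>k x. (digit_psi k x + g (branch k x) - g x)\<^sup>2))" using sig2 by (simp add: asymp_var_def)
  qed
  then show ?thesis by blast
qed

end

subsection \<open>The perturbed kernel\<close>

text \<open>Expansion to second order in t with an error explicit in the digit, which enters through
  e; D bounds everything that does not depend on the digit. As lam is of order t^2, the square of
  \<open>lam * l\<close> and its product with i t p already belong to the error. The factor
  \<open>exp (lam * l)\<close> stems from the remainder of the exponential series and has to be
  absorbed by the moments of the digit law.\<close>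

lemma exp_product_expansion:
  fixes t p l g u s D e :: real
  defines "lam \<equiv> s * t\<^sup>2 / 2"
  assumes D: "1 \<le> D" and e: "1 \<le> e" and t: "\<bar>t\<bar> \<le> 1"
    and p: "\<bar>p\<bar> \<le> D * e" and l: "0 \<le> l" "l \<le> e" and g: "\<bar>g\<bar> \<le> D" and u: "\<bar>u\<bar> \<le> D"
    and s: "0 \<le> s" "s \<le> D"
  shows "cmod (exp (\<i> * of_real (t * p) + of_real (lam * l)) * (1 + \<i> * of_real (t * g) + of_real (t\<^sup>2 * u))
      - (1 + \<i> * of_real (t * (p + g)) + of_real (t\<^sup>2 * (- p\<^sup>2 / 2 - p * g + s / 2 * l + u))))
    \<le> 33 * D ^ 4 * \<bar>t\<bar> ^ 3 * (e ^ 3 * exp (lam * l))"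
proof -
  define a where "a = \<bar>t\<bar>"
  have a: "0 \<le> a" "a \<le> 1" and a2: "t\<^sup>2 = a\<^sup>2" using t by (auto simp: a_def)
  define P1 P2 Q1 Q2 :: complex where "P1 = \<i> * of_real (t * p)" and "P2 = of_real (t\<^sup>2 * (- p\<^sup>2 / 2 + s / 2 * l))"
    and "Q1 = \<i> * of_real (t * g)" and "Q2 = of_real (t\<^sup>2 * u)"
  define z where "z = P1 + of_real (lam * l)"
  define R where "R = exp z - (1 + z + z\<^sup>2 / 2)"
  define E1 where "E1 = P1 * of_real (lam * l) + of_real ((lam * l)\<^sup>2 / 2) + R"
  have lam0: "0 \<le> lam" "lam \<le> D * a\<^sup>2"
  proof -
    have "0 \<le> s * a\<^sup>2" using s by simp
    moreover have "s * a\<^sup>2 \<le> D * a\<^sup>2" using s by (intro mult_right_mono) auto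
    moreover have "lam = s * a\<^sup>2 / 2" by (simp add: lam_def a2)
    ultimately show "0 \<le> lam" "lam \<le> D * a\<^sup>2" by linarith+
  qed
  have De: "0 \<le> D * e" "1 \<le> D * e" using D e by (auto intro: mult_ge1_I)
  have nP1: "cmod P1 \<le> a * (D * e)"
    unfolding P1_def norm_mult norm_ii norm_of_real abs_mult using p a by (simp add: a_def mult_left_mono)
  have nlam: "cmod (of_real (lam * l)) \<le> a\<^sup>2 * (D * e)"
  proof -
    have "lam * l \<le> (D * a\<^sup>2) * e" using lam0 l D by (intro mult_mono) auto
    then show ?thesis using lam0 l unfolding norm_of_real by (simp add: mult_ac)
  qed
  have nP2: "cmod P2 \<le> a\<^sup>2 * (D * e)\<^sup>2"
  proof -
    have "p\<^sup>2 \<le> (D * e)\<^sup>2" using p De by (metis abs_ge_zero power2_abs power_mono)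
    moreover have "s * l \<le> D * e" using s l D by (intro mult_mono) auto
    moreover have "D * e \<le> (D * e)\<^sup>2" using mult_left_mono[OF De(2) De(1)] by (simp add: power2_eq_square)
    moreover have "0 \<le> s * l" using s l by simp
    moreover have "0 \<le> p\<^sup>2" by simp
    moreover have "- p\<^sup>2 / 2 + s / 2 * l = (s * l - p\<^sup>2) / 2" by (simp add: field_simps)
    ultimately have "\<bar>- p\<^sup>2 / 2 + s / 2 * l\<bar> \<le> (D * e)\<^sup>2"
      by linarith
    then show ?thesis unfolding P2_def norm_of_real abs_mult a2 by (simp add: mult_left_mono)
  qed
  have nQ1: "cmod Q1 \<le> a * D"
    unfolding Q1_def norm_mult norm_ii norm_of_real abs_mult using g a by (simp add: a_def mult_left_mono)
  have nQ2: "cmod Q2 \<le> a\<^sup>2 * D"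
    unfolding Q2_def norm_of_real abs_mult a2 using u by (simp add: mult_left_mono)
  have a32: "a\<^sup>2 \<le> a" "a ^ 4 \<le> a ^ 3" using a by (auto simp: power_decreasing power2_eq_square mult_left_le)
  have nz: "cmod z \<le> 2 * a * (D * e)"
  proof -
    have "cmod z \<le> a * (D * e) + a\<^sup>2 * (D * e)" unfolding z_def using nP1 nlam norm_triangle_le add_mono by blast
    also have "\<dots> \<le> a * (D * e) + a * (D * e)" using a32 De by (intro add_left_mono mult_right_mono) auto
    also have "\<dots> = 2 * a * (D * e)" by simp
    finally show ?thesis .
  qed
  have "cmod R \<le> exp \<bar>Re z\<bar> * cmod z ^ 3 / 2"
    using Taylor_exp[of z 2] unfolding R_def by (simp add: numeral_2_eq_2 power2_eq_square power3_eq_cube add_ac)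
  also have "\<bar>Re z\<bar> = lam * l" using lam0 l by (simp add: z_def P1_def)
  also have "exp (lam * l) * cmod z ^ 3 / 2 \<le> exp (lam * l) * (2 * a * (D * e)) ^ 3 / 2"
    using nz by (intro divide_right_mono mult_left_mono power_mono) auto
  finally have nR: "cmod R \<le> 4 * (a ^ 3 * D ^ 3 * (e ^ 3 * exp (lam * l)))"
    by (simp add: power_mult_distrib mult_ac)
  define X where "X = a ^ 3 * (e ^ 3 * exp (lam * l))"
  have E: "1 \<le> exp (lam * l)" using lam0 l by simp
  have X0: "0 \<le> X" using a e by (simp add: X_def)
  have e23: "e ^ i \<le> e ^ 3 * exp (lam * l)" if "i \<le> 3" for i
  proof -
    have "e ^ i * 1 \<le> e ^ 3 * exp (lam * l)" using that e E by (intro mult_mono power_increasing) auto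
    then show ?thesis by simp
  qed
  \<comment> \<open>Every error term is a monomial of degree at least 3 in a and at most 3 in D and
    in e. Since a is at most 1 while D and e are at least 1, all of them compare with the single
    quantity \<open>D ^ 3 * X\<close>.\<close>
  have mono: "a ^ i * D ^ n * e ^ j \<le> D ^ 3 * X" if "3 \<le> i" "n \<le> 3" "j \<le> 3" for i n j
  proof -
    have "a ^ i * D ^ n * e ^ j \<le> a ^ 3 * D ^ 3 * (e ^ 3 * exp (lam * l))"
      using a D e that e23[OF that(3)]
      by (intro mult_mono power_decreasing power_increasing) auto
    also have "\<dots> = D ^ 3 * X" by (simp add: X_def)
    finally show ?thesis .
  qed
  have nE1: "cmod E1 \<le> 6 * (D ^ 3 * X)"
  proof -
    have "cmod (P1 * of_real (lam * l)) \<le> (a * (D * e)) * (a\<^sup>2 * (D * e))"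
      unfolding norm_mult by (rule mult_mono[OF nP1 nlam]) (use a De in auto)
    also have "\<dots> = a ^ 3 * D ^ 2 * e ^ 2" by (simp add: power2_eq_square power3_eq_cube)
    also have "\<dots> \<le> D ^ 3 * X" by (rule mono) auto
    finally have 1: "cmod (P1 * of_real (lam * l)) \<le> D ^ 3 * X" .
    have "cmod (of_real ((lam * l)\<^sup>2 / 2)) = (cmod (of_real (lam * l)))\<^sup>2 / 2"
      unfolding norm_of_real by simp
    also have "\<dots> \<le> (a\<^sup>2 * (D * e))\<^sup>2 / 2"
      using nlam by (intro divide_right_mono power_mono) auto
    also have "\<dots> \<le> (a\<^sup>2 * (D * e))\<^sup>2" by simp
    also have "\<dots> = a ^ 4 * D ^ 2 * e ^ 2" by (simp add: power_mult_distrib)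
    also have "\<dots> \<le> D ^ 3 * X" by (rule mono) auto
    finally have 2: "cmod (of_real ((lam * l)\<^sup>2 / 2)) \<le> D ^ 3 * X" .
    have "cmod E1 \<le> D ^ 3 * X + D ^ 3 * X + 4 * (D ^ 3 * X)"
      unfolding E1_def using 1 2 nR by (intro order_trans[OF norm_triangle_ineq] add_mono) (auto simp: X_def mult_ac)
    also have "\<dots> = 6 * (D ^ 3 * X)" by simp
    finally show ?thesis .
  qed
  have nh: "cmod (1 + Q1 + Q2) \<le> 3 * D"
  proof -
    have "a * D \<le> 1 * D" "a\<^sup>2 * D \<le> 1 * D" using a a32 D by (intro mult_right_mono; simp)+
    then have "cmod Q1 \<le> D" "cmod Q2 \<le> D" using nQ1 nQ2 by auto
    then have "cmod (1 + Q1 + Q2) \<le> 1 + D + D"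
      by (intro order_trans[OF norm_triangle_ineq] add_mono) auto
    then show ?thesis using D by simp
  qed
  have expz: "exp z = 1 + P1 + P2 + E1"
  proof -
    have "z\<^sup>2 / 2 = of_real (- (t\<^sup>2 * p\<^sup>2) / 2) + P1 * of_real (lam * l) + of_real ((lam * l)\<^sup>2 / 2)"
      unfolding z_def P1_def by (simp add: power2_eq_square algebra_simps) (simp add: field_simps)
    moreover have "of_real (lam * l) + of_real (- (t\<^sup>2 * p\<^sup>2) / 2) = P2"
      unfolding P2_def lam_def by (simp add: algebra_simps)
    ultimately show ?thesis unfolding E1_def R_def z_def by (simp add: algebra_simps)
  qed
  have "exp z * (1 + Q1 + Q2) - (1 + \<i> * of_real (t * (p + g)) + of_real (t\<^sup>2 * (- p\<^sup>2 / 2 - p * g + s / 2 * l + u)))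
     = P1 * Q2 + P2 * Q1 + P2 * Q2 + E1 * (1 + Q1 + Q2)"
  proof -
    have eqq: "1 + \<i> * of_real (t * (p + g)) + of_real (t\<^sup>2 * (- p\<^sup>2 / 2 - p * g + s / 2 * l + u)) = 1 + (P1 + Q1) + (P2 + P1 * Q1 + Q2)"
      unfolding P1_def P2_def Q1_def Q2_def by (simp add: power2_eq_square algebra_simps)
    show ?thesis unfolding expz eqq by (simp add: algebra_simps)
  qed
  \<comment> \<open>The first three terms contribute 1 each and the last one 18, so the constant 33
    is generous.\<close>
  also have "cmod \<dots> \<le> 33 * D ^ 4 * X"
  proof -
    have D34: "D ^ 3 * X \<le> D ^ 4 * X" using D X0 by (intro mult_right_mono power_increasing) auto
    have "cmod (P1 * Q2) \<le> (a * (D * e)) * (a\<^sup>2 * D)"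
      unfolding norm_mult using nP1 nQ2 a De by (intro mult_mono) auto
    also have "\<dots> = a ^ 3 * D ^ 2 * e ^ 1" by (simp add: power2_eq_square power3_eq_cube)
    also have "\<dots> \<le> D ^ 3 * X" by (rule mono) auto
    finally have 1: "cmod (P1 * Q2) \<le> D ^ 3 * X" .
    have "cmod (P2 * Q1) \<le> (a\<^sup>2 * (D * e)\<^sup>2) * (a * D)"
      unfolding norm_mult using nP2 nQ1 a De by (intro mult_mono) auto
    also have "\<dots> = a ^ 3 * D ^ 3 * e ^ 2" by (simp add: power2_eq_square power3_eq_cube)
    also have "\<dots> \<le> D ^ 3 * X" by (rule mono) auto
    finally have 2: "cmod (P2 * Q1) \<le> D ^ 3 * X" .
    have "cmod (P2 * Q2) \<le> (a\<^sup>2 * (D * e)\<^sup>2) * (a\<^sup>2 * D)"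
      unfolding norm_mult using nP2 nQ2 a De by (intro mult_mono) auto
    also have "\<dots> = a ^ 4 * D ^ 3 * e ^ 2" by (simp add: power2_eq_square power3_eq_cube power4_eq_xxxx)
    also have "\<dots> \<le> D ^ 3 * X" by (rule mono) auto
    finally have 3: "cmod (P2 * Q2) \<le> D ^ 3 * X" .
    have "cmod (E1 * (1 + Q1 + Q2)) \<le> (6 * (D ^ 3 * X)) * (3 * D)"
      unfolding norm_mult using nE1 nh D X0 by (intro mult_mono) auto
    also have "\<dots> = 18 * (D ^ 4 * X)" by (simp add: power3_eq_cube power4_eq_xxxx)
    finally have 4: "cmod (E1 * (1 + Q1 + Q2)) \<le> 18 * (D ^ 4 * X)" .
    have "cmod (P1 * Q2 + P2 * Q1 + P2 * Q2 + E1 * (1 + Q1 + Q2)) \<le> D ^ 3 * X + D ^ 3 * X + D ^ 3 * X + 18 * (D ^ 4 * X)"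
      using 1 2 3 4 by (intro order_trans[OF norm_triangle_ineq] add_mono) auto
    also have "\<dots> \<le> 33 * (D ^ 4 * X)"
    proof -
      have "0 \<le> D ^ 4 * X" using D X0 by simp
      then show ?thesis using D34 by linarith
    qed
    also have "\<dots> = 33 * D ^ 4 * X" by simp
    finally show ?thesis .
  qed
  finally show ?thesis by (simp only: X_def a_def P1_def Q1_def Q2_def z_def mult.assoc)
qed

lemma digit_pmf_affine:
  fixes F G :: "nat \<Rightarrow> real"
  assumes "integrable (digit_pmf x) F" "integrable (digit_pmf x) G"
  shows "integrable (digit_pmf x) (\<lambda>k. 1 + \<i> * of_real (t * F k) + of_real (s * G k))"
    "measure_pmf.expectation (digit_pmf x) (\<lambda>k. 1 + \<i> * of_real (t * F k) + of_real (s * G k)) =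
      1 + \<i> * of_real (t * measure_pmf.expectation (digit_pmf x) F) + of_real (s * measure_pmf.expectation (digit_pmf x) G)"
proof -
  have F: "integrable (digit_pmf x) (\<lambda>k. complex_of_real (t * F k))" and G: "integrable (digit_pmf x) (\<lambda>k. complex_of_real (s * G k))"
    using assms by (auto intro!: integrable_of_real)
  have F': "integrable (digit_pmf x) (\<lambda>k. 1 + \<i> * complex_of_real (t * F k))"
    by (rule Bochner_Integration.integrable_add[OF _ integrable_mult_right[OF F]]) simp
  then show "integrable (digit_pmf x) (\<lambda>k. 1 + \<i> * of_real (t * F k) + of_real (s * G k))"
    by (rule Bochner_Integration.integrable_add[OF _ G])
  have "measure_pmf.expectation (digit_pmf x) (\<lambda>k. 1 + \<i> * complex_of_real (t * F k)) =
      1 + \<i> * of_real (t * measure_pmf.expectation (digit_pmf x) F)"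
    using Bochner_Integration.integral_add[OF _ integrable_mult_right[OF F], of "\<lambda>_. 1" \<i>]
    by (simp add: integral_mult_right_zero integral_complex_of_real del: of_real_mult)
  moreover have "measure_pmf.expectation (digit_pmf x) (\<lambda>k. complex_of_real (s * G k)) = of_real (s * measure_pmf.expectation (digit_pmf x) G)"
    by (simp add: integral_complex_of_real del: of_real_mult)
  ultimately show "measure_pmf.expectation (digit_pmf x) (\<lambda>k. 1 + \<i> * of_real (t * F k) + of_real (s * G k)) =
      1 + \<i> * of_real (t * measure_pmf.expectation (digit_pmf x) F) + of_real (s * measure_pmf.expectation (digit_pmf x) G)"
    using Bochner_Integration.integral_add[OF F' G] by simp
qed

context gauss_clt
begin

definition lam :: "real \<Rightarrow> real" where "lam t = sig2 * t\<^sup>2 / 2"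

definition char_eigen :: "real \<Rightarrow> real \<Rightarrow> complex" where
  "char_eigen t x = 1 + \<i> * of_real (t * g x) + of_real (t\<^sup>2 * u x)"

definition char_kernel :: "real \<Rightarrow> nat \<Rightarrow> real \<Rightarrow> complex" where
  "char_kernel t k x = exp (\<i> * of_real (t * digit_psi k x) + of_real (lam t * ln (real k + 1 + x))) * char_eigen t (branch k x)"

text \<open>The expansion is integrated against the digit law. By the two Poisson equations its
  second-order part gives back \<open>char_eigen\<close> exactly, and the cubic remainder stays.
  With \<open>lam t\<close> at most 1/4 the factor \<open>exp (lam * l)\<close> grows no faster than
  a fourth root of the digit, as does the cube of \<open>log_size\<close>; their product is of
  square root size and hence integrable.\<close>

lemma char_kernel_expectation:
  obtains C t0 where "0 < t0" "t0 \<le> 1" "lam t0 \<le> 1/4" "0 \<le> C"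
    "\<And>t x. \<bar>t\<bar> \<le> t0 \<Longrightarrow> x \<in> {0..1} \<Longrightarrow> integrable (digit_pmf x) (\<lambda>k. char_kernel t k x)"
    "\<And>t x. \<bar>t\<bar> \<le> t0 \<Longrightarrow> x \<in> {0..1} \<Longrightarrow>
       cmod (measure_pmf.expectation (digit_pmf x) (\<lambda>k. char_kernel t k x) - char_eigen t x) \<le> C * \<bar>t\<bar> ^ 3"
proof -
  obtain A where A: "log_lip 1 digit_psi A" using log_lip_digit_psi by blast
  define D where "D = 1 + A + L + sig2"
  have nn: "0 \<le> A" "0 \<le> L" "0 \<le> sig2" using log_lip_nonneg[OF A] g_bd[of 0] sig2_pos by auto
  then have D: "1 \<le> D" "A \<le> D" "L \<le> D" "sig2 \<le> D" by (auto simp: D_def)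
  \<comment> \<open>From 4 sig2 \<le> (1 + sig2)^2 it follows that sig2 t0^2 is at most 1/4, which
    is more than enough for \<open>lam t0 \<le> 1/4\<close>.\<close>
  define t0 where "t0 = 1 / (1 + sig2)"
  have t0: "0 < t0" "t0 \<le> 1" using nn by (auto simp: t0_def)
  have lam_le: "lam t \<le> 1/2 * (t0 * (sig2 / (1 + sig2)))" if "\<bar>t\<bar> \<le> t0" for t
  proof -
    have "t\<^sup>2 \<le> t0\<^sup>2" using that by (metis abs_ge_zero power2_abs power_mono)
    then have "lam t \<le> sig2 * t0\<^sup>2 / 2" unfolding lam_def using nn by (intro divide_right_mono mult_left_mono) auto
    also have "\<dots> = 1/2 * (t0 * (sig2 / (1 + sig2)))" by (simp add: t0_def power2_eq_square)
    finally show ?thesis .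
  qed
  have q: "t0 * (sig2 / (1 + sig2)) \<le> 1/2"
  proof -
    have "4 * sig2 \<le> (1 + sig2)\<^sup>2" using zero_le_power2[of "1 - sig2"] by (simp add: power2_eq_square algebra_simps)
    then have "sig2 / (1 + sig2)\<^sup>2 \<le> 1/4" using nn by (simp add: divide_le_eq)
    moreover have "t0 * (sig2 / (1 + sig2)) = sig2 / (1 + sig2)\<^sup>2" by (simp add: t0_def power2_eq_square)
    ultimately show ?thesis by linarith
  qed
  have lam4: "lam t \<le> 1/4" if "\<bar>t\<bar> \<le> t0" for t using order_trans[OF lam_le[OF that] mult_left_mono[OF q, of "1/2"]] by simp
  \<comment> \<open>The kernel truncated after second order; its coefficients of t and t^2 are the
    integrands of the two Poisson equations.\<close>
  define T where "T t k x = 1 + \<i> * of_real (t * (digit_psi k x + g (branch k x)))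
     + of_real (t\<^sup>2 * (- (digit_psi k x)\<^sup>2 / 2 - digit_psi k x * g (branch k x) + sig2 / 2 * ln (real k + 1 + x) + u (branch k x)))" for t k x
  define M where "M = 33 * D ^ 4 * (2 * 17 ^ 4)"
  have diff: "cmod (char_kernel t k x - T t k x) \<le> (M * \<bar>t\<bar> ^ 3) * sqrt (real k + 1 + x)"
    if t: "\<bar>t\<bar> \<le> t0" and x: "x \<in> {0..1}" for t k x
  proof -
    define l where "l = ln (real k + 1 + x)"
    have l: "0 \<le> l" "l \<le> log_size k" "\<bar>digit_psi k x\<bar> \<le> A * log_size k"
      using log_lip_ln A x unfolding log_lip_def l_def by (auto intro!: ln_ge_zero dest: bspec[of _ _ x])
    have "A * log_size k \<le> D * log_size k" using D log_size_ge1[of k] by (intro mult_right_mono) auto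
    then have p: "\<bar>digit_psi k x\<bar> \<le> D * log_size k" using l by simp
    have gu: "\<bar>g (branch k x)\<bar> \<le> D" "\<bar>u (branch k x)\<bar> \<le> D"
      using g_bd[OF branch_mem, of x k] u_bd[OF branch_mem, of x k] x D by auto
    have "cmod (char_kernel t k x - T t k x) \<le> 33 * D ^ 4 * \<bar>t\<bar> ^ 3 * (log_size k ^ 3 * exp (sig2 * t\<^sup>2 / 2 * l))"
      unfolding char_kernel_def T_def lam_def char_eigen_def l_def[symmetric]
      by (rule exp_product_expansion) (use D log_size_ge1[of k] t t0 p l gu nn in auto)
    also have "\<dots> \<le> 33 * D ^ 4 * \<bar>t\<bar> ^ 3 * (2 * 17 ^ 4 * sqrt (real k + 1 + x))"
    proof (intro mult_left_mono)
      have "log_size k ^ 3 \<le> log_size k ^ 4" using log_size_ge1[of k] by (intro power_increasing) auto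
      also have "\<dots> \<le> 17 ^ 4 * (real k + 2) powr (1/4)"
        unfolding log_size_def by (rule log_power_bound) simp
      finally have 1: "log_size k ^ 3 \<le> 17 ^ 4 * (real k + 2) powr (1/4)" .
      have "sig2 * t\<^sup>2 / 2 * l \<le> 1/4 * ln (real k + 2)"
      proof (rule mult_mono)
        show "l \<le> ln (real k + 2)" unfolding l_def using x by (subst ln_le_cancel_iff) auto
      qed (use lam4[OF t] l in \<open>auto simp: lam_def\<close>)
      then have 2: "exp (sig2 * t\<^sup>2 / 2 * l) \<le> (real k + 2) powr (1/4)" by (simp add: powr_def)
      have "log_size k ^ 3 * exp (sig2 * t\<^sup>2 / 2 * l) \<le> (17 ^ 4 * (real k + 2) powr (1/4)) * (real k + 2) powr (1/4)"
        using 1 2 by (intro mult_mono) auto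
      also have "\<dots> = 17 ^ 4 * sqrt (real k + 2)" by (simp add: powr_add[symmetric] powr_half_sqrt)
      also have "\<dots> \<le> 17 ^ 4 * sqrt (4 * (real k + 1 + x))" using x by (intro mult_left_mono real_sqrt_le_mono) auto
      also have "sqrt (4 * (real k + 1 + x)) = 2 * sqrt (real k + 1 + x)" by (simp only: real_sqrt_mult real_sqrt_four)
      finally show "log_size k ^ 3 * exp (sig2 * t\<^sup>2 / 2 * l) \<le> 2 * 17 ^ 4 * sqrt (real k + 1 + x)" by simp
    qed (use D in auto)
    finally show ?thesis by (simp add: M_def mult_ac)
  qed
  have lgb: "log_lip 0 (\<lambda>k x. g (branch k x)) L" "log_lip 0 (\<lambda>k x. u (branch k x)) L"
    using log_lip_branch[of g L] log_lip_branch[of u L] g_lip g_bd u_lip u_bd by blast+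
  have n1: "\<exists>A. sqrt_lip (\<lambda>k x. digit_psi k x + g (branch k x)) A"
    using log_lip_sqrt_lip[OF log_lip_add[OF A log_lip_mono[OF lgb(1)]]] by auto
  have n2: "\<exists>A. sqrt_lip (\<lambda>k x. - (digit_psi k x)\<^sup>2 / 2 - digit_psi k x * g (branch k x) + sig2 / 2 * ln (real k + 1 + x) + u (branch k x)) A"
  proof -
    have 1: "log_lip 2 (\<lambda>k x. (-1/2) * (digit_psi k x * digit_psi k x)) (2 * (\<bar>-1/2\<bar> * (2 * (A * A))))"
      using log_lip_mult[OF log_lip_const log_lip_mult[OF A A], of "-1/2"] by (simp add: numeral_2_eq_2)
    have 2: "log_lip 2 (\<lambda>k x. (-1) * (digit_psi k x * g (branch k x))) (2 * (\<bar>-1\<bar> * (2 * (A * L))))"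
      using log_lip_mult[OF log_lip_const log_lip_mult[OF A lgb(1)], of "-1"] by (rule log_lip_mono) arith
    have 3: "log_lip 2 (\<lambda>k x. (sig2 / 2) * ln (real k + 1 + x)) (2 * (\<bar>sig2 / 2\<bar> * 1))"
      using log_lip_mult[OF log_lip_const log_lip_ln, of "sig2 / 2"] by (rule log_lip_mono) arith
    have 4: "log_lip 2 (\<lambda>k x. u (branch k x)) L" using lgb(2) by (rule log_lip_mono) simp
    have "(\<lambda>k x. - (digit_psi k x)\<^sup>2 / 2 - digit_psi k x * g (branch k x) + sig2 / 2 * ln (real k + 1 + x) + u (branch k x))
      = (\<lambda>k x. (-1/2) * (digit_psi k x * digit_psi k x) + (-1) * (digit_psi k x * g (branch k x)) + (sig2 / 2) * ln (real k + 1 + x) + u (branch k x))"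
      by (auto simp: fun_eq_iff power2_eq_square)
    with log_lip_sqrt_lip[OF log_lip_add[OF log_lip_add[OF log_lip_add[OF 1 2] 3] 4]] show ?thesis by auto
  qed
  have T: "integrable (digit_pmf x) (\<lambda>k. T t k x)" "measure_pmf.expectation (digit_pmf x) (\<lambda>k. T t k x) = char_eigen t x"
    if x: "x \<in> {0..1}" for t x
  proof -
    obtain A1 A2 where "sqrt_lip (\<lambda>k x. digit_psi k x + g (branch k x)) A1"
      "sqrt_lip (\<lambda>k x. - (digit_psi k x)\<^sup>2 / 2 - digit_psi k x * g (branch k x) + sig2 / 2 * ln (real k + 1 + x) + u (branch k x)) A2"
      using n1 n2 by blast
    note i = sqrt_lip_integrable[OF this(1) x x] sqrt_lip_integrable[OF this(2) x x]
    show "integrable (digit_pmf x) (\<lambda>k. T t k x)"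
      unfolding T_def by (rule digit_pmf_affine[OF i])
    show "measure_pmf.expectation (digit_pmf x) (\<lambda>k. T t k x) = char_eigen t x"
      unfolding T_def digit_pmf_affine(2)[OF i] char_eigen_def using g_eq[OF x] u_eq[OF x] by (simp only: branch_mean_def)
  qed
  have kint: "integrable (digit_pmf x) (\<lambda>k. char_kernel t k x)" if t: "\<bar>t\<bar> \<le> t0" and x: "x \<in> {0..1}" for t x
  proof -
    have "integrable (digit_pmf x) (\<lambda>k. char_kernel t k x - T t k x)"
      using x diff[OF t x] by (rule digit_pmf_integrable)
    from Bochner_Integration.integrable_add[OF this T(1)[OF x, of t]] show ?thesis by simp
  qed
  have "cmod (measure_pmf.expectation (digit_pmf x) (\<lambda>k. char_kernel t k x) - char_eigen t x) \<le> (3 * M) * \<bar>t\<bar> ^ 3"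
    if t: "\<bar>t\<bar> \<le> t0" and x: "x \<in> {0..1}" for t x
  proof -
    have "measure_pmf.expectation (digit_pmf x) (\<lambda>k. char_kernel t k x) - char_eigen t x = measure_pmf.expectation (digit_pmf x) (\<lambda>k. char_kernel t k x - T t k x)"
      using kint[OF t x] T[OF x] by simp
    also have "cmod \<dots> \<le> 3 * (M * \<bar>t\<bar> ^ 3)"
      using x diff[OF t x] by (rule digit_pmf_expectation_bound)
    finally show ?thesis by simp
  qed
  moreover have "0 \<le> 3 * M" using D by (simp add: M_def)
  moreover have "lam t0 \<le> 1/4" using lam4[of t0] t0 by simp
  ultimately show ?thesis using t0 kint by (intro that[of t0 "3 * M"]) auto
qed

end

subsection \<open>Stopped digit words\<close>

text \<open>Digit words are stored with the latest digit first, each digit decremented by one.\<close>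
primrec cf_dens :: "nat list \<Rightarrow> nat \<times> nat" where
  "cf_dens [] = (1, 0)"
| "cf_dens (k # w) = (Suc k * fst (cf_dens w) + snd (cf_dens w), fst (cf_dens w))"

abbreviation cf_den :: "nat list \<Rightarrow> nat" where "cf_den w \<equiv> fst (cf_dens w)"
abbreviation cf_den_prev :: "nat list \<Rightarrow> nat" where "cf_den_prev w \<equiv> snd (cf_dens w)"

definition cf_theta :: "nat list \<Rightarrow> real" where
  "cf_theta w = real (cf_den_prev w) / real (cf_den w)"

text \<open>The length of the interval of numbers whose expansion starts with the digits of w: its
  endpoints are p / q and (p + p') / (q + q'), where p q' - p' q is 1 or - 1.\<close>

definition cyl_length :: "nat list \<Rightarrow> real" where
  "cyl_length w = 1 / (real (cf_den w) * (real (cf_den w) + real (cf_den_prev w)))"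

lemma cf_den_pos: "1 \<le> cf_den w"
  by (induction w) auto

lemma cf_den_prev_le: "cf_den_prev w \<le> cf_den w"
  by (cases w) (auto simp: trans_le_add1)

lemma cf_theta_mem: "cf_theta w \<in> {0..1}"
  using cf_den_pos[of w] cf_den_prev_le[of w] by (auto simp: cf_theta_def divide_le_eq_1)

lemma cf_theta_Cons: "cf_theta (k # w) = branch k (cf_theta w)"
proof -
  have "real (cf_den w) > 0" using cf_den_pos[of w] by linarith
  then show ?thesis by (simp add: cf_theta_def branch_def field_simps)
qed

lemma cf_den_Cons: "real (cf_den (k # w)) = real (cf_den w) * (real k + 1 + cf_theta w)"
proof -
  have "real (cf_den w) > 0" using cf_den_pos[of w] by linarith
  then show ?thesis by (simp add: cf_theta_def field_simps)
qed

lemma cyl_length_pos: "0 < cyl_length w"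
  using cf_den_pos[of w] by (simp add: cyl_length_def add_pos_nonneg)

text \<open>The link with Lebesgue measure: the relative length of a subcylinder is the weight at
  \<open>cf_theta w\<close>. Drawing digits by \<open>digit_pmf\<close> at the current quotient
  therefore produces the digits of a Lebesgue random number.\<close>

lemma cyl_length_Cons: "cyl_length (k # w) = digit_wgt k (cf_theta w) * cyl_length w"
proof -
  define q r where "q = real (cf_den w)" and "r = real (cf_den_prev w)"
  have q: "0 < q" "0 \<le> r" using cf_den_pos[of w] by (auto simp: q_def r_def)
  have t: "cf_theta w = r / q" by (simp add: cf_theta_def q_def r_def)
  have 1: "real (cf_den (k # w)) = (real k + 1) * q + r" "real (cf_den_prev (k # w)) = q"
    by (simp_all add: q_def r_def algebra_simps)
  have "digit_wgt k (cf_theta w) = (q + r) * q / (((real k + 1) * q + r) * ((real k + 2) * q + r))"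
    unfolding t digit_wgt_def using q by (simp add: divide_simps)
  then have "digit_wgt k (cf_theta w) * cyl_length w = 1 / (((real k + 1) * q + r) * ((real k + 2) * q + r))"
    using q by (simp add: cyl_length_def q_def[symmetric] r_def[symmetric])
  moreover have "cyl_length (k # w) = 1 / (((real k + 1) * q + r) * ((real k + 2) * q + r))"
    unfolding cyl_length_def 1 by (simp add: algebra_simps)
  ultimately show ?thesis by simp
qed

lemma cf_den_mono_Cons: "cf_den w \<le> cf_den (k # w)"
  by simp

lemma cf_den_suffix_mono: "cf_den w \<le> cf_den (v @ w)"
  by (induction v) auto

text \<open>Any two further digits at least double the denominator.\<close>

lemma cf_den_growth: "2 ^ (length w div 2) \<le> cf_den w"
proof (induction w rule: induct_list012)
  case (3 k j w)
  have "2 ^ (length (k # j # w) div 2) = 2 * 2 ^ (length w div 2)" by simp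
  also have "\<dots> \<le> 2 * cf_den w" using 3 by simp
  also have "\<dots> \<le> cf_den (k # j # w)" by simp
  finally show ?case .
qed auto

text \<open>A Lebesgue random word, extended digit by digit until its denominator exceeds N. The
  fuel m only serves to make the recursion finite; \<open>chain_steps\<close> will be enough of
  it.\<close>

fun chain :: "nat \<Rightarrow> nat \<Rightarrow> nat list \<Rightarrow> nat list pmf" where
  "chain N 0 w = return_pmf w"
| "chain N (Suc m) w = (if N < cf_den w then return_pmf w else bind_pmf (digit_pmf (cf_theta w)) (\<lambda>k. chain N m (k # w)))"

lemma expectation_bind_pmf:
  fixes f :: "'a \<Rightarrow> real"
  assumes "\<And>x. \<bar>f x\<bar> \<le> M"
  shows "measure_pmf.expectation (bind_pmf p K) f = measure_pmf.expectation p (\<lambda>x. measure_pmf.expectation (K x) f)"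
  unfolding measure_pmf_bind
  by (rule integral_bind[where K="count_space UNIV" and B'=1 and B=M])
     (use assms in \<open>auto simp: measure_pmf.emeasure_space_1 space_subprob_algebra
        intro!: measure_pmf.finite_measure prob_space_imp_subprob_space measure_pmf.prob_space_axioms\<close>)

lemma complex_expectation_bind_pmf:
  fixes f :: "'a \<Rightarrow> complex"
  assumes "\<And>x. cmod (f x) \<le> M"
  shows "measure_pmf.expectation (bind_pmf p K) f = measure_pmf.expectation p (\<lambda>x. measure_pmf.expectation (K x) f)"
proof -
  have i: "integrable (measure_pmf p') f" for p' :: "'a pmf"
    using assms by (intro measure_pmf.integrable_const_bound[where B=M]) auto
  have n: "cmod (measure_pmf.expectation (K x) f) \<le> M" for x
  proof -
    have "cmod (measure_pmf.expectation (K x) f) \<le> measure_pmf.expectation (K x) (\<lambda>y. cmod (f y))" by simp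
    also have "\<dots> \<le> measure_pmf.expectation (K x) (\<lambda>y. M)"
      using assms i by (intro integral_mono) auto
    finally show ?thesis by simp
  qed
  then have i': "integrable (measure_pmf p) (\<lambda>x. measure_pmf.expectation (K x) f)"
    by (intro measure_pmf.integrable_const_bound[where B=M]) auto
  have b: "\<bar>Re (f x)\<bar> \<le> M" "\<bar>Im (f x)\<bar> \<le> M" for x
    using assms[of x] abs_Re_le_cmod[of "f x"] abs_Im_le_cmod[of "f x"] by auto
  show ?thesis
  proof (rule complex_eqI)
    show "Re (measure_pmf.expectation (bind_pmf p K) f) = Re (measure_pmf.expectation p (\<lambda>x. measure_pmf.expectation (K x) f))"
      unfolding integral_Re[OF i, symmetric] integral_Re[OF i', symmetric] by (rule expectation_bind_pmf[OF b(1)])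
    show "Im (measure_pmf.expectation (bind_pmf p K) f) = Im (measure_pmf.expectation p (\<lambda>x. measure_pmf.expectation (K x) f))"
      unfolding integral_Im[OF i, symmetric] integral_Im[OF i', symmetric] by (rule expectation_bind_pmf[OF b(2)])
  qed
qed

lemma chain_support:
  assumes "w' \<in> set_pmf (chain N m w)"
  shows "\<exists>v. w' = v @ w \<and> (v \<noteq> [] \<longrightarrow> cf_den (tl w') \<le> N) \<and> (N < cf_den w' \<or> length v = m)"
  using assms
proof (induction m arbitrary: w)
  case (Suc m)
  show ?case
  proof (cases "N < cf_den w")
    case True
    then show ?thesis using Suc.prems by simp
  next
    case False
    then obtain k where "w' \<in> set_pmf (chain N m (k # w))" using Suc.prems by (auto simp del: cf_dens.simps)
    from Suc.IH[OF this] obtain v where v: "w' = v @ k # w" "v \<noteq> [] \<longrightarrow> cf_den (tl w') \<le> N" "N < cf_den w' \<or> length v = m"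
      by blast
    have "cf_den (tl w') \<le> N" using v(1,2) False by (cases v) auto
    then show ?thesis using v by (intro exI[of _ "v @ [k]"]) auto
  qed
qed auto

text \<open>For words that the chain can reach this is an equality, the weights along the path
  telescoping into a quotient of lengths. The inequality points in the direction in which chain
  probabilities bound lattice counts from below.\<close>

lemma chain_pmf_le: "pmf (chain N m w) w' \<le> cyl_length w' / cyl_length w"
proof (induction m arbitrary: w)
  case 0
  show ?case using cyl_length_pos[of w] cyl_length_pos[of w'] by (cases "w = w'") (auto simp: pmf_return)
next
  case (Suc m)
  show ?case
  proof (cases "N < cf_den w")
    case True
    then show ?thesis using cyl_length_pos[of w] cyl_length_pos[of w'] by (cases "w = w'") (auto simp: pmf_return)
  next
    case False
    show ?thesis
    proof (cases "\<exists>j v. w' = v @ j # w")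
      case True
      then obtain j v where w': "w' = v @ j # w" by blast
      have "pmf (chain N (Suc m) w) w' = measure_pmf.expectation (digit_pmf (cf_theta w)) (\<lambda>k. pmf (chain N m (k # w)) w')"
        using False by (simp add: pmf_bind)
      also have "\<dots> \<le> measure_pmf.expectation (digit_pmf (cf_theta w)) (\<lambda>k. cyl_length w' / cyl_length (j # w) * indicator {j} k)"
      proof (rule integral_mono)
        show "integrable (digit_pmf (cf_theta w)) (\<lambda>k. pmf (chain N m (k # w)) w')"
          by (rule digit_pmf_integrable_bounded[where B=1]) (simp add: pmf_le_1)
        show "integrable (digit_pmf (cf_theta w)) (\<lambda>k. cyl_length w' / cyl_length (j # w) * indicator {j} k)"
          by (intro integrable_mult_right measure_pmf.integrable_const_bound[where B=1]) auto
        show "pmf (chain N m (k # w)) w' \<le> cyl_length w' / cyl_length (j # w) * indicator {j} k" for k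
        proof (cases "k = j")
          case False
          have "w' \<notin> set_pmf (chain N m (k # w))"
          proof
            assume "w' \<in> set_pmf (chain N m (k # w))"
            from chain_support[OF this] obtain v' where "w' = v' @ k # w" by blast
            with w' have "v' @ [k] = v @ [j]" by simp
            with False show False by simp
          qed
          then show ?thesis using False by (simp add: set_pmf_iff)
        qed (use Suc.IH in auto)
      qed
      also have "\<dots> = cyl_length w' / cyl_length (j # w) * digit_wgt j (cf_theta w)"
        using cf_theta_mem[of w] by (simp add: measure_pmf_single pmf_digit_pmf)
      also have "\<dots> = cyl_length w' / cyl_length w"
        using cyl_length_pos[of w] digit_wgt_pos[of "cf_theta w" j] cf_theta_mem[of w] by (simp add: cyl_length_Cons)
      finally show ?thesis .
    next
      case nex: False
      have "w' \<notin> set_pmf (chain N (Suc m) w)"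
      proof
        assume "w' \<in> set_pmf (chain N (Suc m) w)"
        then obtain k where "w' \<in> set_pmf (chain N m (k # w))" using False by (auto simp del: cf_dens.simps)
        from chain_support[OF this] nex show False by blast
      qed
      then show ?thesis using cyl_length_pos[of w] cyl_length_pos[of w'] by (simp add: set_pmf_iff)
    qed
  qed
qed

section \<open>Crossing the level: probability and overshoot\<close>

lemma cross_eq:
  fixes R :: real
  assumes "0 \<le> R"
  obtains j where "{k. R < real (cf_den (k # w))} = {j..}" "R < real (cf_den w) * (real j + 1 + cf_theta w)"
    "j \<noteq> 0 \<Longrightarrow> real (cf_den w) * (real j + cf_theta w) \<le> R"
proof -
  have q: "0 < real (cf_den w)" using cf_den_pos[of w] by linarith
  let ?P = "\<lambda>k. R < real (cf_den (k # w))"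
  define j where "j = (LEAST k. ?P k)"
  have "?P (nat \<lceil>R\<rceil>)"
  proof -
    have "R < real (nat \<lceil>R\<rceil>) + 1 + cf_theta w" using cf_theta_mem[of w] real_nat_ceiling_ge[of R] by simp
    also have "\<dots> \<le> real (cf_den w) * (real (nat \<lceil>R\<rceil>) + 1 + cf_theta w)"
      using cf_den_pos[of w] cf_theta_mem[of w] mult_right_mono[of 1 "real (cf_den w)" "real (nat \<lceil>R\<rceil>) + 1 + cf_theta w"] by simp
    finally show ?thesis by (simp only: cf_den_Cons)
  qed
  then have Pj: "?P j" unfolding j_def by (rule LeastI)
  have mono: "real (cf_den (k # w)) \<le> real (cf_den (l # w))" if "k \<le> l" for k l
    unfolding cf_den_Cons using that q by (intro mult_left_mono) auto
  show ?thesis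
  proof (rule that[of j])
    show "{k. R < real (cf_den (k # w))} = {j..}"
    proof (intro set_eqI iffI)
      fix k assume "k \<in> {k. R < real (cf_den (k # w))}"
      then show "k \<in> {j..}" unfolding j_def by (auto intro: Least_le)
    next
      fix k assume "k \<in> {j..}"
      then show "k \<in> {k. R < real (cf_den (k # w))}" using order_less_le_trans[OF Pj mono[of j k]] by simp
    qed
    show "R < real (cf_den w) * (real j + 1 + cf_theta w)" using Pj by (simp only: cf_den_Cons)
    assume "j \<noteq> 0"
    then have "j - 1 < (LEAST k. ?P k)" unfolding j_def[symmetric] by simp
    then have "\<not> ?P (j - 1)" by (rule not_less_Least)
    then have "real (cf_den w) * (real (j - 1) + 1 + cf_theta w) \<le> R" by (simp only: cf_den_Cons not_less)
    then show "real (cf_den w) * (real j + cf_theta w) \<le> R" using \<open>j \<noteq> 0\<close> by (simp add: of_nat_diff)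
  qed
qed

definition cross_prob :: "nat \<Rightarrow> nat list \<Rightarrow> real" where
  "cross_prob N w = measure_pmf.prob (digit_pmf (cf_theta w)) {k. N < cf_den (k # w)}"

text \<open>At the least crossing index j the denominator is at most 2 N: for j = 0 because 1 +
  \<open>cf_theta w\<close> is at most 2, otherwise because passing from index j - 1 to j at most
  doubles it. Hence the crossing probability is comparable with \<open>cf_den w / N\<close>.\<close>

lemma cross_data:
  assumes "cf_den w \<le> N"
  obtains j where "{k. N < cf_den (k # w)} = {j..}" "cross_prob N w = (1 + cf_theta w) / (real j + 1 + cf_theta w)"
    "real N < real (cf_den w) * (real j + 1 + cf_theta w)" "real (cf_den w) * (real j + 1 + cf_theta w) \<le> 2 * real N"
proof -
  obtain j where j: "{k. real N < real (cf_den (k # w))} = {j..}" "real N < real (cf_den w) * (real j + 1 + cf_theta w)"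
    "j \<noteq> 0 \<Longrightarrow> real (cf_den w) * (real j + cf_theta w) \<le> real N" using cross_eq[of "real N" w] by auto
  have q: "0 < real (cf_den w)" "real (cf_den w) \<le> real N" using cf_den_pos[of w] assms by auto
  have "real (cf_den w) * (real j + 1 + cf_theta w) \<le> 2 * real N"
  proof (cases "j = 0")
    case True
    have "real (cf_den w) * (1 + cf_theta w) \<le> real N * 2" using q cf_theta_mem[of w] by (intro mult_mono) auto
    then show ?thesis using True by simp
  next
    case False
    have "real (cf_den w) * (real j + 1 + cf_theta w) \<le> real (cf_den w) * (2 * (real j + cf_theta w))"
      using False q cf_theta_mem[of w] by (intro mult_left_mono) auto
    also have "\<dots> = 2 * (real (cf_den w) * (real j + cf_theta w))" by simp
    also have "\<dots> \<le> 2 * real N" using j(3)[OF False] by (rule mult_left_mono) simp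
    finally show ?thesis .
  qed
  moreover have e: "{k. N < cf_den (k # w)} = {j..}" using j(1) by (simp only: of_nat_less_iff)
  moreover have "cross_prob N w = (1 + cf_theta w) / (real j + 1 + cf_theta w)"
    unfolding cross_prob_def e using digit_pmf_prob_ge[of "cf_theta w" j] cf_theta_mem[of w] by (simp add: digit_tail_def)
  ultimately show ?thesis using j(2) that by blast
qed

text \<open>The bound is a multiple of the crossing probability and not just a constant. As a path
  crosses only once, errors of this kind stay bounded when summed along the chain.\<close>

lemma cross_sqrt:
  assumes w: "cf_den w \<le> N"
  shows "measure_pmf.expectation (digit_pmf (cf_theta w)) (\<lambda>k. sqrt (real (cf_den (k # w)) / real N) * indicator {k. N < cf_den (k # w)} k)
    \<le> 4 * cross_prob N w"
proof -
  obtain j where j: "{k. N < cf_den (k # w)} = {j..}" "cross_prob N w = (1 + cf_theta w) / (real j + 1 + cf_theta w)"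
    "real N < real (cf_den w) * (real j + 1 + cf_theta w)" "real (cf_den w) * (real j + 1 + cf_theta w) \<le> 2 * real N"
    using cross_data[OF w] .
  define x where "x = cf_theta w"
  have x: "x \<in> {0..1}" unfolding x_def by (rule cf_theta_mem)
  define s where "s = sqrt (real (cf_den w) / real N)"
  have q: "0 < real (cf_den w)" "real (cf_den w) \<le> real N" using cf_den_pos[of w] w by auto
  have s0: "0 \<le> s" by (simp add: s_def)
  have "sqrt (real (cf_den (k # w)) / real N) = s * sqrt (real k + 1 + x)" for k
    unfolding cf_den_Cons s_def x_def by (simp add: real_sqrt_mult[symmetric] del: real_sqrt_mult)
  then have "measure_pmf.expectation (digit_pmf (cf_theta w)) (\<lambda>k. sqrt (real (cf_den (k # w)) / real N) * indicator {k. N < cf_den (k # w)} k)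
     = s * measure_pmf.expectation (digit_pmf x) (\<lambda>k. sqrt (real k + 1 + x) * indicator {j..} k)"
    unfolding j(1) x_def[symmetric] by (simp add: mult.assoc del: cf_dens.simps)
  also have "measure_pmf.expectation (digit_pmf x) (\<lambda>k. sqrt (real k + 1 + x) * indicator {j..} k) \<le> 2 * (1 + x) / sqrt (real j + 1 + x)"
  proof (subst integral_eq_nn_integral)
    have "(\<integral>\<^sup>+k. ennreal (sqrt (real k + 1 + x) * indicator {j..} k) \<partial>digit_pmf x)
      = (\<integral>\<^sup>+k. ennreal (sqrt (real k + 1 + x)) * indicator {j..} k \<partial>digit_pmf x)"
      by (intro nn_integral_cong) (simp split: split_indicator)
    also have "\<dots> \<le> ennreal (2 * (1 + x) / sqrt (real j + 1 + x))"
      using x by (intro nn_integral_digit_pmf_sqrt_tail) auto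
    finally show "enn2real (\<integral>\<^sup>+k. ennreal (sqrt (real k + 1 + x) * indicator {j..} k) \<partial>digit_pmf x) \<le> 2 * (1 + x) / sqrt (real j + 1 + x)"
      using x by (intro enn2real_leI) auto
  qed (use x in auto)
  then have "s * measure_pmf.expectation (digit_pmf x) (\<lambda>k. sqrt (real k + 1 + x) * indicator {j..} k) \<le> s * (2 * (1 + x) / sqrt (real j + 1 + x))"
    using s0 by (rule mult_left_mono)
  also have "\<dots> = 2 * cross_prob N w * (s * sqrt (real j + 1 + x))"
    using x unfolding j(2) x_def[symmetric] by (simp add: real_div_sqrt field_simps)
  also have "\<dots> \<le> 2 * cross_prob N w * 2"
  proof (rule mult_left_mono)
    have "s * sqrt (real j + 1 + x) = sqrt (real (cf_den w) * (real j + 1 + x) / real N)"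
      by (simp add: s_def real_sqrt_mult[symmetric] del: real_sqrt_mult)
    also have "\<dots> \<le> sqrt 4"
      using j(4) q unfolding x_def[symmetric] by (intro real_sqrt_le_mono) (simp add: divide_le_eq)
    finally show "s * sqrt (real j + 1 + x) \<le> 2" by simp
  qed (simp add: cross_prob_def)
  finally show ?thesis by simp
qed

text \<open>Digit tails are inversely proportional to the threshold, so raising the level by the
  factor K divides the tail by K, up to the factor 2 from \<open>cross_data\<close>.\<close>

lemma cross_overshoot:
  assumes w: "cf_den w \<le> N" and K: "1 \<le> K"
  shows "measure_pmf.prob (digit_pmf (cf_theta w)) {k. real K * real N < real (cf_den (k # w))} \<le> 2 / real K * cross_prob N w"
proof -
  obtain j where j: "cross_prob N w = (1 + cf_theta w) / (real j + 1 + cf_theta w)"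
    "real (cf_den w) * (real j + 1 + cf_theta w) \<le> 2 * real N"
    using cross_data[OF w] by metis
  obtain i where i: "{k. real K * real N < real (cf_den (k # w))} = {i..}" "real K * real N < real (cf_den w) * (real i + 1 + cf_theta w)"
    using cross_eq[of "real K * real N" w] by auto
  have q: "0 < real (cf_den w)" "0 < real N" "0 < real K" using cf_den_pos[of w] w K by auto
  have t: "0 \<le> cf_theta w" using cf_theta_mem[of w] by simp
  have "real (cf_den w) * ((real j + 1 + cf_theta w) * real K) \<le> 2 * (real N * real K)"
    using mult_right_mono[OF j(2), of "real K"] q by (simp add: mult_ac)
  also have "\<dots> \<le> 2 * (real (cf_den w) * (real i + 1 + cf_theta w))" using i(2) by (simp only: mult.commute[of "real N"])
  also have "\<dots> = real (cf_den w) * (2 * (real i + 1 + cf_theta w))" by simp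
  finally have "(real j + 1 + cf_theta w) * real K \<le> 2 * (real i + 1 + cf_theta w)"
    using q by simp
  then have "(1 + cf_theta w) * ((real j + 1 + cf_theta w) * real K) \<le> (1 + cf_theta w) * (2 * (real i + 1 + cf_theta w))"
    using t by (intro mult_left_mono) auto
  moreover have "0 < (real j + 1 + cf_theta w) * real K" using t q by simp
  ultimately have "1 + cf_theta w \<le> (1 + cf_theta w) * (2 * (real i + 1 + cf_theta w)) / ((real j + 1 + cf_theta w) * real K)"
    by (simp only: pos_le_divide_eq)
  also have "\<dots> = 2 / real K * ((1 + cf_theta w) / (real j + 1 + cf_theta w)) * (real i + 1 + cf_theta w)"
    by (simp only: times_divide_eq_right times_divide_eq_left divide_divide_eq_left mult_ac)
  finally have "(1 + cf_theta w) / (real i + 1 + cf_theta w) \<le> 2 / real K * ((1 + cf_theta w) / (real j + 1 + cf_theta w))"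
    using t by (subst pos_divide_le_eq) auto
  then show ?thesis unfolding i(1) j(1) using digit_pmf_prob_ge[OF t, of i] by (simp add: digit_tail_def)
qed

text \<open>The value 2 / K is a budget that vanishes once the word has crossed. One step therefore
  releases 2 / K times the crossing probability, which pays exactly for jumping beyond K N in that
  step.\<close>

lemma chain_overshoot:
  assumes K: "1 \<le> K" and w: "real (cf_den w) \<le> real K * real N"
  shows "measure_pmf.prob (chain N m w) {w'. real K * real N < real (cf_den w')} \<le> (if cf_den w \<le> N then 2 / real K else 0)"
  using w
proof (induction m arbitrary: w)
  case 0
  then show ?case by (simp add: measure_return)
next
  case (Suc m)
  let ?A = "{w'. real K * real N < real (cf_den w')}"
  have ind: "integrable (digit_pmf (cf_theta w)) (indicat_real X)" for X
    by (rule digit_pmf_integrable_bounded[where B=1]) simp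
  show ?case
  proof (cases "N < cf_den w")
    case True
    then show ?thesis using Suc.prems by (simp add: measure_return)
  next
    case False
    have "measure_pmf.prob (chain N (Suc m) w) ?A = measure_pmf.expectation (digit_pmf (cf_theta w)) (\<lambda>k. measure_pmf.prob (chain N m (k # w)) ?A)"
      using False expectation_bind_pmf[of "indicat_real ?A" 1 "digit_pmf (cf_theta w)" "\<lambda>k. chain N m (k # w)"]
      by (simp add: indicator_def)
    also have "\<dots> \<le> measure_pmf.expectation (digit_pmf (cf_theta w))
       (\<lambda>k. indicator {k. real K * real N < real (cf_den (k # w))} k + (2 / real K - 2 / real K * indicator {k. N < cf_den (k # w)} k))"
    proof (rule integral_mono)
      fix k
      show "measure_pmf.prob (chain N m (k # w)) ?A
        \<le> indicator {k. real K * real N < real (cf_den (k # w))} k + (2 / real K - 2 / real K * indicator {k. N < cf_den (k # w)} k)"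
      proof (cases "real K * real N < real (cf_den (k # w))")
        case True
        have "real N \<le> real K * real N" using K by (simp add: mult_le_cancel_right1)
        then have "N < cf_den (k # w)" using True by linarith
        then show ?thesis using True by (simp del: cf_dens.simps)
      next
        case False
        then show ?thesis using Suc.IH[of "k # w"] by (simp del: cf_dens.simps split: if_splits)
      qed
    next
      show "integrable (digit_pmf (cf_theta w)) (\<lambda>k. indicator {k. real K * real N < real (cf_den (k # w))} k + (2 / real K - 2 / real K * indicat_real {k. N < cf_den (k # w)} k))"
        by (intro Bochner_Integration.integrable_add Bochner_Integration.integrable_diff integrable_mult_right ind measure_pmf.integrable_const)
      show "integrable (digit_pmf (cf_theta w)) (\<lambda>k. measure_pmf.prob (chain N m (k # w)) ?A)"
        by (rule digit_pmf_integrable_bounded[where B=1]) simp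
    qed
    also have "\<dots> = measure_pmf.prob (digit_pmf (cf_theta w)) {k. real K * real N < real (cf_den (k # w))} + (2 / real K - 2 / real K * cross_prob N w)"
      unfolding cross_prob_def
      using Bochner_Integration.integral_add[OF ind Bochner_Integration.integrable_diff[OF measure_pmf.integrable_const[of "digit_pmf (cf_theta w)" "2 / real K"] integrable_mult_right[OF ind]],
          of "{k. real K * real N < real (cf_den (k # w))}" "2 / real K" "{k. N < cf_den (k # w)}"] ind[of "{k. N < cf_den (k # w)}"]
      by (simp del: cf_dens.simps)
    also have "\<dots> \<le> 2 / real K" using cross_overshoot[of w N K] False K by simp
    finally show ?thesis using False by simp
  qed
qed

subsection \<open>Central limit theorem for stopped words\<close>

text \<open>Words of this length have denominator at least 2 raised to the power \<lceil>log 2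
  N\<rceil> + 1, hence above N.\<close>

definition chain_steps :: "nat \<Rightarrow> nat" where
  "chain_steps N = 2 * (nat \<lceil>log 2 (real N)\<rceil> + 1)"

lemma chain_steps_stop:
  assumes "w \<in> set_pmf (chain N (chain_steps N) [])"
  shows "N < cf_den w"
proof (rule ccontr)
  assume n: "\<not> N < cf_den w"
  with chain_support[OF assms] have "length w = chain_steps N" by auto
  then have "2 ^ (nat \<lceil>log 2 (real N)\<rceil> + 1) \<le> cf_den w"
    using cf_den_growth[of w] by (simp add: chain_steps_def)
  then have le: "2 ^ (nat \<lceil>log 2 (real N)\<rceil> + 1) \<le> N" using n by simp
  then have N: "0 < N" by (metis not_gr_zero not_le zero_less_numeral zero_less_power)
  have "real N = 2 powr (log 2 (real N))" using N by simp
  also have "\<dots> \<le> 2 powr (real (nat \<lceil>log 2 (real N)\<rceil>))"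
    by (intro powr_mono real_nat_ceiling_ge) simp
  also have "\<dots> = real (2 ^ (nat \<lceil>log 2 (real N)\<rceil>))" by (simp add: powr_realpow)
  finally have "N \<le> 2 ^ (nat \<lceil>log 2 (real N)\<rceil>)" by (simp only: of_nat_le_iff)
  moreover have "(2::nat) ^ (nat \<lceil>log 2 (real N)\<rceil>) < 2 ^ (nat \<lceil>log 2 (real N)\<rceil> + 1)" by simp
  ultimately show False using le by linarith
qed

lemma chain_steps_le: "1 \<le> N \<Longrightarrow> real (chain_steps N) \<le> 2 * (ln (real N) / ln 2 + 2)"
proof -
  assume N: "1 \<le> N"
  then have "0 \<le> log 2 (real N)" by simp
  then have "real (nat \<lceil>log 2 (real N)\<rceil>) \<le> log 2 (real N) + 1" by linarith
  then show ?thesis by (simp add: chain_steps_def log_def)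
qed

context gauss_clt
begin

definition centered_cost :: "nat list \<Rightarrow> real" where
  "centered_cost w = (\<Sum>k\<leftarrow>w. c (Suc k)) - mu * ln (real (cf_den w))"

text \<open>The near-martingale, with the power of the denominator normalised to be 1 at level
  N.\<close>

definition Psi' :: "nat \<Rightarrow> real \<Rightarrow> nat list \<Rightarrow> complex" where
  "Psi' N t w = cis (t * centered_cost w) * of_real (exp (lam t * ln (real (cf_den w) / real N))) * char_eigen t (cf_theta w)"

text \<open>Beyond the level both correction factors are dropped, so that the expectation over
  stopped words is exactly a characteristic function. The price is a jump at the crossing, estimated
  in \<open>Psi_cross_diff\<close>.\<close>

definition Psi :: "nat \<Rightarrow> real \<Rightarrow> nat list \<Rightarrow> complex" where
  "Psi N t w = (if N < cf_den w then cis (t * centered_cost w) else Psi' N t w)"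

lemma centered_cost_Cons: "centered_cost (k # w) = centered_cost w + digit_psi k (cf_theta w)"
proof -
  have q: "0 < real (cf_den w)" using cf_den_pos[of w] by linarith
  have "ln (real (cf_den (k # w))) = ln (real (cf_den w)) + ln (real k + 1 + cf_theta w)"
    unfolding cf_den_Cons using q cf_theta_mem[of w] by (subst ln_mult) auto
  then show ?thesis by (simp add: centered_cost_def digit_psi_def algebra_simps del: cf_dens.simps)
qed

lemma Psi'_Cons:
  assumes "0 < N"
  shows "Psi' N t (k # w) = (cis (t * centered_cost w) * of_real (exp (lam t * ln (real (cf_den w) / real N)))) * char_kernel t k (cf_theta w)"
proof -
  have q: "0 < real (cf_den w)" using cf_den_pos[of w] by linarith
  have "ln (real (cf_den (k # w)) / real N) = ln (real (cf_den w) / real N) + ln (real k + 1 + cf_theta w)"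
    unfolding cf_den_Cons using q cf_theta_mem[of w] assms by (simp add: ln_mult ln_div)
  then show ?thesis
    unfolding Psi'_def char_kernel_def centered_cost_Cons cf_theta_Cons
    by (simp add: cis_conv_exp exp_add algebra_simps flip: exp_of_real)
qed

lemma lam_nonneg: "0 \<le> lam t"
  using sig2_pos by (simp add: lam_def)

lemma L_nonneg: "0 \<le> L"
  using g_bd[of 0] by simp

lemma char_eigen_near_1:
  assumes "\<bar>t\<bar> \<le> 1" "x \<in> {0..1}"
  shows "cmod (1 - char_eigen t x) \<le> 2 * L * \<bar>t\<bar>"
proof -
  have "t\<^sup>2 \<le> \<bar>t\<bar>" using assms(1) mult_left_le[of "\<bar>t\<bar>" "\<bar>t\<bar>"] by (simp add: power2_eq_square flip: abs_mult)
  have "cmod (1 - char_eigen t x) = cmod (\<i> * of_real (t * g x) + of_real (t\<^sup>2 * u x))"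
    unfolding char_eigen_def by (metis (no_types, lifting) add.assoc add_diff_cancel_left' norm_minus_commute)
  also have "\<dots> \<le> \<bar>t * g x\<bar> + \<bar>t\<^sup>2 * u x\<bar>"
    by (rule order_trans[OF norm_triangle_ineq]) (simp add: norm_mult del: of_real_mult)
  also have "\<dots> \<le> \<bar>t\<bar> * L + \<bar>t\<bar> * L"
    unfolding abs_mult using g_bd[OF assms(2)] u_bd[OF assms(2)] \<open>t\<^sup>2 \<le> \<bar>t\<bar>\<close> L_nonneg
    by (intro add_mono mult_mono) auto
  finally show ?thesis by simp
qed

lemma Psi_bound:
  assumes "\<bar>t\<bar> \<le> 1"
  shows "cmod (Psi N t w) \<le> 1 + 2 * L"
proof (cases "N < cf_den w")
  case True
  then show ?thesis using L_nonneg by (simp add: Psi_def)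
next
  case False
  have q: "0 < real (cf_den w)" "real (cf_den w) \<le> real N" using cf_den_pos[of w] False by auto
  have "2 * L * \<bar>t\<bar> \<le> 2 * L" using assms L_nonneg by (simp add: mult_left_le)
  then have "cmod (1 - char_eigen t (cf_theta w)) \<le> 2 * L"
    using char_eigen_near_1[OF assms cf_theta_mem[of w]] by simp
  then have h: "cmod (char_eigen t (cf_theta w)) \<le> 1 + 2 * L"
    using norm_triangle_ineq2[of "char_eigen t (cf_theta w)" 1] by (simp add: norm_minus_commute)
  have "ln (real (cf_den w) / real N) \<le> 0" using q by (simp add: divide_le_eq_1)
  then have "exp (lam t * ln (real (cf_den w) / real N)) \<le> 1"
    using lam_nonneg[of t] by (simp add: mult_nonneg_nonpos)
  then have "exp (lam t * ln (real (cf_den w) / real N)) * cmod (char_eigen t (cf_theta w)) \<le> 1 * (1 + 2 * L)"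
    using h by (intro mult_mono) auto
  then show ?thesis using False by (simp add: Psi_def Psi'_def norm_mult)
qed

text \<open>Both dropped factors differ from their trivial values by O(|t|). With y the logarithm of
  the overshoot ratio, \<open>exp (lam t * y)\<close> is at most exp (y / 4), and a second exp (y /
  4) absorbs the factor y; together they make the square root of the ratio, whose mean is bounded by
  \<open>cross_sqrt\<close>.\<close>

lemma Psi_cross_diff:
  assumes t: "\<bar>t\<bar> \<le> 1" "lam t \<le> 1/4" and w: "N < cf_den w" and N: "0 < N"
  shows "cmod (Psi N t w - Psi' N t w) \<le> (2 * sig2 + 2 * L) * \<bar>t\<bar> * sqrt (real (cf_den w) / real N)"
proof -
  define r where "r = real (cf_den w) / real N"
  define y where "y = ln r"
  have r: "1 < r" using w N by (simp add: r_def)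
  have y: "0 < y" using r by (simp add: y_def)
  have sq: "sqrt r = exp (y / 2)"
    using r by (simp add: y_def powr_half_sqrt[symmetric] powr_def)
  have e4: "exp (lam t * y) \<le> exp (y / 4)" using t(2) y by (simp add: mult_right_mono)
  have t2: "t\<^sup>2 \<le> \<bar>t\<bar>" using t(1) mult_left_le[of "\<bar>t\<bar>" "\<bar>t\<bar>"] by (simp add: power2_eq_square flip: abs_mult)
  have lamt: "lam t \<le> sig2 / 2 * \<bar>t\<bar>"
    unfolding lam_def using t2 sig2_pos by (simp add: mult_left_mono)
  have 1: "exp (lam t * y) - 1 \<le> (2 * sig2 * \<bar>t\<bar>) * exp (y / 2)"
  proof -
    have "1 + - (lam t * y) \<le> exp (- (lam t * y))" by (rule exp_ge_add_one_self)
    then have "(1 + - (lam t * y)) * exp (lam t * y) \<le> exp (- (lam t * y)) * exp (lam t * y)"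
      by (rule mult_right_mono) simp
    then have "exp (lam t * y) - 1 \<le> lam t * y * exp (lam t * y)"
      by (simp add: exp_minus algebra_simps)
    also have "\<dots> \<le> lam t * (4 * exp (y / 4)) * exp (y / 4)"
    proof (intro mult_mono mult_left_mono e4)
      have "y / 4 \<le> exp (y / 4)" using exp_ge_add_one_self[of "y / 4"] by linarith
      then show "y \<le> 4 * exp (y / 4)" by simp
    qed (use lam_nonneg y in auto)
    also have "\<dots> = 4 * lam t * exp (y / 2)" by (simp add: mult_exp_exp)
    also have "\<dots> \<le> 4 * (sig2 / 2 * \<bar>t\<bar>) * exp (y / 2)" using lamt by (intro mult_right_mono mult_left_mono) auto
    finally show ?thesis by simp
  qed
  have "Psi N t w - Psi' N t w = cis (t * centered_cost w) * ((1 - of_real (exp (lam t * y))) + of_real (exp (lam t * y)) * (1 - char_eigen t (cf_theta w)))"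
    using w by (simp add: Psi_def Psi'_def r_def[symmetric] y_def[symmetric] algebra_simps)
  also have "cmod \<dots> \<le> cmod (1 - of_real (exp (lam t * y))) + cmod (of_real (exp (lam t * y)) * (1 - char_eigen t (cf_theta w)))"
    by (subst norm_mult) (simp only: norm_cis mult_1_left norm_triangle_ineq)
  also have "cmod (1 - of_real (exp (lam t * y))) = exp (lam t * y) - 1"
  proof -
    have "1 \<le> exp (lam t * y)" using lam_nonneg[of t] y by simp
    then show ?thesis by (metis abs_minus_commute abs_of_nonneg diff_ge_0_iff_ge norm_of_real of_real_1 of_real_diff)
  qed
  also have "cmod (of_real (exp (lam t * y)) * (1 - char_eigen t (cf_theta w))) \<le> exp (y / 2) * (2 * L * \<bar>t\<bar>)"
    unfolding norm_mult norm_of_real abs_exp_cancel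
  proof (rule mult_mono)
    show "exp (lam t * y) \<le> exp (y / 2)" using e4 y by (simp add: order_trans[OF e4])
  qed (use char_eigen_near_1[OF t(1) cf_theta_mem[of w]] in auto)
  finally have "cmod (Psi N t w - Psi' N t w) \<le> (2 * sig2 * \<bar>t\<bar>) * exp (y / 2) + exp (y / 2) * (2 * L * \<bar>t\<bar>)"
    using 1 by simp
  also have "\<dots> = (2 * sig2 + 2 * L) * \<bar>t\<bar> * exp (y / 2)" by (simp add: algebra_simps)
  finally show ?thesis using sq by (simp add: r_def)
qed

text \<open>The error splits in two: \<open>Psi'\<close> is a martingale up to |t|^3 by
  \<open>char_kernel_expectation\<close>, and \<open>Psi\<close> differs from \<open>Psi'\<close> on
  crossing digits only, which costs |t| times the crossing probability.\<close>

lemma Psi_step: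
  obtains C t0 where "0 < t0" "t0 \<le> 1" "0 \<le> C"
    "\<And>t N w. \<bar>t\<bar> \<le> t0 \<Longrightarrow> cf_den w \<le> N \<Longrightarrow>
       cmod (measure_pmf.expectation (digit_pmf (cf_theta w)) (\<lambda>k. Psi N t (k # w)) - Psi N t w) \<le> C * \<bar>t\<bar> ^ 3 + C * \<bar>t\<bar> * cross_prob N w"
proof -
  obtain C0 t0 where t0: "0 < t0" "t0 \<le> 1" "lam t0 \<le> 1/4" "0 \<le> C0"
    and ki: "\<And>t x. \<bar>t\<bar> \<le> t0 \<Longrightarrow> x \<in> {0..1} \<Longrightarrow> integrable (digit_pmf x) (\<lambda>k. char_kernel t k x)"
    and ke: "\<And>t x. \<bar>t\<bar> \<le> t0 \<Longrightarrow> x \<in> {0..1} \<Longrightarrow>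
       cmod (measure_pmf.expectation (digit_pmf x) (\<lambda>k. char_kernel t k x) - char_eigen t x) \<le> C0 * \<bar>t\<bar> ^ 3"
    using char_kernel_expectation by metis
  define C1 where "C1 = 2 * sig2 + 2 * L"
  have C1: "0 \<le> C1" using sig2_pos L_nonneg by (simp add: C1_def)
  define C where "C = C0 + 4 * C1"
  show ?thesis
  proof (rule that[of t0 C])
    show "0 < t0" "t0 \<le> 1" "0 \<le> C" using t0 C1 by (auto simp: C_def)
    fix t N w assume t: "\<bar>t\<bar> \<le> t0" and w: "cf_den w \<le> N"
    have q: "0 < real (cf_den w)" "real (cf_den w) \<le> real N" "0 < N" using cf_den_pos[of w] w by auto
    have t1: "\<bar>t\<bar> \<le> 1" using t t0 by simp
    have lam4: "lam t \<le> 1/4"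
    proof -
      have "t\<^sup>2 \<le> t0\<^sup>2" using t t0 by (metis abs_ge_zero power2_abs power_mono)
      then have "lam t \<le> lam t0" using sig2_pos by (simp add: lam_def)
      then show ?thesis using t0 by simp
    qed
    define a where "a = cis (t * centered_cost w) * of_real (exp (lam t * ln (real (cf_den w) / real N)))"
    have a: "cmod a \<le> 1"
    proof -
      have "ln (real (cf_den w) / real N) \<le> 0" using q by (simp add: divide_le_eq_1)
      then show ?thesis using lam_nonneg[of t] by (simp add: a_def norm_mult mult_nonneg_nonpos)
    qed
    have P': "Psi' N t (k # w) = a * char_kernel t k (cf_theta w)" for k
      unfolding a_def using q by (intro Psi'_Cons) simp
    have Pw: "Psi N t w = a * char_eigen t (cf_theta w)" using w by (simp add: Psi_def Psi'_def a_def)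
    have iP': "integrable (digit_pmf (cf_theta w)) (\<lambda>k. Psi' N t (k # w))"
      unfolding P' by (intro integrable_mult_right ki t cf_theta_mem)
    have iP: "integrable (digit_pmf (cf_theta w)) (\<lambda>k. Psi N t (k # w))"
      by (rule digit_pmf_integrable_bounded[OF Psi_bound[OF t1]])
    have id: "integrable (digit_pmf (cf_theta w)) (\<lambda>k. Psi N t (k # w) - Psi' N t (k # w))"
      using iP iP' by simp
    let ?I = "\<lambda>k. sqrt (real (cf_den (k # w)) / real N) * indicator {k. N < cf_den (k # w)} k"
    have A: "cmod (measure_pmf.expectation (digit_pmf (cf_theta w)) (\<lambda>k. Psi N t (k # w) - Psi' N t (k # w))) \<le> 4 * C1 * \<bar>t\<bar> * cross_prob N w"
    proof -
      have iI: "integrable (digit_pmf (cf_theta w)) ?I"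
      proof (rule digit_pmf_integrable[OF cf_theta_mem])
        fix k
        have "?I k \<le> sqrt (real (cf_den (k # w)) / real N)" by (simp split: split_indicator del: cf_dens.simps)
        also have "\<dots> = sqrt (real (cf_den w) / real N) * sqrt (real k + 1 + cf_theta w)"
          unfolding cf_den_Cons by (simp add: real_sqrt_mult[symmetric] del: real_sqrt_mult)
        finally show "norm (?I k) \<le> sqrt (real (cf_den w) / real N) * sqrt (real k + 1 + cf_theta w)" by (simp del: cf_dens.simps)
      qed
      have "cmod (measure_pmf.expectation (digit_pmf (cf_theta w)) (\<lambda>k. Psi N t (k # w) - Psi' N t (k # w)))
        \<le> measure_pmf.expectation (digit_pmf (cf_theta w)) (\<lambda>k. cmod (Psi N t (k # w) - Psi' N t (k # w)))" by simp
      also have "\<dots> \<le> measure_pmf.expectation (digit_pmf (cf_theta w)) (\<lambda>k. (C1 * \<bar>t\<bar>) * ?I k)"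
      proof (rule integral_mono)
        show "cmod (Psi N t (k # w) - Psi' N t (k # w)) \<le> (C1 * \<bar>t\<bar>) * ?I k" for k
        proof (cases "N < cf_den (k # w)")
          case True
          then show ?thesis using Psi_cross_diff[OF t1 lam4 True q(3)] by (simp add: C1_def del: cf_dens.simps)
        qed (simp add: Psi_def del: cf_dens.simps)
      qed (use id iI in \<open>auto simp del: cf_dens.simps\<close>)
      also have "\<dots> = (C1 * \<bar>t\<bar>) * measure_pmf.expectation (digit_pmf (cf_theta w)) ?I" by (rule integral_mult_right_zero)
      also have "\<dots> \<le> (C1 * \<bar>t\<bar>) * (4 * cross_prob N w)"
        using cross_sqrt[OF w] C1 by (intro mult_left_mono) auto
      finally show ?thesis by (simp add: mult_ac)
    qed
    have B: "cmod (measure_pmf.expectation (digit_pmf (cf_theta w)) (\<lambda>k. Psi' N t (k # w)) - Psi N t w) \<le> C0 * \<bar>t\<bar> ^ 3"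
    proof -
      have "measure_pmf.expectation (digit_pmf (cf_theta w)) (\<lambda>k. Psi' N t (k # w)) - Psi N t w
        = a * (measure_pmf.expectation (digit_pmf (cf_theta w)) (\<lambda>k. char_kernel t k (cf_theta w)) - char_eigen t (cf_theta w))"
        unfolding P' Pw by (simp add: right_diff_distrib)
      also have "cmod \<dots> \<le> 1 * (C0 * \<bar>t\<bar> ^ 3)"
        unfolding norm_mult using a ke[OF t cf_theta_mem[of w]] by (intro mult_mono) auto
      finally show ?thesis by simp
    qed
    have "measure_pmf.expectation (digit_pmf (cf_theta w)) (\<lambda>k. Psi N t (k # w)) - Psi N t w =
      measure_pmf.expectation (digit_pmf (cf_theta w)) (\<lambda>k. Psi N t (k # w) - Psi' N t (k # w)) +
      (measure_pmf.expectation (digit_pmf (cf_theta w)) (\<lambda>k. Psi' N t (k # w)) - Psi N t w)"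
      using iP iP' by simp
    also have "cmod \<dots> \<le> 4 * C1 * \<bar>t\<bar> * cross_prob N w + C0 * \<bar>t\<bar> ^ 3"
      using A B by (rule order_trans[OF norm_triangle_ineq add_mono])
    also have "\<dots> \<le> C * \<bar>t\<bar> * cross_prob N w + C * \<bar>t\<bar> ^ 3"
      using C1 t0 by (intro add_mono mult_right_mono) (auto simp: C_def cross_prob_def)
    finally show "cmod (measure_pmf.expectation (digit_pmf (cf_theta w)) (\<lambda>k. Psi N t (k # w)) - Psi N t w) \<le> C * \<bar>t\<bar> ^ 3 + C * \<bar>t\<bar> * cross_prob N w"
      by simp
  qed
qed

lemma chain_Psi:
  obtains C t0 where "0 < t0" "t0 \<le> 1" "0 \<le> C"
    "\<And>t N m w. \<bar>t\<bar> \<le> t0 \<Longrightarrow>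
       cmod (measure_pmf.expectation (chain N m w) (Psi N t) - Psi N t w) \<le> real m * (C * \<bar>t\<bar> ^ 3) + C * \<bar>t\<bar>"
proof -
  obtain C t0 where t0: "0 < t0" "t0 \<le> 1" "0 \<le> C"
    and st: "\<And>t N w. \<bar>t\<bar> \<le> t0 \<Longrightarrow> cf_den w \<le> N \<Longrightarrow>
       cmod (measure_pmf.expectation (digit_pmf (cf_theta w)) (\<lambda>k. Psi N t (k # w)) - Psi N t w) \<le> C * \<bar>t\<bar> ^ 3 + C * \<bar>t\<bar> * cross_prob N w"
    using Psi_step by metis
  \<comment> \<open>The induction needs a reserve C |t| that is held only while the level has not
    been crossed. Each step spends C |t| times the crossing probability, which is just the part of
    the reserve released by the paths that cross.\<close>
  have main: "cmod (measure_pmf.expectation (chain N m w) (Psi N t) - Psi N t w)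
     \<le> real m * (C * \<bar>t\<bar> ^ 3) + (if cf_den w \<le> N then C * \<bar>t\<bar> else 0)" if t: "\<bar>t\<bar> \<le> t0" for t N m w
  proof (induction m arbitrary: w)
    case 0
    then show ?case using t0 by simp
  next
    case (Suc m)
    show ?case
    proof (cases "N < cf_den w")
      case True
      then show ?thesis using t0 by simp
    next
      case False
      have t1: "\<bar>t\<bar> \<le> 1" using t t0 by simp
      let ?E = "\<lambda>k. measure_pmf.expectation (chain N m (k # w)) (Psi N t)"
      have Eb: "cmod (?E k) \<le> 1 + 2 * L" for k
      proof -
        have i: "integrable (chain N m (k # w)) (Psi N t)"
          using Psi_bound[OF t1] by (intro measure_pmf.integrable_const_bound[where B="1 + 2 * L"]) auto
        have "cmod (?E k) \<le> measure_pmf.expectation (chain N m (k # w)) (\<lambda>w. cmod (Psi N t w))" by simp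
        also have "\<dots> \<le> measure_pmf.expectation (chain N m (k # w)) (\<lambda>w. 1 + 2 * L)"
          using Psi_bound[OF t1] i by (intro integral_mono) auto
        finally show ?thesis by simp
      qed
      have iE: "integrable (digit_pmf (cf_theta w)) ?E" by (rule digit_pmf_integrable_bounded[OF Eb])
      have iP: "integrable (digit_pmf (cf_theta w)) (\<lambda>k. Psi N t (k # w))"
        by (rule digit_pmf_integrable_bounded[OF Psi_bound[OF t1]])
      have ind: "integrable (digit_pmf (cf_theta w)) (indicat_real X)" for X
        by (rule digit_pmf_integrable_bounded[where B=1]) simp
      have e: "measure_pmf.expectation (chain N (Suc m) w) (Psi N t) = measure_pmf.expectation (digit_pmf (cf_theta w)) ?E"
        using False complex_expectation_bind_pmf[of "Psi N t", OF Psi_bound[OF t1]] by simp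
      have "cmod (measure_pmf.expectation (digit_pmf (cf_theta w)) (\<lambda>k. ?E k - Psi N t (k # w)))
        \<le> measure_pmf.expectation (digit_pmf (cf_theta w)) (\<lambda>k. cmod (?E k - Psi N t (k # w)))" by simp
      also have "\<dots> \<le> measure_pmf.expectation (digit_pmf (cf_theta w))
          (\<lambda>k. (real m * (C * \<bar>t\<bar> ^ 3) + C * \<bar>t\<bar>) - C * \<bar>t\<bar> * indicator {k. N < cf_den (k # w)} k)"
      proof (rule integral_mono)
        show "cmod (?E k - Psi N t (k # w)) \<le> (real m * (C * \<bar>t\<bar> ^ 3) + C * \<bar>t\<bar>) - C * \<bar>t\<bar> * indicator {k. N < cf_den (k # w)} k" for k
          using Suc.IH[of "k # w"] by (cases "N < cf_den (k # w)") (simp_all del: cf_dens.simps)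
        show "integrable (digit_pmf (cf_theta w)) (\<lambda>k. cmod (?E k - Psi N t (k # w)))"
          using iE iP by (intro integrable_norm Bochner_Integration.integrable_diff)
        show "integrable (digit_pmf (cf_theta w)) (\<lambda>k. (real m * (C * \<bar>t\<bar> ^ 3) + C * \<bar>t\<bar>) - C * \<bar>t\<bar> * indicator {k. N < cf_den (k # w)} k)"
          by (intro Bochner_Integration.integrable_diff integrable_mult_right ind measure_pmf.integrable_const)
      qed
      also have "\<dots> = (real m * (C * \<bar>t\<bar> ^ 3) + C * \<bar>t\<bar>) - C * \<bar>t\<bar> * cross_prob N w"
        unfolding cross_prob_def
        using Bochner_Integration.integral_diff[OF measure_pmf.integrable_const[of "digit_pmf (cf_theta w)" "real m * (C * \<bar>t\<bar> ^ 3) + C * \<bar>t\<bar>"] integrable_mult_right[OF ind, of "C * \<bar>t\<bar>" "{k. N < cf_den (k # w)}"]]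
          ind[of "{k. N < cf_den (k # w)}"]
        by (simp del: cf_dens.simps)
      finally have A: "cmod (measure_pmf.expectation (digit_pmf (cf_theta w)) (\<lambda>k. ?E k - Psi N t (k # w)))
        \<le> (real m * (C * \<bar>t\<bar> ^ 3) + C * \<bar>t\<bar>) - C * \<bar>t\<bar> * cross_prob N w" .
      have "measure_pmf.expectation (chain N (Suc m) w) (Psi N t) - Psi N t w =
        measure_pmf.expectation (digit_pmf (cf_theta w)) (\<lambda>k. ?E k - Psi N t (k # w))
        + (measure_pmf.expectation (digit_pmf (cf_theta w)) (\<lambda>k. Psi N t (k # w)) - Psi N t w)"
        unfolding e using iE iP by simp
      also have "cmod \<dots> \<le> ((real m * (C * \<bar>t\<bar> ^ 3) + C * \<bar>t\<bar>) - C * \<bar>t\<bar> * cross_prob N w) + (C * \<bar>t\<bar> ^ 3 + C * \<bar>t\<bar> * cross_prob N w)"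
        using A st[OF t, of w N] False by (intro order_trans[OF norm_triangle_ineq add_mono]) auto
      also have "\<dots> = real (Suc m) * (C * \<bar>t\<bar> ^ 3) + C * \<bar>t\<bar>" by (simp add: algebra_simps)
      finally show ?thesis using False by simp
    qed
  qed
  show ?thesis
  proof (rule that[OF t0])
    fix t N m w assume "\<bar>t\<bar> \<le> t0"
    from main[OF this, of N m w] show "cmod (measure_pmf.expectation (chain N m w) (Psi N t) - Psi N t w) \<le> real m * (C * \<bar>t\<bar> ^ 3) + C * \<bar>t\<bar>"
      using t0(3) by (auto split: if_splits intro: order_trans)
  qed
qed

text \<open>For t = s / sqrt (ln N) the initial value of \<open>Psi\<close>, at the empty word with
  denominator 1, is exp (- sig2 s^2 / 2) times a factor tending to 1. The errors accumulated over
  O(ln N) steps are O(|t|^3 ln N + |t|) and vanish.\<close>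

lemma chain_char_limit:
  "(\<lambda>N. measure_pmf.expectation (chain N (chain_steps N) []) (\<lambda>w. cis (s / sqrt (ln (real N)) * centered_cost w))) \<longlonglongrightarrow> of_real (exp (- (sig2 * s\<^sup>2 / 2)))"
proof -
  obtain C t0 where t0: "0 < t0" "t0 \<le> 1" "0 \<le> C"
    and ch: "\<And>t N m w. \<bar>t\<bar> \<le> t0 \<Longrightarrow>
       cmod (measure_pmf.expectation (chain N m w) (Psi N t) - Psi N t w) \<le> real m * (C * \<bar>t\<bar> ^ 3) + C * \<bar>t\<bar>"
    using chain_Psi by metis
  define t where "t N = s / sqrt (ln (real N))" for N :: nat
  let ?E = "\<lambda>N. measure_pmf.expectation (chain N (chain_steps N) []) (\<lambda>w. cis (t N * centered_cost w))"
  let ?e = "exp (- (sig2 * s\<^sup>2 / 2))"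
  have tl: "t \<longlonglongrightarrow> 0" unfolding t_def by real_asymp
  have "(\<lambda>N. \<bar>t N\<bar>) \<longlonglongrightarrow> 0" using tendsto_rabs[OF tl] by simp
  then have ev: "eventually (\<lambda>N. \<bar>t N\<bar> < t0) sequentially" using t0(1) by (rule order_tendstoD)
  have bound: "eventually (\<lambda>N. cmod (?E N - of_real ?e) \<le> 2 * (ln (real N) / ln 2 + 2) * (C * \<bar>t N\<bar> ^ 3) + C * \<bar>t N\<bar> + 2 * L * \<bar>t N\<bar>) sequentially"
    using ev eventually_ge_at_top[of 2]
  proof eventually_elim
    case (elim N)
    have t: "\<bar>t N\<bar> \<le> t0" "\<bar>t N\<bar> \<le> 1" using elim t0 by auto
    have lN: "0 < ln (real N)" using elim by simp
    \<comment> \<open>Every word in the support has crossed the level, and there \<open>Psi\<close>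
      is the bare character.\<close>
    have "?E N = measure_pmf.expectation (chain N (chain_steps N) []) (Psi N (t N))"
      by (intro integral_cong_AE) (auto simp: AE_measure_pmf_iff Psi_def dest: chain_steps_stop)
    moreover have "Psi N (t N) [] = of_real ?e * char_eigen (t N) 0"
    proof -
      have "(t N)\<^sup>2 = s\<^sup>2 / ln (real N)" using lN by (simp add: t_def power_divide)
      then have "lam (t N) * ln (1 / real N) = - (sig2 * s\<^sup>2 / 2)"
        using lN elim by (simp add: lam_def ln_div)
      then show ?thesis using elim by (simp add: Psi_def Psi'_def centered_cost_def cf_theta_def)
    qed
    ultimately have 1: "cmod (?E N - of_real ?e * char_eigen (t N) 0) \<le> real (chain_steps N) * (C * \<bar>t N\<bar> ^ 3) + C * \<bar>t N\<bar>"
      using ch[OF t(1), of N "chain_steps N" "[]"] by simp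
    have "cmod (of_real ?e * char_eigen (t N) 0 - of_real ?e) = ?e * cmod (1 - char_eigen (t N) 0)"
    proof -
      have "of_real ?e * char_eigen (t N) 0 - of_real ?e = of_real ?e * (char_eigen (t N) 0 - 1)" by (simp add: right_diff_distrib)
      then have "cmod (of_real ?e * char_eigen (t N) 0 - of_real ?e) = cmod (of_real ?e) * cmod (char_eigen (t N) 0 - 1)"
        by (simp only: norm_mult)
      then show ?thesis by (simp add: norm_minus_commute del: of_real_exp exp_of_real)
    qed
    also have "\<dots> \<le> 1 * (2 * L * \<bar>t N\<bar>)"
      using char_eigen_near_1[OF t(2), of 0] sig2_pos by (intro mult_mono) auto
    finally have 2: "cmod (of_real ?e * char_eigen (t N) 0 - of_real ?e) \<le> 2 * L * \<bar>t N\<bar>" by simp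
    have "cmod (?E N - of_real ?e) \<le> cmod (?E N - of_real ?e * char_eigen (t N) 0) + cmod (of_real ?e * char_eigen (t N) 0 - of_real ?e)"
      by (rule norm_diff_triangle_le[OF order_refl order_refl])
    also have "\<dots> \<le> (real (chain_steps N) * (C * \<bar>t N\<bar> ^ 3) + C * \<bar>t N\<bar>) + 2 * L * \<bar>t N\<bar>" using 1 2 by (rule add_mono)
    also have "\<dots> \<le> (2 * (ln (real N) / ln 2 + 2) * (C * \<bar>t N\<bar> ^ 3) + C * \<bar>t N\<bar>) + 2 * L * \<bar>t N\<bar>"
      using chain_steps_le[of N] elim t0 by (intro add_right_mono mult_right_mono) auto
    finally show ?case .
  qed
  have "(\<lambda>N. 2 * (ln (real N) / ln 2 + 2) * (C * \<bar>t N\<bar> ^ 3) + C * \<bar>t N\<bar> + 2 * L * \<bar>t N\<bar>) \<longlonglongrightarrow> 0"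
  proof -
    have e: "eventually (\<lambda>N. 2 * (ln (real N) / ln 2 + 2) * (C * (\<bar>s\<bar> ^ 3 / (sqrt (ln (real N))) ^ 3)) + C * (\<bar>s\<bar> / sqrt (ln (real N))) + 2 * L * (\<bar>s\<bar> / sqrt (ln (real N)))
      = 2 * (ln (real N) / ln 2 + 2) * (C * \<bar>t N\<bar> ^ 3) + C * \<bar>t N\<bar> + 2 * L * \<bar>t N\<bar>) sequentially"
      using eventually_ge_at_top[of 2]
      by eventually_elim (simp add: t_def power_divide)
    have "(\<lambda>N. 2 * (ln (real N) / ln 2 + 2) * (C * (\<bar>s\<bar> ^ 3 / (sqrt (ln (real N))) ^ 3)) + C * (\<bar>s\<bar> / sqrt (ln (real N))) + 2 * L * (\<bar>s\<bar> / sqrt (ln (real N)))) \<longlonglongrightarrow> 0"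
    proof -
      have 1: "(\<lambda>N. 2 * (ln (real N) / ln 2 + 2) * (1 / (sqrt (ln (real N))) ^ 3)) \<longlonglongrightarrow> 0"
        "(\<lambda>N. 1 / sqrt (ln (real N))) \<longlonglongrightarrow> 0" by real_asymp+
      show ?thesis
        using tendsto_add[OF tendsto_add[OF tendsto_mult[OF tendsto_const[of "C * \<bar>s\<bar> ^ 3"] 1(1)] tendsto_mult[OF tendsto_const[of "C * \<bar>s\<bar>"] 1(2)]] tendsto_mult[OF tendsto_const[of "2 * L * \<bar>s\<bar>"] 1(2)]]
        by (simp add: mult_ac)
    qed
    then show ?thesis by (rule Lim_transform_eventually[OF _ e])
  qed
  then have "(\<lambda>N. ?E N - of_real ?e) \<longlonglongrightarrow> 0"
    by (rule Lim_null_comparison[OF bound])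
  then show ?thesis using LIM_zero_iff unfolding t_def by blast
qed

abbreviation Phi :: "real \<Rightarrow> real" where "Phi \<equiv> cdf std_normal_distribution"

lemma isCont_Phi: "isCont Phi x"
proof -
  interpret real_distribution std_normal_distribution by (rule real_dist_normal_dist)
  have "emeasure std_normal_distribution {x} = 0"
    by (subst emeasure_density) (auto intro: nn_integral_null_set)
  then show ?thesis by (simp add: isCont_cdf measure_def)
qed

lemma chain_clt:
  "(\<lambda>N. measure_pmf.prob (chain N (chain_steps N) []) {w. centered_cost w / (sqrt sig2 * sqrt (ln (real N))) \<le> x}) \<longlonglongrightarrow> Phi x"
proof -
  let ?p = "\<lambda>N. chain N (chain_steps N) []"
  define M where "M N = distr (measure_pmf (?p N)) borel (\<lambda>w. centered_cost w / (sqrt sig2 * sqrt (ln (real N))))" for N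
  have rd: "real_distribution (M N)" for N
    unfolding M_def by (intro prob_space.real_distribution_distr[OF measure_pmf.prob_space_axioms]) simp
  have ch: "char (M N) r = measure_pmf.expectation (?p N) (\<lambda>w. cis ((r / sqrt sig2) / sqrt (ln (real N)) * centered_cost w))" for N r
    unfolding char_def M_def by (subst integral_distr) (auto simp: cis_conv_exp)
  have "weak_conv_m M std_normal_distribution"
  proof (rule levy_continuity[OF rd real_dist_normal_dist])
    fix r
    have "sig2 * (r / sqrt sig2)\<^sup>2 / 2 = r\<^sup>2 / 2" using sig2_pos by (simp add: power_divide)
    then show "(\<lambda>N. char (M N) r) \<longlonglongrightarrow> char std_normal_distribution r"
      using chain_char_limit[of "r / sqrt sig2"] unfolding ch char_std_normal_distribution by simp
  qed
  then have "(\<lambda>N. cdf (M N) x) \<longlonglongrightarrow> Phi x"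
    using isCont_Phi[of x] unfolding weak_conv_m_def weak_conv_def by blast
  moreover have "cdf (M N) x = measure_pmf.prob (?p N) {w. centered_cost w / (sqrt sig2 * sqrt (ln (real N))) \<le> x}" for N
    unfolding cdf_def M_def by (subst measure_distr) (auto simp: vimage_def)
  ultimately show ?thesis by simp
qed

end

subsection \<open>Counting pairs by cylinders\<close>

text \<open>The ratio of the result has the digits of w followed by those of p. The head of w is the
  latest digit, hence the innermost one, and is applied first. One digit acts on a ratio by x going
  to 1 / (k + 1 + x), which keeps the gcd of the pair.\<close>

primrec prepend :: "nat list \<Rightarrow> nat \<times> nat \<Rightarrow> nat \<times> nat" where
  "prepend [] p = p"
| "prepend (k # w) p = prepend w (snd p, Suc k * snd p + fst p)"

definition proper_pair :: "nat \<times> nat \<Rightarrow> bool" where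
  "proper_pair p \<longleftrightarrow> 1 \<le> fst p \<and> fst p < snd p"

lemma prepend_snd: "snd (prepend w p) = cf_den w * snd p + cf_den_prev w * fst p"
  by (induction w arbitrary: p) (auto simp: algebra_simps)

lemma proper_pair_step: "proper_pair p \<Longrightarrow> proper_pair (snd p, Suc k * snd p + fst p)"
  by (auto simp: proper_pair_def)

lemma prepend_proper_pair: "proper_pair p \<Longrightarrow> proper_pair (prepend w p)"
proof (induction w arbitrary: p)
  case (Cons k w)
  show ?case using Cons.IH[OF proper_pair_step[OF Cons.prems, of k]] by simp
qed simp

lemma prepend_inj: "prepend w p = prepend w p' \<Longrightarrow> p = p'"
proof (induction w arbitrary: p p')
  case (Cons k w)
  have "(snd p, Suc k * snd p + fst p) = (snd p', Suc k * snd p' + fst p')"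
    by (rule Cons.IH) (use Cons.prems in \<open>simp only: prepend.simps\<close>)
  then have "snd p = snd p'" "fst p = fst p'" by auto
  then show ?case by (simp add: prod_eq_iff)
qed simp

definition ratio :: "nat \<times> nat \<Rightarrow> real" where
  "ratio p = real (fst p) / real (snd p)"

lemma cf_digits_eq: "cf_expansion as x \<Longrightarrow> cf_digits x = as"
  unfolding cf_digits_def using cf_expansion_unique by (intro the_equality) auto

lemma cf_digits_expansion:
  assumes "proper_pair p"
  shows "cf_expansion (cf_digits (ratio p)) (ratio p)"
proof -
  obtain as where "cf_expansion as (ratio p)"
    using cf_expansion_exists[of "fst p" "snd p"] assms by (auto simp: proper_pair_def ratio_def)
  then show ?thesis using cf_digits_eq by metis
qed

lemma cf_digits_step:
  assumes p: "proper_pair p"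
  shows "cf_digits (ratio (snd p, Suc k * snd p + fst p)) = Suc k # cf_digits (ratio p)"
proof (rule cf_digits_eq)
  have v: "0 < real (snd p)" using p by (simp add: proper_pair_def)
  have "ratio (snd p, Suc k * snd p + fst p) = 1 / (real (Suc k) + ratio p)"
    using v by (simp add: ratio_def field_simps)
  then show "cf_expansion (Suc k # cf_digits (ratio p)) (ratio (snd p, Suc k * snd p + fst p))"
    using cf_digits_expansion[OF p] by (auto simp: cf_expansion_def)
qed

lemma cf_digits_prepend:
  assumes "proper_pair p"
  shows "cf_digits (ratio (prepend w p)) = map Suc (rev w) @ cf_digits (ratio p)"
  using assms
proof (induction w arbitrary: p)
  case (Cons k w)
  show ?case using Cons.IH[OF proper_pair_step[OF Cons.prems], of k] cf_digits_step[OF Cons.prems, of k] by simp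
qed simp

lemma total_cost_prepend:
  assumes "proper_pair p"
  shows "total_cost c (ratio (prepend w p)) = (\<Sum>k\<leftarrow>w. c (Suc k)) + total_cost c (ratio p)"
  unfolding total_cost_def cf_digits_prepend[OF assms]
  by (simp add: rev_map[symmetric] sum_list_rev o_def)

text \<open>A crude bound; it is applied to the unread rest of an expansion, whose denominator is
  bounded independently of n.\<close>

lemma cf_digits_length:
  assumes "proper_pair (u, v)"
  shows "length (cf_digits (ratio (u, v))) \<le> v"
  using assms
proof (induction v arbitrary: u rule: less_induct)
  case (less v)
  have u: "1 \<le> u" "u < v" using less.prems by (auto simp: proper_pair_def)
  show ?case
  proof (cases "v mod u = 0")
    case True
    then have v: "v = (v div u) * u" by (metis add.right_neutral div_mult_mod_eq)
    have "2 \<le> v div u"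
    proof (rule ccontr)
      assume "\<not> 2 \<le> v div u"
      then have "(v div u) * u \<le> 1 * u" by (intro mult_le_mono1) simp
      then show False using u v by simp
    qed
    moreover have "ratio (u, v) = 1 / real (v div u)"
    proof -
      have "real v = real (v div u) * real u" using v by (metis of_nat_mult)
      then show ?thesis using u by (simp add: ratio_def)
    qed
    ultimately have "cf_expansion [v div u] (ratio (u, v))" by (simp add: cf_expansion_def)
    then show ?thesis using cf_digits_eq u by fastforce
  next
    case False
    define k where "k = v div u - 1"
    have "1 \<le> v div u" using u by (simp add: Suc_le_eq div_greater_zero_iff)
    then have k: "v = Suc k * u + v mod u" unfolding k_def by simp
    have r: "proper_pair (v mod u, u)" using False u by (simp add: proper_pair_def)
    have "cf_digits (ratio (u, v)) = Suc k # cf_digits (ratio (v mod u, u))"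
      using cf_digits_step[OF r, of k] k by simp
    moreover have "length (cf_digits (ratio (v mod u, u))) \<le> u" using less.IH[OF u(2) r] .
    ultimately show ?thesis using u by simp
  qed
qed

lemma total_cost_bounds:
  assumes c: "\<And>n. 1 \<le> n \<Longrightarrow> 0 \<le> c n" "\<And>n. 1 \<le> n \<Longrightarrow> c n \<le> B" and p: "proper_pair p"
  shows "0 \<le> total_cost c (ratio p)" "total_cost c (ratio p) \<le> B * real (snd p)"
proof -
  have d: "\<forall>a\<in>set (cf_digits (ratio p)). 1 \<le> a" using cf_digits_expansion[OF p] by (simp add: cf_expansion_def)
  show "0 \<le> total_cost c (ratio p)"
    unfolding total_cost_def using d c by (intro sum_list_nonneg) auto
  have "total_cost c (ratio p) \<le> (\<Sum>a\<leftarrow>cf_digits (ratio p). B)"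
    unfolding total_cost_def using d c by (intro sum_list_mono) auto
  also have "\<dots> = B * real (length (cf_digits (ratio p)))" by (simp add: sum_list_triv)
  also have "\<dots> \<le> B * real (snd p)"
    using cf_digits_length[of "fst p" "snd p"] p c[of 1] by (intro mult_left_mono) auto
  finally show "total_cost c (ratio p) \<le> B * real (snd p)" .
qed

section \<open>Stopped words, disjointness of their cylinders, and lattice points\<close>

definition stopped :: "nat \<Rightarrow> nat list \<Rightarrow> bool" where
  "stopped N w \<longleftrightarrow> N < cf_den w \<and> (w \<noteq> [] \<longrightarrow> cf_den (tl w) \<le> N)"

text \<open>Stopped words form an antichain: a proper extension of w passes through w before its
  last digit, where the denominator already exceeds N.\<close>

lemma stopped_suffix:
  assumes "stopped N (v @ w)" "stopped N w"
  shows "v = []"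
proof (rule ccontr)
  assume "v \<noteq> []"
  then have "cf_den w \<le> cf_den (tl (v @ w))" using cf_den_suffix_mono[of w "tl v"] by simp
  also have "\<dots> \<le> N" using assms(1) \<open>v \<noteq> []\<close> by (simp add: stopped_def)
  finally show False using assms(2) by (simp add: stopped_def)
qed

text \<open>By uniqueness of expansions one of the two words is an initial block of digits of the
  other, hence a list suffix in this storage order, and the antichain property makes them equal.
  Different stopped words thus account for disjoint sets of pairs.\<close>

lemma prepend_stopped_inj:
  assumes "stopped N w" "stopped N w'" "proper_pair p" "proper_pair p'" "prepend w p = prepend w' p'"
  shows "w = w' \<and> p = p'"
proof -
  have "map Suc (rev w) @ cf_digits (ratio p) = map Suc (rev w') @ cf_digits (ratio p')"
    using cf_digits_prepend[OF assms(3), of w] cf_digits_prepend[OF assms(4), of w'] assms(5) by simp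
  then obtain us where us: "map Suc (rev w) = map Suc (rev w') @ us \<or> map Suc (rev w) @ us = map Suc (rev w')"
    by (auto simp: append_eq_append_conv2)
  have "\<exists>v. w = v @ w' \<or> w' = v @ w"
    using us
  proof
    assume "map Suc (rev w) = map Suc (rev w') @ us"
    then obtain xs ys where "rev w = xs @ ys" "map Suc (rev w') = map Suc xs" by (metis map_eq_append_conv)
    then have "rev w = rev w' @ ys" by (metis inj_Suc inj_map_eq_map)
    then have "w = rev ys @ w'" by (metis rev_append rev_rev_ident)
    then show ?thesis by blast
  next
    assume "map Suc (rev w) @ us = map Suc (rev w')"
    then obtain xs ys where "rev w' = xs @ ys" "map Suc (rev w) = map Suc xs" by (metis map_eq_append_conv)
    then have "rev w' = rev w @ ys" by (metis inj_Suc inj_map_eq_map)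
    then have "w' = rev ys @ w" by (metis rev_append rev_rev_ident)
    then show ?thesis by blast
  qed
  then have "w = w'" using stopped_suffix assms(1,2) by fastforce
  then show ?thesis using prepend_inj assms(5) by blast
qed

definition suffix_pairs :: "nat \<Rightarrow> nat \<Rightarrow> nat \<Rightarrow> (nat \<times> nat) set" where
  "suffix_pairs q r n = {p. proper_pair p \<and> q * snd p + r * fst p \<le> n}"

lemma finite_suffix_pairs: "1 \<le> q \<Longrightarrow> finite (suffix_pairs q r n)"
proof (rule finite_subset[of _ "{..n} \<times> {..n}"])
  assume q: "1 \<le> q"
  show "suffix_pairs q r n \<subseteq> {..n} \<times> {..n}"
  proof
    fix p assume p: "p \<in> suffix_pairs q r n"
    have "1 * snd p \<le> q * snd p" using q by (intro mult_right_mono) auto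
    then have "snd p \<le> n" "fst p \<le> n" using p unfolding suffix_pairs_def proper_pair_def by (simp_all, linarith+)
    then show "p \<in> {..n} \<times> {..n}" by (cases p) auto
  qed
qed simp

lemma div_lower: "real n / real q - 1 \<le> real (n div q)"
proof (cases "q = 0")
  case False
  have "n < q * (n div q + 1)" using dividend_less_times_div[of q n] False by simp
  then have "real n < real (q * (n div q + 1))" by (simp only: of_nat_less_iff)
  then have "real n < real q * (real (n div q) + 1)" by (simp add: distrib_left)
  then show ?thesis using False by (simp add: field_simps)
qed simp

text \<open>Lattice points of the triangle with vertices (0, 0), (0, n/q) and (n/(q+r), n/(q+r)),
  whose area n^2 / (2 q (q + r)) is n^2 / 2 times the cylinder length. They are counted along lines
  of constant u, each length being bounded below by a linear function A - b u.\<close>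

lemma card_suffix_pairs:
  assumes q: "1 \<le> q" "r \<le> q" and n: "3 * q \<le> n"
  shows "(real n - 3 * real q)\<^sup>2 / (2 * real q * (real q + real r)) \<le> real (card (suffix_pairs q r n))"
proof -
  \<comment> \<open>The integer part of A / b, that is, the last u for which the linear bound is not
    negative.\<close>
  define U where "U = (n - q) div (q + r)"
  define h where "h u = (n - r * u) div q" for u
  define R where "R = (SIGMA u:{1..U}. {u<..h u})"
  have sub: "R \<subseteq> suffix_pairs q r n"
  proof
    fix p assume "p \<in> R"
    then obtain u v where p: "p = (u, v)" "1 \<le> u" "u < v" "v \<le> (n - r * u) div q" by (auto simp: R_def h_def)
    have "q * v \<le> n - r * u" using p(4) q by (metis div_times_less_eq_dividend le_trans mult.commute mult_le_mono2)
    moreover have "1 \<le> q * v" using p q by (metis less_one mult_eq_0_iff not_le not_less0 zero_neq_one le_less_trans)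
    ultimately have "q * v + r * u \<le> n" by linarith
    then show "p \<in> suffix_pairs q r n" using p by (simp add: suffix_pairs_def proper_pair_def)
  qed
  define A b where "A = (real n - real q) / real q" and "b = (real q + real r) / real q"
  have Ab: "0 < b" "A / b = (real n - real q) / (real q + real r)" using q by (auto simp: A_def b_def)
  have rq: "0 < real q" using q by simp
  have U1: "real U \<le> A / b"
  proof -
    have "real U \<le> real (n - q) / real (q + r)" unfolding U_def by (rule of_nat_div_le_of_nat)
    then show ?thesis using n q unfolding Ab by (simp add: of_nat_diff)
  qed
  have U2: "A / b - 1 \<le> real U"
  proof -
    have "real (n - q) / real (q + r) - 1 \<le> real U" unfolding U_def
      using div_lower[of "n - q" "q + r"] by linarith
    then show ?thesis using n q unfolding Ab by (simp add: of_nat_diff)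
  qed
  \<comment> \<open>Truncated subtraction does no harm: when r u exceeds n, the linear bound is at
    most 0.\<close>
  have row: "A - b * real u \<le> real (h u - u)" for u
  proof (cases "r * u \<le> n")
    case True
    have "real (n - r * u) / real q - 1 \<le> real (h u)" unfolding h_def
      using div_lower[of "n - r * u" q] by linarith
    then have "(real n - real r * real u) / real q - 1 - real u \<le> real (h u) - real u"
      using True by (simp add: of_nat_diff)
    also have "\<dots> \<le> real (h u - u)" by simp
    finally have "(real n - real r * real u) / real q - 1 - real u \<le> real (h u - u)" .
    moreover have "(real n - real r * real u) / real q - 1 - real u = A - b * real u"
      unfolding A_def b_def using rq by (simp add: field_simps)
    ultimately show ?thesis by linarith
  next
    case False
    then have "real n < real r * real u" by (metis not_le of_nat_less_iff of_nat_mult)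
    then have "real n - real q \<le> (real q + real r) * real u"
      by (simp add: distrib_right) (smt (verit) mult_nonneg_nonneg of_nat_0_le_iff)
    then have "A \<le> b * real u" using rq by (simp add: A_def b_def divide_right_mono)
    then show ?thesis using of_nat_0_le_iff[of "h u - u", where ?'a = real] by linarith
  qed
  have "real (card R) = (\<Sum>u=1..U. real (h u - u))"
    unfolding R_def by (subst card_SigmaI) auto
  also have "\<dots> \<ge> (\<Sum>u=1..U. A - b * real u)" by (intro sum_mono row)
  also have "(\<Sum>u=1..U. A - b * real u) = real U * (A - b * (real U + 1) / 2)"
    by (induction U) (auto simp: algebra_simps add_divide_distrib)
  finally have c1: "real U * (A - b * (real U + 1) / 2) \<le> real (card R)" .
  \<comment> \<open>U lies between A / b - 1 and A / b. The lower end bounds the number of lines,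
    the upper end their mean length.\<close>
  have "(A / b - 1) * ((A - b) / 2) \<le> real U * (A - b * (real U + 1) / 2)"
  proof (rule mult_mono)
    have "b * real U \<le> A" using U1 unfolding pos_le_divide_eq[OF Ab(1)] by (simp only: mult.commute)
    moreover have "(A - b) / 2 \<le> A - (z + b) / 2" if "z \<le> A" for z using that by (simp add: field_simps)
    moreover have "b * (real U + 1) = b * real U + b" by (simp add: distrib_left)
    ultimately show "(A - b) / 2 \<le> A - b * (real U + 1) / 2" by (simp only:)
    have "real q + real r \<le> real n - real q" using n q by linarith
    then have "b \<le> A" using rq unfolding A_def b_def by (intro divide_right_mono) auto
    then show "0 \<le> (A - b) / 2" by simp
  qed (use U2 in auto)
  also note c1
  also have "real (card R) \<le> real (card (suffix_pairs q r n))"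
    using card_mono[OF finite_suffix_pairs[OF q(1)] sub] by simp
  finally have c2: "(A / b - 1) * ((A - b) / 2) \<le> real (card (suffix_pairs q r n))" .
  have "(A / b - 1) * ((A - b) / 2) = (real n - 2 * real q - real r)\<^sup>2 / (2 * real q * (real q + real r))"
  proof -
    have "A - b = (real n - 2 * real q - real r) / real q" using rq by (simp add: A_def b_def diff_divide_distrib[symmetric])
    moreover have "A / b - 1 = (real n - 2 * real q - real r) / (real q + real r)"
      unfolding Ab(2) using rq by (simp add: field_simps)
    ultimately show ?thesis by (simp add: power2_eq_square mult_ac)
  qed
  moreover have "(real n - 3 * real q)\<^sup>2 / (2 * real q * (real q + real r)) \<le> (real n - 2 * real q - real r)\<^sup>2 / (2 * real q * (real q + real r))"
    using n q by (intro divide_right_mono power_mono) auto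
  ultimately show ?thesis using c2 by linarith
qed

text \<open>The denominator bounds every digit directly, and the number of digits through its
  exponential growth.\<close>

lemma finite_words: "finite {w. cf_den w \<le> M}"
proof (rule finite_subset)
  show "{w. cf_den w \<le> M} \<subseteq> {w. set w \<subseteq> {..M} \<and> length w \<le> 2 * M + 1}"
  proof
    fix w assume "w \<in> {w. cf_den w \<le> M}"
    then have w: "cf_den w \<le> M" by simp
    have "k \<le> cf_den w" if "k \<in> set w" for k
      using that
    proof (induction w)
      case (Cons j w)
      have "Suc j * 1 \<le> Suc j * cf_den w" using cf_den_pos[of w] by (intro mult_le_mono2)
      then have "j \<le> cf_den (j # w)" by simp
      then show ?case using Cons cf_den_mono_Cons[of w j] by (metis le_trans set_ConsD)
    qed simp
    then have "set w \<subseteq> {..M}" using w by force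
    moreover have "length w div 2 < 2 ^ (length w div 2)" by simp
    then have "length w div 2 < M + 1" using cf_den_growth[of w] w by linarith
    then have "length w \<le> 2 * M + 1" by linarith
    ultimately show "w \<in> {w. set w \<subseteq> {..M} \<and> length w \<le> 2 * M + 1}" by simp
  qed
qed (simp add: finite_lists_length_le)

lemma all_pairs_proper_pair: "p \<in> all_pairs n \<longleftrightarrow> proper_pair p \<and> snd p \<le> n"
  by (cases p) (auto simp: all_pairs_def proper_pair_def)

lemma finite_all_pairs: "finite (all_pairs n)"
  by (rule finite_subset[of _ "{..n} \<times> {..n}"]) (auto simp: all_pairs_def)

text \<open>Stopped words with q at most K N are used; then q is at most n / K and the lattice count
  loses the factor (1 - 3 / K)^2, while words of larger overshoot cost the probability 2 / K. G is
  an event for words and E an event for pairs that it forces, so the same lemma serves both an event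
  and its complement.\<close>

lemma cylinder_count:
  assumes K: "4 \<le> K" and N: "1 \<le> N" and n: "K * K * N \<le> n"
    and E: "\<And>w p. stopped N w \<Longrightarrow> w \<in> G \<Longrightarrow> cf_den w \<le> K * N \<Longrightarrow> p \<in> suffix_pairs (cf_den w) (cf_den_prev w) n \<Longrightarrow> E (prepend w p)"
  shows "(1 - 3 / real K)\<^sup>2 * ((real n)\<^sup>2 / 2) * (measure_pmf.prob (chain N (chain_steps N) []) G - 2 / real K)
    \<le> real (card {p \<in> all_pairs n. E p})"
proof -
  let ?p = "chain N (chain_steps N) []"
  let ?bad = "{w'. real K * real N < real (cf_den w')}"
  define W where "W = {w \<in> G. stopped N w \<and> cf_den w \<le> K * N}"
  have finW: "finite W" by (rule finite_subset[OF _ finite_words[of "K * N"]]) (auto simp: W_def)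
  have supp: "stopped N w" if "w \<in> set_pmf ?p" for w
    using chain_support[OF that] chain_steps_stop[OF that] by (auto simp: stopped_def)
  have over: "measure_pmf.prob ?p ?bad \<le> 2 / real K"
  proof -
    have "real (cf_den []) \<le> real K * real N" using K N mult_mono[of 1 "real K" 1 "real N"] by simp
    from chain_overshoot[OF _ this, of "chain_steps N"] show ?thesis using K N by simp
  qed
  have "measure_pmf.prob ?p G \<le> measure_pmf.prob ?p (W \<union> ?bad)"
  proof (rule measure_pmf.finite_measure_mono_AE)
    show "AE w in ?p. w \<in> G \<longrightarrow> w \<in> W \<union> ?bad"
    proof (rule AE_pmfI, intro impI)
      fix w assume "w \<in> set_pmf ?p" "w \<in> G"
      moreover have "real (cf_den w) \<le> real K * real N \<Longrightarrow> cf_den w \<le> K * N"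
        by (metis of_nat_le_iff of_nat_mult)
      ultimately show "w \<in> W \<union> ?bad" using supp by (auto simp: W_def not_less)
    qed
  qed simp
  also have "\<dots> \<le> measure_pmf.prob ?p W + measure_pmf.prob ?p ?bad"
    by (rule measure_Un_le) auto
  finally have 1: "measure_pmf.prob ?p G - 2 / real K \<le> measure_pmf.prob ?p W" using over by simp
  have "measure_pmf.prob ?p W = (\<Sum>w\<in>W. pmf ?p w)" by (rule measure_measure_pmf_finite[OF finW])
  also have "\<dots> \<le> (\<Sum>w\<in>W. cyl_length w)"
    using chain_pmf_le[of N "chain_steps N" "[]"] by (intro sum_mono) (simp add: cyl_length_def[of "[]"])
  finally have 2: "measure_pmf.prob ?p G - 2 / real K \<le> (\<Sum>w\<in>W. cyl_length w)" using 1 by simp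
  have inj: "inj_on (\<lambda>(w, p). prepend w p) (SIGMA w:W. suffix_pairs (cf_den w) (cf_den_prev w) n)"
  proof (rule inj_onI)
    fix x y assume xy: "x \<in> (SIGMA w:W. suffix_pairs (cf_den w) (cf_den_prev w) n)" "y \<in> (SIGMA w:W. suffix_pairs (cf_den w) (cf_den_prev w) n)"
      "(case x of (w, p) \<Rightarrow> prepend w p) = (case y of (w, p) \<Rightarrow> prepend w p)"
    obtain w p where x: "x = (w, p)" by (cases x)
    obtain w' p' where y: "y = (w', p')" by (cases y)
    have "w = w' \<and> p = p'"
      by (rule prepend_stopped_inj[of N]) (use xy x y in \<open>auto simp: W_def suffix_pairs_def\<close>)
    then show "x = y" using x y by simp
  qed
  have img: "(\<lambda>(w, p). prepend w p) ` (SIGMA w:W. suffix_pairs (cf_den w) (cf_den_prev w) n) \<subseteq> {p \<in> all_pairs n. E p}"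
    using E prepend_proper_pair by (auto simp: W_def suffix_pairs_def all_pairs_proper_pair prepend_snd)
  have each: "(1 - 3 / real K)\<^sup>2 * ((real n)\<^sup>2 / 2) * cyl_length w \<le> real (card (suffix_pairs (cf_den w) (cf_den_prev w) n))" if "w \<in> W" for w
  proof -
    have q: "1 \<le> cf_den w" "cf_den_prev w \<le> cf_den w" "cf_den w \<le> K * N" using cf_den_pos cf_den_prev_le that by (auto simp: W_def)
    have Kq: "K * cf_den w \<le> n" using mult_le_mono2[OF q(3), of K] n unfolding mult.assoc by (rule le_trans)
    have "3 * cf_den w \<le> K * cf_den w" using K by (intro mult_le_mono1) simp
    then have q3: "3 * cf_den w \<le> n" using Kq by (rule le_trans)
    have rK: "real K * real (cf_den w) \<le> real n" using Kq by (metis of_nat_le_iff of_nat_mult)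
    have "(1 - 3 / real K) * real n \<le> real n - 3 * real (cf_den w)"
    proof -
      have "3 * real (cf_den w) \<le> 3 / real K * real n" using rK K by (simp add: field_simps)
      then show ?thesis by (simp add: left_diff_distrib)
    qed
    moreover have "0 \<le> (1 - 3 / real K) * real n" using K by simp
    ultimately have "((1 - 3 / real K) * real n)\<^sup>2 \<le> (real n - 3 * real (cf_den w))\<^sup>2" by (rule power_mono)
    then have "((1 - 3 / real K) * real n)\<^sup>2 / (2 * real (cf_den w) * (real (cf_den w) + real (cf_den_prev w)))
      \<le> (real n - 3 * real (cf_den w))\<^sup>2 / (2 * real (cf_den w) * (real (cf_den w) + real (cf_den_prev w)))"
      by (intro divide_right_mono) auto
    also have "\<dots> \<le> real (card (suffix_pairs (cf_den w) (cf_den_prev w) n))" using q q3 by (intro card_suffix_pairs)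
    finally show ?thesis by (simp add: cyl_length_def power_mult_distrib mult_ac)
  qed
  have "(1 - 3 / real K)\<^sup>2 * ((real n)\<^sup>2 / 2) * (measure_pmf.prob ?p G - 2 / real K)
    \<le> (1 - 3 / real K)\<^sup>2 * ((real n)\<^sup>2 / 2) * (\<Sum>w\<in>W. cyl_length w)"
    using 2 by (intro mult_left_mono) auto
  also have "\<dots> \<le> (\<Sum>w\<in>W. real (card (suffix_pairs (cf_den w) (cf_den_prev w) n)))"
    unfolding sum_distrib_left by (intro sum_mono each)
  also have "\<dots> = real (card (SIGMA w:W. suffix_pairs (cf_den w) (cf_den_prev w) n))"
    using finW finite_suffix_pairs cf_den_pos by (subst card_SigmaI) auto
  also have "\<dots> = real (card ((\<lambda>(w, p). prepend w p) ` (SIGMA w:W. suffix_pairs (cf_den w) (cf_den_prev w) n)))"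
    by (simp add: card_image[OF inj])
  also have "\<dots> \<le> real (card {p \<in> all_pairs n. E p})"
    using card_mono[OF _ img] finite_all_pairs by simp
  finally show ?thesis .
qed

lemma card_all_pairs: "real (card (all_pairs n)) = real n * (real n - 1) / 2"
proof (induction n)
  case 0
  have "all_pairs 0 = {}" by (auto simp: all_pairs_def)
  then show ?case by simp
next
  case (Suc n)
  have e: "all_pairs (Suc n) = all_pairs n \<union> (\<lambda>u. (u, Suc n)) ` {1..n}"
    by (auto simp: all_pairs_def)
  have "card (all_pairs (Suc n)) = card (all_pairs n) + card ((\<lambda>u. (u, Suc n)) ` {1..n})"
    unfolding e by (intro card_Un_disjoint finite_all_pairs) (auto simp: all_pairs_def)
  also have "card ((\<lambda>u. (u, Suc n)) ` {1..n}) = n" by (subst card_image) (auto intro: inj_onI)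
  finally show ?case using Suc by (simp add: algebra_simps)
qed


text \<open>Monotonicity traps the value at x j between those at the fixed points t - d / 2 and t +
  d / 2, where convergence is known.\<close>

lemma tendsto_cdf_moving:
  fixes F :: "nat \<Rightarrow> real \<Rightarrow> real" and P :: "real \<Rightarrow> real"
  assumes mono: "\<And>j x y. x \<le> y \<Longrightarrow> F j x \<le> F j y"
    and lim: "\<And>x. (\<lambda>j. F j x) \<longlonglongrightarrow> P x" and cont: "isCont P t" and x: "x \<longlonglongrightarrow> t"
  shows "(\<lambda>j. F j (x j)) \<longlonglongrightarrow> P t"
proof (rule LIMSEQ_I)
  fix e :: real assume e: "0 < e"
  obtain d where d: "0 < d" "\<And>y. \<bar>y - t\<bar> < d \<Longrightarrow> \<bar>P y - P t\<bar> < e / 2"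
    using cont e unfolding continuous_at_eps_delta dist_real_def by (meson half_gt_zero)
  have P: "\<bar>P (t - d / 2) - P t\<bar> < e / 2" "\<bar>P (t + d / 2) - P t\<bar> < e / 2" using d by auto
  have "eventually (\<lambda>j. \<bar>x j - t\<bar> < d / 2) sequentially"
    using tendstoD[OF x, of "d / 2"] d by (simp add: dist_real_def)
  moreover have "eventually (\<lambda>j. \<bar>F j (t - d / 2) - P (t - d / 2)\<bar> < e / 2) sequentially"
    using tendstoD[OF lim[of "t - d / 2"], of "e / 2"] e by (simp add: dist_real_def)
  moreover have "eventually (\<lambda>j. \<bar>F j (t + d / 2) - P (t + d / 2)\<bar> < e / 2) sequentially"
    using tendstoD[OF lim[of "t + d / 2"], of "e / 2"] e by (simp add: dist_real_def)
  ultimately have "eventually (\<lambda>j. norm (F j (x j) - P t) < e) sequentially"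
  proof eventually_elim
    case (elim j)
    have "F j (t - d / 2) \<le> F j (x j)" "F j (x j) \<le> F j (t + d / 2)"
      using elim(1) by (intro mono; linarith)+
    then show ?case unfolding real_norm_def using elim P by linarith
  qed
  then show "\<exists>no. \<forall>n\<ge>no. norm (F n (x n) - P t) < e" by (simp add: eventually_sequentially)
qed

text \<open>A bounded change of the logarithm or of X alters the numerator by a bounded amount and
  the scale by a factor tending to 1. This is used to pass from the range of the pairs to the
  stopping level, and from n to \<open>n div d\<close>.\<close>

lemma scale_change:
  fixes a b X :: "nat \<Rightarrow> real" and m s E F t :: real
  assumes s0: "0 < s" and m: "0 \<le> m" and lna: "filterlim (\<lambda>j. ln (a j)) at_top sequentially"
    and dl: "eventually (\<lambda>j. 0 \<le> ln (a j) - ln (b j) \<and> ln (a j) - ln (b j) \<le> F) sequentially"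
    and e: "\<And>j. \<bar>e j\<bar> \<le> E" and X: "(\<lambda>j. (X j - m * ln (a j)) / (s * sqrt (ln (a j)))) \<longlonglongrightarrow> t"
  shows "(\<lambda>j. (X j - e j - m * ln (b j)) / (s * sqrt (ln (b j)))) \<longlonglongrightarrow> t"
proof -
  define dl where "dl j = ln (a j) - ln (b j)" for j
  have inv0: "(\<lambda>j. 1 / ln (a j)) \<longlonglongrightarrow> 0" "(\<lambda>j. 1 / sqrt (ln (a j))) \<longlonglongrightarrow> 0"
    using tendsto_inverse_0_at_top[OF lna] tendsto_inverse_0_at_top[OF filterlim_compose[OF sqrt_at_top lna]]
    by (simp_all add: inverse_eq_divide)
  have lna1: "eventually (\<lambda>j. 1 < ln (a j)) sequentially" using lna by (simp add: filterlim_at_top_dense)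
  have dlF: "eventually (\<lambda>j. 0 \<le> dl j \<and> dl j \<le> F) sequentially" using dl by (simp add: dl_def)
  have dl0: "(\<lambda>j. dl j * (1 / ln (a j))) \<longlonglongrightarrow> 0"
  proof (rule Lim_null_comparison)
    show "eventually (\<lambda>j. norm (dl j * (1 / ln (a j))) \<le> F * (1 / ln (a j))) sequentially"
      using dlF lna1 by eventually_elim (auto simp: abs_mult intro!: divide_right_mono)
    show "(\<lambda>j. F * (1 / ln (a j))) \<longlonglongrightarrow> 0"
      using tendsto_mult[OF tendsto_const inv0(1)] by simp
  qed
  have ratio1: "(\<lambda>j. sqrt (ln (a j)) / sqrt (ln (b j))) \<longlonglongrightarrow> 1"
  proof -
    have "(\<lambda>j. 1 / sqrt (1 - dl j * (1 / ln (a j)))) \<longlonglongrightarrow> 1 / sqrt (1 - 0)"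
      by (intro tendsto_intros dl0) simp
    moreover have "eventually (\<lambda>j. 1 / sqrt (1 - dl j * (1 / ln (a j))) = sqrt (ln (a j)) / sqrt (ln (b j))) sequentially"
      using lna1
    proof eventually_elim
      case (elim j)
      have "1 - dl j * (1 / ln (a j)) = ln (b j) / ln (a j)"
        using elim by (simp add: dl_def field_simps)
      then show ?case by (simp add: real_sqrt_divide)
    qed
    ultimately show ?thesis using Lim_transform_eventually by fastforce
  qed
  let ?T = "\<lambda>j. (X j - m * ln (a j)) / (s * sqrt (ln (a j)))"
  have 0: "(\<lambda>j. (m * dl j - e j) / s * (1 / sqrt (ln (a j)))) \<longlonglongrightarrow> 0"
  proof (rule Lim_null_comparison)
    show "eventually (\<lambda>j. norm ((m * dl j - e j) / s * (1 / sqrt (ln (a j))))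
        \<le> (m * F + E) / s * (1 / sqrt (ln (a j)))) sequentially"
      using dlF lna1
    proof eventually_elim
      case (elim j)
      have "m * dl j \<le> m * F" "0 \<le> m * dl j"
        using elim m by (auto intro: mult_left_mono)
      then have "\<bar>m * dl j - e j\<bar> \<le> m * F + E" using e[of j] by linarith
      then have "\<bar>m * dl j - e j\<bar> / s * (1 / sqrt (ln (a j))) \<le> (m * F + E) / s * (1 / sqrt (ln (a j)))"
        using s0 elim by (intro mult_right_mono divide_right_mono) auto
      then show ?case using s0 elim by (simp add: abs_mult)
    qed
    show "(\<lambda>j. (m * F + E) / s * (1 / sqrt (ln (a j)))) \<longlonglongrightarrow> 0"
      using tendsto_mult[OF tendsto_const[of "(m * F + E) / s"] inv0(2)] by (simp only: mult_zero_right)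
  qed
  have "(\<lambda>j. (?T j + (m * dl j - e j) / s * (1 / sqrt (ln (a j)))) * (sqrt (ln (a j)) / sqrt (ln (b j)))) \<longlonglongrightarrow> (t + 0) * 1"
    by (intro tendsto_mult tendsto_add X 0 ratio1)
  moreover have "eventually (\<lambda>j. (?T j + (m * dl j - e j) / s * (1 / sqrt (ln (a j)))) * (sqrt (ln (a j)) / sqrt (ln (b j)))
     = (X j - e j - m * ln (b j)) / (s * sqrt (ln (b j)))) sequentially"
    using lna1
  proof eventually_elim
    case (elim j)
    define r where "r = sqrt (ln (a j))"
    have r: "0 < r" using elim by (simp add: r_def)
    have "?T j + (m * dl j - e j) / s * (1 / r) = (X j - e j - m * ln (b j)) / (s * r)"
      unfolding r_def[symmetric] dl_def using s0 r by (simp add: field_simps)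
    then show ?case unfolding r_def[symmetric] using r s0 by simp
  qed
  ultimately show ?thesis using Lim_transform_eventually by fastforce
qed

text \<open>The order of limits: first j tends to infinity for fixed K, then K is chosen
  large.\<close>

lemma tendsto_squeeze_params:
  fixes a :: "nat \<Rightarrow> real"
  assumes l: "l \<longlonglongrightarrow> p" and u: "u \<longlonglongrightarrow> p"
    and ev: "\<And>K. 4 \<le> K \<Longrightarrow> eventually (\<lambda>j. l K \<le> a j) sequentially" "\<And>K. 4 \<le> K \<Longrightarrow> eventually (\<lambda>j. a j \<le> u K) sequentially"
  shows "a \<longlonglongrightarrow> p"
proof (rule order_tendstoI)
  fix y assume "y < p"
  then have "eventually (\<lambda>K. y < l K \<and> 4 \<le> K) sequentially"
    using order_tendstoD(1)[OF l] eventually_ge_at_top[of "4::nat"] by (simp add: eventually_conj_iff)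
  then obtain K where "y < l K" "4 \<le> K" by (auto simp: eventually_sequentially)
  then show "eventually (\<lambda>j. y < a j) sequentially" using ev(1)[of K] by (auto elim!: eventually_mono)
next
  fix y assume "p < y"
  then have "eventually (\<lambda>K. u K < y \<and> 4 \<le> K) sequentially"
    using order_tendstoD(2)[OF u] eventually_ge_at_top[of "4::nat"] by (simp add: eventually_conj_iff)
  then obtain K where "u K < y" "4 \<le> K" by (auto simp: eventually_sequentially)
  then show "eventually (\<lambda>j. a j < y) sequentially" using ev(2)[of K] by (auto elim!: eventually_mono)
qed

section \<open>The number of pairs whose cost lies below a threshold\<close>

context gauss_clt
begin

definition cost_count :: "nat \<Rightarrow> real \<Rightarrow> real" where
  "cost_count n X = real (card {p \<in> all_pairs n. total_cost c (ratio p) \<le> X})"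

lemma cost_centered_cost: "(\<Sum>k\<leftarrow>w. c (Suc k)) = centered_cost w + mu * ln (real (cf_den w))"
  by (simp add: centered_cost_def)

text \<open>The unread rest costs at most 2 B K^2: its denominator v satisfies N v \<le> q v \<le> n
  \<le> 2 K^2 N, and there are at most v digits. The centring term is bounded by its value at q = K
  N. Both corrections are independent of w and p and are moved into the threshold.\<close>

lemma cost_count_lower:
  assumes K: "4 \<le> K" and N: "1 \<le> N" and n: "K * K * N \<le> n" "n \<le> 2 * K * K * N"
  shows "(1 - 3 / real K)\<^sup>2 * ((real n)\<^sup>2 / 2) *
      (measure_pmf.prob (chain N (chain_steps N) []) {w. centered_cost w \<le> X - 2 * B * (real K)\<^sup>2 - mu * ln (real K * real N)} - 2 / real K)
    \<le> cost_count n X"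
  unfolding cost_count_def
proof (rule cylinder_count[OF K N n(1)])
  fix w p assume w: "stopped N w" "w \<in> {w. centered_cost w \<le> X - 2 * B * (real K)\<^sup>2 - mu * ln (real K * real N)}"
    "cf_den w \<le> K * N" and p: "p \<in> suffix_pairs (cf_den w) (cf_den_prev w) n"
  have pv: "proper_pair p" "cf_den w * snd p \<le> n" using p by (auto simp: suffix_pairs_def)
  have q: "0 < real (cf_den w)" using cf_den_pos[of w] by linarith
  have "real (cf_den w) \<le> real K * real N" using w(3) by (metis of_nat_le_iff of_nat_mult)
  then have "ln (real (cf_den w)) \<le> ln (real K * real N)" using q by (subst ln_le_cancel_iff) auto
  then have 1: "mu * ln (real (cf_den w)) \<le> mu * ln (real K * real N)" using mu_pos by (simp add: mult_left_mono)
  have "N * snd p \<le> cf_den w * snd p" using w(1) by (intro mult_le_mono1) (simp add: stopped_def)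
  also have "\<dots> \<le> N * (2 * K * K)" using pv(2) n(2) by (simp add: mult_ac)
  finally have "snd p \<le> 2 * K * K" using N by simp
  then have "real (snd p) \<le> real (2 * K * K)" by (simp only: of_nat_le_iff)
  then have "real (snd p) \<le> 2 * (real K)\<^sup>2" by (simp add: power2_eq_square)
  then have "B * real (snd p) \<le> B * (2 * (real K)\<^sup>2)" using B_nonneg by (rule mult_left_mono)
  moreover have "total_cost c (ratio p) \<le> B * real (snd p)" by (rule total_cost_bounds(2)[of c B p, OF c_nonneg c_le pv(1)])
  ultimately show "total_cost c (ratio (prepend w p)) \<le> X"
    unfolding total_cost_prepend[OF pv(1)] cost_centered_cost using w(2) 1 by simp
qed

text \<open>The count is taken for the complementary event. There the unread rest is bounded below
  by 0 and the denominator by N, and no upper bound on n enters.\<close>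

lemma cost_count_upper:
  assumes K: "4 \<le> K" and N: "1 \<le> N" and n: "K * K * N \<le> n"
  shows "cost_count n X \<le> (real n)\<^sup>2 / 2 - (1 - 3 / real K)\<^sup>2 * ((real n)\<^sup>2 / 2) *
      (measure_pmf.prob (chain N (chain_steps N) []) {w. X - mu * ln (real N) < centered_cost w} - 2 / real K)"
proof -
  have "(1 - 3 / real K)\<^sup>2 * ((real n)\<^sup>2 / 2) *
      (measure_pmf.prob (chain N (chain_steps N) []) {w. X - mu * ln (real N) < centered_cost w} - 2 / real K)
    \<le> real (card {p \<in> all_pairs n. X < total_cost c (ratio p)})"
  proof (rule cylinder_count[OF K N n(1)])
    fix w p assume w: "stopped N w" "w \<in> {w. X - mu * ln (real N) < centered_cost w}" and p: "p \<in> suffix_pairs (cf_den w) (cf_den_prev w) n"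
    have pv: "proper_pair p" using p by (auto simp: suffix_pairs_def)
    have "ln (real N) \<le> ln (real (cf_den w))" using w(1) N by (subst ln_le_cancel_iff) (auto simp: stopped_def)
    then have "mu * ln (real N) \<le> mu * ln (real (cf_den w))" using mu_pos by (simp add: mult_left_mono)
    then show "X < total_cost c (ratio (prepend w p))"
      unfolding total_cost_prepend[OF pv] cost_centered_cost using w(2) total_cost_bounds(1)[of c B p, OF c_nonneg c_le pv] by simp
  qed
  moreover have "cost_count n X + real (card {p \<in> all_pairs n. X < total_cost c (ratio p)}) = real (card (all_pairs n))"
  proof -
    have "all_pairs n = {p \<in> all_pairs n. total_cost c (ratio p) \<le> X} \<union> {p \<in> all_pairs n. X < total_cost c (ratio p)}"
      by auto
    then have "card (all_pairs n) = card {p \<in> all_pairs n. total_cost c (ratio p) \<le> X} + card {p \<in> all_pairs n. X < total_cost c (ratio p)}"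
      by (metis (no_types, lifting) card_Un_disjoint disjoint_iff finite_Un finite_all_pairs mem_Collect_eq not_less)
    then show ?thesis by (simp add: cost_count_def)
  qed
  moreover have "real (card (all_pairs n)) \<le> (real n)\<^sup>2 / 2"
    unfolding card_all_pairs by (simp add: power2_eq_square right_diff_distrib)
  ultimately show ?thesis by linarith
qed

text \<open>The range M and the threshold X are arbitrary sequences, so that the result also covers
  the range \<open>n div d\<close> with the threshold belonging to n.\<close>

lemma cost_count_limit:
  assumes M: "filterlim M at_top sequentially"
    and X: "(\<lambda>j. (X j - mu * ln (real (M j))) / (sqrt sig2 * sqrt (ln (real (M j))))) \<longlonglongrightarrow> t"
  shows "(\<lambda>j. cost_count (M j) (X j) / ((real (M j))\<^sup>2 / 2)) \<longlonglongrightarrow> Phi t"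
proof (rule tendsto_squeeze_params)
  let ?F = "\<lambda>N x. measure_pmf.prob (chain N (chain_steps N) []) {w. centered_cost w / (sqrt sig2 * sqrt (ln (real N))) \<le> x}"
  have s0: "0 < sqrt sig2" using sig2_pos by simp
  \<comment> \<open>The last 1 / K absorbs, for large j, the distance between the chain probability
    and its limit; 2 / K and the square come from \<open>cylinder_count\<close>.\<close>
  let ?l = "\<lambda>K::nat. (1 - 3 / real K)\<^sup>2 * (Phi t - 2 / real K - 1 / real K)"
  let ?u = "\<lambda>K::nat. 1 - (1 - 3 / real K)\<^sup>2 * ((1 - Phi t) - 2 / real K - 1 / real K)"
  have k: "(\<lambda>K::nat. 1 / real K) \<longlonglongrightarrow> 0" "(\<lambda>K::nat. 2 / real K) \<longlonglongrightarrow> 0" "(\<lambda>K::nat. 3 / real K) \<longlonglongrightarrow> 0" by real_asymp+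
  have "?l \<longlonglongrightarrow> (1 - 0)\<^sup>2 * (Phi t - 0 - 0)"
    by (intro tendsto_mult tendsto_power tendsto_diff tendsto_const k)
  then show "?l \<longlonglongrightarrow> Phi t" by simp
  have "?u \<longlonglongrightarrow> 1 - (1 - 0)\<^sup>2 * ((1 - Phi t) - 0 - 0)"
    by (intro tendsto_mult tendsto_power tendsto_diff tendsto_const k)
  then show "?u \<longlonglongrightarrow> Phi t" by simp
  fix K :: nat assume K: "4 \<le> K"
  \<comment> \<open>The level lies below the range by K^2: one factor K admits the overshoot, the
    other makes the lattice count accurate.\<close>
  define N where "N j = M j div (K * K)" for j
  have Mr: "filterlim (\<lambda>j. real (M j)) at_top sequentially"
    by (rule filterlim_compose[OF filterlim_real_sequentially M])
  have lnM: "filterlim (\<lambda>j. ln (real (M j))) at_top sequentially"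
    by (rule filterlim_compose[OF ln_at_top Mr])
  have NM: "filterlim N at_top sequentially"
    unfolding filterlim_at_top
  proof
    fix Z
    have "eventually (\<lambda>j. Z * (K * K) \<le> M j) sequentially" using M by (simp add: filterlim_at_top)
    then show "eventually (\<lambda>j. Z \<le> N j) sequentially"
      by eventually_elim (use K in \<open>simp add: N_def less_eq_div_iff_mult_less_eq\<close>)
  qed
  have ev1: "eventually (\<lambda>j. 2 \<le> N j) sequentially" using NM by (simp add: filterlim_at_top)
  have facts: "K * K * N j \<le> M j" "M j \<le> 2 * K * K * N j" if "2 \<le> N j" for j
  proof -
    show "K * K * N j \<le> M j" by (simp add: N_def)
    have "M j < K * K * (N j + 1)" unfolding N_def using K dividend_less_times_div[of "K * K" "M j"] by simp
    also have "\<dots> \<le> K * K * (2 * N j)" using that by (intro mult_le_mono2) simp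
    finally show "M j \<le> 2 * K * K * N j" by (simp add: mult_ac)
  qed
  define dl where "dl j = ln (real (M j)) - ln (real (N j))" for j
  have dl: "0 \<le> dl j" "dl j \<le> ln (2 * real K * real K)" if "2 \<le> N j" for j
  proof -
    have N0: "0 < real (N j)" using that by simp
    have "real (N j) \<le> real (M j)" by (simp add: N_def)
    then show "0 \<le> dl j" using N0 by (simp add: dl_def)
    have "real (M j) \<le> (2 * real K * real K) * real (N j)"
      using facts(2)[OF that] by (metis of_nat_le_iff of_nat_mult of_nat_numeral)
    then have "ln (real (M j)) \<le> ln ((2 * real K * real K) * real (N j))"
      using N0 \<open>real (N j) \<le> real (M j)\<close> K by (subst ln_le_cancel_iff) auto
    also have "\<dots> = ln (2 * real K * real K) + ln (real (N j))" using N0 K by (subst ln_mult) auto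
    finally show "dl j \<le> ln (2 * real K * real K)" by (simp add: dl_def)
  qed
  have moving: "(\<lambda>j. (X j - e j - mu * ln (real (N j))) / (sqrt sig2 * sqrt (ln (real (N j))))) \<longlonglongrightarrow> t"
    if e: "\<And>j. \<bar>e j\<bar> \<le> E" for e :: "nat \<Rightarrow> real" and E
    by (rule scale_change[where a="\<lambda>j. real (M j)" and F="ln (2 * real K * real K)", OF s0 _ lnM _ e X])
      (use mu_pos ev1 dl in \<open>auto simp: dl_def elim!: eventually_mono\<close>)
  have mono: "?F N x \<le> ?F N y" if "x \<le> y" for N x y
    using that by (intro measure_pmf.finite_measure_mono) auto
  have limF: "(\<lambda>j. ?F (N j) x) \<longlonglongrightarrow> Phi x" for x
    using filterlim_compose[OF chain_clt[of x] NM] by simp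
  have conv: "(centered_cost w / (sqrt sig2 * sqrt (ln (real (N j)))) \<le> Z / (sqrt sig2 * sqrt (ln (real (N j))))) \<longleftrightarrow> centered_cost w \<le> Z"
    if "2 \<le> N j" for w j Z
    using s0 that by (simp add: divide_le_cancel mult_less_0_iff)
  show "eventually (\<lambda>j. ?l K \<le> cost_count (M j) (X j) / ((real (M j))\<^sup>2 / 2)) sequentially"
  proof -
    let ?e = "2 * B * (real K)\<^sup>2 + mu * ln (real K)"
    let ?x = "\<lambda>j. (X j - ?e - mu * ln (real (N j))) / (sqrt sig2 * sqrt (ln (real (N j))))"
    have "(\<lambda>j. ?F (N j) (?x j)) \<longlonglongrightarrow> Phi t"
      by (rule tendsto_cdf_moving[where F="\<lambda>j. ?F (N j)", OF mono limF isCont_Phi moving[of "\<lambda>_. ?e" "\<bar>?e\<bar>"]]) simp_all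
    then have "eventually (\<lambda>j. Phi t - 1 / real K < ?F (N j) (?x j)) sequentially"
      using K by (intro order_tendstoD(1)) auto
    then show ?thesis using ev1
    proof eventually_elim
      case (elim j)
      have M0: "0 < (real (M j))\<^sup>2 / 2" using elim(2) by (cases "M j = 0") (auto simp: N_def)
      have "X j - ?e - mu * ln (real (N j)) = X j - 2 * B * (real K)\<^sup>2 - mu * ln (real K * real (N j))"
        using K elim(2) by (simp add: ln_mult distrib_left)
      then have eq: "?F (N j) (?x j) = measure_pmf.prob (chain (N j) (chain_steps (N j)) []) {w. centered_cost w \<le> X j - 2 * B * (real K)\<^sup>2 - mu * ln (real K * real (N j))}"
        by (simp only: conv[OF elim(2)])
      have "(real (M j))\<^sup>2 / 2 * ?l K \<le> (1 - 3 / real K)\<^sup>2 * ((real (M j))\<^sup>2 / 2) * (?F (N j) (?x j) - 2 / real K)"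
        using elim(1) by (simp only: mult.left_commute mult.assoc) (intro mult_left_mono; simp)
      also have "\<dots> \<le> cost_count (M j) (X j)"
        unfolding eq using K elim(2) facts[OF elim(2)] by (intro cost_count_lower) auto
      finally show ?case using M0 by (simp add: pos_le_divide_eq mult.commute)
    qed
  qed
  show "eventually (\<lambda>j. cost_count (M j) (X j) / ((real (M j))\<^sup>2 / 2) \<le> ?u K) sequentially"
  proof -
    let ?x = "\<lambda>j. (X j - 0 - mu * ln (real (N j))) / (sqrt sig2 * sqrt (ln (real (N j))))"
    have "(\<lambda>j. ?F (N j) (?x j)) \<longlonglongrightarrow> Phi t"
      by (rule tendsto_cdf_moving[where F="\<lambda>j. ?F (N j)", OF mono limF isCont_Phi moving[of "\<lambda>_. 0" 0]]) simp_all
    then have "eventually (\<lambda>j. ?F (N j) (?x j) < Phi t + 1 / real K) sequentially"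
      using K by (intro order_tendstoD(2)) auto
    then show ?thesis using ev1
    proof eventually_elim
      case (elim j)
      let ?p = "chain (N j) (chain_steps (N j)) []"
      have M0: "0 < (real (M j))\<^sup>2 / 2" using elim(2) by (cases "M j = 0") (auto simp: N_def)
      have "{w. X j - mu * ln (real (N j)) < centered_cost w} = UNIV - {w. centered_cost w \<le> X j - mu * ln (real (N j))}" by auto
      then have "measure_pmf.prob ?p {w. X j - mu * ln (real (N j)) < centered_cost w} = 1 - measure_pmf.prob ?p {w. centered_cost w \<le> X j - mu * ln (real (N j))}"
        using measure_pmf.prob_compl[of "{w. centered_cost w \<le> X j - mu * ln (real (N j))}" ?p] by simp
      also have "measure_pmf.prob ?p {w. centered_cost w \<le> X j - mu * ln (real (N j))} = ?F (N j) (?x j)"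
        by (simp only: conv[OF elim(2)] diff_zero)
      finally have eq: "measure_pmf.prob ?p {w. X j - mu * ln (real (N j)) < centered_cost w} = 1 - ?F (N j) (?x j)" .
      have "cost_count (M j) (X j) \<le> (real (M j))\<^sup>2 / 2 - (1 - 3 / real K)\<^sup>2 * ((real (M j))\<^sup>2 / 2) * (1 - ?F (N j) (?x j) - 2 / real K)"
        unfolding eq[symmetric] using K elim(2) facts[OF elim(2)] by (intro cost_count_upper) auto
      also have "\<dots> \<le> (real (M j))\<^sup>2 / 2 - (1 - 3 / real K)\<^sup>2 * ((real (M j))\<^sup>2 / 2) * ((1 - Phi t) - 2 / real K - 1 / real K)"
        using elim(1) by (intro diff_left_mono mult_left_mono) auto
      also have "\<dots> = ?u K * ((real (M j))\<^sup>2 / 2)"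
      proof -
        have "m - a * m * x = (1 - a * x) * m" for m a x :: real by (simp add: algebra_simps)
        then show ?thesis .
      qed
      finally show ?case using M0 by (simp only: pos_divide_le_eq)
    qed
  qed
qed

end

subsection \<open>Coprime pairs\<close>

definition moebius_mu :: "nat \<Rightarrow> real" where
  "moebius_mu n = (if squarefree n then (- 1) ^ card (prime_factors n) else 0)"

lemma moebius_mu_abs_le: "\<bar>moebius_mu n\<bar> \<le> 1"
  by (simp add: moebius_mu_def power_abs)

lemma moebius_mu_1: "moebius_mu 1 = 1" "moebius_mu (Suc 0) = 1"
  by (simp_all add: moebius_mu_def)

lemma moebius_mu_prime_mult:
  assumes p: "prime p" and e: "\<not> p dvd e" "e \<noteq> 0"
  shows "moebius_mu (p * e) = - moebius_mu e"
proof -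
  have co: "coprime p e" using p e by (simp add: prime_imp_coprime)
  have "squarefree (p * e) \<longleftrightarrow> squarefree e"
    using squarefree_mult_coprime[OF co squarefree_prime[OF p]] squarefree_multD(2)[of p e] by blast
  moreover have "card (prime_factors (p * e)) = Suc (card (prime_factors e))"
  proof -
    have "prime_factors (p * e) = insert p (prime_factors e)"
      using p e by (simp add: prime_factors_product prime_prime_factors not_prime_0)
    moreover have "p \<notin> prime_factors e" using e by (auto dest: in_prime_factors_imp_dvd)
    ultimately show ?thesis by simp
  qed
  ultimately show ?thesis by (simp add: moebius_mu_def)
qed

lemma moebius_mu_square_dvd:
  assumes "prime p" "p dvd e"
  shows "moebius_mu (p * e) = 0"
proof -
  have "p\<^sup>2 dvd p * e" using assms by (simp add: power2_eq_square)
  then have "\<not> squarefree (p * e)" by (rule not_squarefreeI) (use assms(1) in auto)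
  then show ?thesis by (simp add: moebius_mu_def)
qed

text \<open>For a prime p dividing n, the divisors prime to p cancel against their multiples by p;
  divisors containing p twice contribute 0.\<close>

lemma sum_moebius_mu_divisors:
  assumes n: "0 < n"
  shows "(\<Sum>d | d dvd n. moebius_mu d) = (if n = 1 then 1 else 0)"
proof (cases "n = 1")
  case True
  then show ?thesis by (simp add: moebius_mu_1)
next
  case False
  then obtain p where p: "prime p" "p dvd n" using prime_factor_nat by blast
  then have p0: "0 < p" by (simp add: prime_gt_0_nat)
  let ?A = "{d. d dvd n \<and> \<not> p dvd d}" and ?B = "{d. d dvd n \<and> p dvd d}"
  have fin: "finite {d. d dvd n}" using n by simp
  have "?A \<union> ?B = {d. d dvd n}" by auto
  then have "(\<Sum>d | d dvd n. moebius_mu d) = sum moebius_mu ?A + sum moebius_mu ?B"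
    using sum.union_disjoint[of ?A ?B moebius_mu] fin by (auto simp: finite_subset[OF _ fin])
  also have "sum moebius_mu ?B = (\<Sum>e | p * e dvd n. moebius_mu (p * e))"
    by (rule sum.reindex_bij_witness[of _ "\<lambda>e. p * e" "\<lambda>d. d div p"]) (use p0 in \<open>auto elim!: dvdE\<close>)
  also have "\<dots> = (\<Sum>e\<in>?A. moebius_mu (p * e))"
  proof (rule sum.mono_neutral_right)
    have "inj_on (\<lambda>e. p * e) {e. p * e dvd n}" using p0 by (auto intro: inj_onI)
    moreover have "(\<lambda>e. p * e) ` {e. p * e dvd n} \<subseteq> {d. d dvd n}" by auto
    ultimately show "finite {e. p * e dvd n}" using fin by (meson finite_imageD finite_subset)
    show "?A \<subseteq> {e. p * e dvd n}" using p by (auto intro!: divides_mult simp: prime_imp_coprime)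
    show "\<forall>e\<in>{e. p * e dvd n} - ?A. moebius_mu (p * e) = 0"
      using moebius_mu_square_dvd[OF p(1)] by (auto dest: dvd_mult_right)
  qed
  also have "\<dots> = (\<Sum>e\<in>?A. - moebius_mu e)"
    using moebius_mu_prime_mult[OF p(1)] n by (intro sum.cong) auto
  finally show ?thesis using False by (simp add: sum_negf)
qed

text \<open>Telescoping from d = 3 on. The bound 3/4 < 1 is what keeps \<open>moebius_sum\<close>
  positive, as the term d = 1 contributes 1.\<close>

lemma inverse_squares_partial:
  "(\<Sum>d=2..Suc (Suc n). 1 / (real d)\<^sup>2) \<le> 3 / 4 - 1 / (real n + 2)"
proof (induction n)
  case (Suc n)
  have "1 / (real n + 3)\<^sup>2 \<le> 1 / ((real n + 2) * (real n + 3))"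
    by (intro divide_left_mono) (auto simp: power2_eq_square)
  also have "\<dots> = 1 / (real n + 2) - 1 / (real n + 3)" by (simp add: field_simps)
  finally show ?case using Suc by (simp add: add_ac)
qed (simp add: numeral_2_eq_2)

text \<open>This is 1 / zeta(2) = 6 / pi^2. It occurs as a common factor of both counts of coprime
  pairs and must be nonzero in order to cancel.\<close>

definition moebius_sum :: real where "moebius_sum = (\<Sum>d. moebius_mu d / (real d)\<^sup>2)"

lemma summable_inverse_squares: "summable (\<lambda>d. 1 / (real d)\<^sup>2)"
  using inverse_power_summable[of 2, where 'a=real] by (simp add: inverse_eq_divide power_one_over)

lemma summable_moebius_mu: "summable (\<lambda>d. moebius_mu d / (real d)\<^sup>2)"
  by (rule summable_comparison_test'[OF summable_inverse_squares, of 0])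
     (use moebius_mu_abs_le in \<open>auto simp: divide_right_mono\<close>)

lemma moebius_sum_pos: "0 < moebius_sum"
proof -
  have "1 / 4 \<le> moebius_sum"
    unfolding moebius_sum_def
  proof (rule LIMSEQ_le_const[OF summable_LIMSEQ[OF summable_moebius_mu]], intro exI allI impI)
    fix n :: nat assume n: "3 \<le> n"
    define m where "m = n - 3"
    have nm: "n = Suc (Suc (Suc m))" using n by (simp add: m_def)
    have "{..<n} = insert 0 (insert 1 {2..Suc (Suc m)})" unfolding nm by auto
    then have "(\<Sum>d<n. moebius_mu d / (real d)\<^sup>2) = 1 + (\<Sum>d=2..Suc (Suc m). moebius_mu d / (real d)\<^sup>2)"
      by (simp add: moebius_mu_1)
    moreover have "(\<Sum>d=2..Suc (Suc m). - (1 / (real d)\<^sup>2)) \<le> (\<Sum>d=2..Suc (Suc m). moebius_mu d / (real d)\<^sup>2)"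
    proof (rule sum_mono)
      fix d
      have "- 1 \<le> moebius_mu d" using moebius_mu_abs_le[of d] by simp
      then have "- 1 / (real d)\<^sup>2 \<le> moebius_mu d / (real d)\<^sup>2" by (intro divide_right_mono) auto
      then show "- (1 / (real d)\<^sup>2) \<le> moebius_mu d / (real d)\<^sup>2" by simp
    qed
    moreover have "(\<Sum>d=2..Suc (Suc m). 1 / (real d)\<^sup>2) \<le> 3 / 4"
    proof -
      have "0 \<le> 1 / (real m + 2)" by simp
      then show ?thesis using inverse_squares_partial[of m] by linarith
    qed
    ultimately show "1 / 4 \<le> (\<Sum>d<n. moebius_mu d / (real d)\<^sup>2)" unfolding sum_negf by linarith
  qed
  then show ?thesis by simp
qed

lemma finite_coprime_pairs: "finite (coprime_pairs n)"
  by (rule finite_subset[OF _ finite_all_pairs[of n]]) (auto simp: coprime_pairs_def)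

text \<open>The event depends on the ratio only, so pairs up to n with both entries divisible by d
  correspond to arbitrary pairs up to \<open>n div d\<close> with the same event.\<close>

lemma coprime_count:
  assumes E: "\<And>d u v. 1 \<le> d \<Longrightarrow> E (d * u, d * v) \<longleftrightarrow> E (u, v)"
  shows "real (card {p \<in> coprime_pairs n. E p}) = (\<Sum>d. moebius_mu d * real (card {p \<in> all_pairs (n div d). E p}))"
proof -
  let ?Q = "{p \<in> all_pairs n. E p}"
  have finQ: "finite ?Q" using finite_all_pairs by simp
  have card_d: "card {p \<in> ?Q. d dvd fst p \<and> d dvd snd p} = card {p \<in> all_pairs (n div d). E p}" if d: "1 \<le> d" for d
  proof -
    have Ed: "E (u * d, v * d) \<longleftrightarrow> E (u, v)" for u v using E[OF d, of u v] by (simp add: mult.commute)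
    have "bij_betw (\<lambda>p. (d * fst p, d * snd p)) {p \<in> all_pairs (n div d). E p} {p \<in> ?Q. d dvd fst p \<and> d dvd snd p}"
    proof (rule bij_betwI[where g="\<lambda>p. (fst p div d, snd p div d)"])
      show "(\<lambda>p. (d * fst p, d * snd p)) \<in> {p \<in> all_pairs (n div d). E p} \<rightarrow> {p \<in> ?Q. d dvd fst p \<and> d dvd snd p}"
        using d Ed by (auto simp: all_pairs_def less_eq_div_iff_mult_less_eq mult.commute)
      show "(\<lambda>p. (fst p div d, snd p div d)) \<in> {p \<in> ?Q. d dvd fst p \<and> d dvd snd p} \<rightarrow> {p \<in> all_pairs (n div d). E p}"
      proof
        fix p assume p: "p \<in> {p \<in> ?Q. d dvd fst p \<and> d dvd snd p}"
        then obtain u v where uv: "p = (d * u, d * v)" by (cases p) (auto elim!: dvdE)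
        then show "(fst p div d, snd p div d) \<in> {p \<in> all_pairs (n div d). E p}"
          using p d E[OF d, of u v] by (auto simp: all_pairs_def less_eq_div_iff_mult_less_eq mult.commute)
      qed
    qed (use d in auto)
    then show ?thesis by (simp add: bij_betw_same_card)
  qed
  have gcd0: "0 < gcd (fst p) (snd p)" if "p \<in> ?Q" for p using that by (auto simp: all_pairs_def)
  have "{p \<in> coprime_pairs n. E p} = {p \<in> ?Q. gcd (fst p) (snd p) = 1}"
    by (auto simp: coprime_pairs_def)
  then have "real (card {p \<in> coprime_pairs n. E p}) = (\<Sum>p\<in>?Q. if gcd (fst p) (snd p) = 1 then 1 else 0)"
    using finQ by (simp add: sum.If_cases Int_def)
  also have "\<dots> = (\<Sum>p\<in>?Q. \<Sum>d | d dvd gcd (fst p) (snd p). moebius_mu d)"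
    by (intro sum.cong refl) (simp only: sum_moebius_mu_divisors[OF gcd0])
  also have "\<dots> = (\<Sum>p\<in>?Q. \<Sum>d\<in>{1..n}. if d dvd fst p \<and> d dvd snd p then moebius_mu d else 0)"
  proof (rule sum.cong[OF refl])
    fix p assume p: "p \<in> ?Q"
    have "{d. d dvd gcd (fst p) (snd p)} = {d \<in> {1..n}. d dvd fst p \<and> d dvd snd p}"
    proof -
      have "1 \<le> d \<and> d \<le> n" if "d dvd snd p" for d
        using that p dvd_imp_le[of d "snd p"] by (cases "d = 0") (auto simp: all_pairs_def)
      then show ?thesis by auto
    qed
    then show "(\<Sum>d | d dvd gcd (fst p) (snd p). moebius_mu d) = (\<Sum>d\<in>{1..n}. if d dvd fst p \<and> d dvd snd p then moebius_mu d else 0)"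
      by (simp only: sum.inter_filter[OF finite_atLeastAtMost])
  qed
  also have "\<dots> = (\<Sum>d\<in>{1..n}. \<Sum>p\<in>?Q. if d dvd fst p \<and> d dvd snd p then moebius_mu d else 0)"
    by (rule sum.swap)
  also have "\<dots> = (\<Sum>d\<in>{1..n}. moebius_mu d * real (card {p \<in> all_pairs (n div d). E p}))"
  proof (rule sum.cong[OF refl])
    fix d assume d: "d \<in> {1..n}"
    have "(\<Sum>p\<in>?Q. if d dvd fst p \<and> d dvd snd p then moebius_mu d else 0) = (\<Sum>p\<in>{p \<in> ?Q. d dvd fst p \<and> d dvd snd p}. moebius_mu d)"
      using finQ by (simp only: sum.inter_filter)
    also have "\<dots> = moebius_mu d * real (card {p \<in> ?Q. d dvd fst p \<and> d dvd snd p})" by simp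
    finally show "(\<Sum>p\<in>?Q. if d dvd fst p \<and> d dvd snd p then moebius_mu d else 0) = moebius_mu d * real (card {p \<in> all_pairs (n div d). E p})"
      using card_d[of d] d by simp
  qed
  \<comment> \<open>The added terms are 0 because \<open>n div d = 0\<close> there; for d = 0 this
    is the convention for division by zero.\<close>
  also have "\<dots> = (\<Sum>d. moebius_mu d * real (card {p \<in> all_pairs (n div d). E p}))"
  proof (rule suminf_finite[symmetric])
    fix d assume "d \<notin> {1..n}"
    then have "n div d = 0" by (cases "d = 0") auto
    then have "all_pairs (n div d) = {}" by (auto simp: all_pairs_def)
    then show "moebius_mu d * real (card {p \<in> all_pairs (n div d). E p}) = 0" by simp
  qed simp
  finally show ?thesis .
qed

text \<open>A has two arguments because the threshold stays that of n while the pairs only range up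
  to \<open>n div d\<close>. Limit and sum are exchanged by Tannery's theorem with the majorant 1 /
  d^2.\<close>

lemma moebius_limit:
  fixes A :: "nat \<Rightarrow> nat \<Rightarrow> real"
  assumes A: "\<And>m n. 0 \<le> A m n" "\<And>m n. A m n \<le> (real m)\<^sup>2 / 2"
    and lim: "\<And>d. 1 \<le> d \<Longrightarrow> (\<lambda>n. A (n div d) n / ((real (n div d))\<^sup>2 / 2)) \<longlonglongrightarrow> P"
  shows "(\<lambda>n. (\<Sum>d. moebius_mu d * A (n div d) n) / (real n)\<^sup>2) \<longlonglongrightarrow> moebius_sum * P / 2"
proof -
  let ?a = "\<lambda>d n. moebius_mu d * A (n div d) n / (real n)\<^sup>2"
  have divd: "(\<lambda>n. real (n div d) / real n) \<longlonglongrightarrow> 1 / real d" if d: "1 \<le> d" for d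
  proof (rule tendsto_sandwich)
    show "eventually (\<lambda>n. 1 / real d - 1 / real n \<le> real (n div d) / real n) sequentially"
      using eventually_gt_at_top[of 0]
    proof eventually_elim
      case (elim n)
      have "(real n / real d - 1) / real n \<le> real (n div d) / real n"
        using div_lower by (intro divide_right_mono) auto
      then show ?case using elim by (simp add: diff_divide_distrib)
    qed
    show "eventually (\<lambda>n. real (n div d) / real n \<le> 1 / real d) sequentially"
      using eventually_gt_at_top[of 0]
    proof eventually_elim
      case (elim n)
      have "real (n div d) / real n \<le> (real n / real d) / real n"
        by (intro divide_right_mono of_nat_div_le_of_nat) auto
      then show ?case using elim by simp
    qed
    show "(\<lambda>n. 1 / real d - 1 / real n) \<longlonglongrightarrow> 1 / real d" by real_asymp
  qed simp
  have limit: "?a d \<longlonglongrightarrow> moebius_mu d / (real d)\<^sup>2 * (P / 2)" for d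
  proof (cases "d = 0")
    case True
    have "A 0 n = 0" for n using A[of 0 n] by simp
    then show ?thesis using True by simp
  next
    case False
    then have d: "1 \<le> d" by simp
    have "(\<lambda>n. moebius_mu d * ((A (n div d) n / ((real (n div d))\<^sup>2 / 2)) / 2) * (real (n div d) / real n)\<^sup>2) \<longlonglongrightarrow> moebius_mu d * (P / 2) * (1 / real d)\<^sup>2"
      by (intro tendsto_mult tendsto_divide tendsto_const tendsto_power lim divd d) simp
    moreover have "eventually (\<lambda>n. moebius_mu d * ((A (n div d) n / ((real (n div d))\<^sup>2 / 2)) / 2) * (real (n div d) / real n)\<^sup>2 = ?a d n) sequentially"
      using eventually_ge_at_top[of d]
    proof eventually_elim
      case (elim n)
      have "n div d \<noteq> 0" using elim d by (simp add: div_eq_0_iff)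
      then have "0 < real (n div d)" by simp
      then show ?case by (simp add: power_divide)
    qed
    ultimately have "?a d \<longlonglongrightarrow> moebius_mu d * (P / 2) * (1 / real d)\<^sup>2" by (rule Lim_transform_eventually)
    moreover have "moebius_mu d * (P / 2) * (1 / real d)\<^sup>2 = moebius_mu d / (real d)\<^sup>2 * (P / 2)"
      by (simp add: power_one_over)
    ultimately show ?thesis by (simp only:)
  qed
  have bound: "norm (?a d n) \<le> 1 / (real d)\<^sup>2" for d n
  proof (cases "d = 0 \<or> n = 0")
    case True
    have "A 0 n = 0" for n using A[of 0 n] by simp
    then show ?thesis using True by auto
  next
    case False
    have "A (n div d) n \<le> (real (n div d))\<^sup>2 / 2" by (rule A)
    also have "\<dots> \<le> (real (n div d))\<^sup>2" by simp
    also have "\<dots> \<le> (real n / real d)\<^sup>2" by (intro power_mono of_nat_div_le_of_nat) auto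
    finally have 1: "A (n div d) n \<le> (real n / real d)\<^sup>2" .
    have "\<bar>moebius_mu d\<bar> * A (n div d) n \<le> 1 * (real n / real d)\<^sup>2"
      using moebius_mu_abs_le 1 A by (intro mult_mono) auto
    then have "\<bar>moebius_mu d\<bar> * A (n div d) n / (real n)\<^sup>2 \<le> (real n / real d)\<^sup>2 / (real n)\<^sup>2"
      by (intro divide_right_mono) auto
    then show ?thesis using False A by (simp add: abs_mult power_divide)
  qed
  have "(\<lambda>n. \<Sum>d. ?a d n) \<longlonglongrightarrow> (\<Sum>d. moebius_mu d / (real d)\<^sup>2 * (P / 2))"
    using tannerys_theorem[of ?a "\<lambda>d. moebius_mu d / (real d)\<^sup>2 * (P / 2)" sequentially "\<lambda>d. 1 / (real d)\<^sup>2"]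
      limit bound summable_inverse_squares by (auto simp: always_eventually case_prod_beta)
  moreover have "(\<Sum>d. moebius_mu d / (real d)\<^sup>2 * (P / 2)) = moebius_sum * P / 2"
    unfolding moebius_sum_def using suminf_mult2[OF summable_moebius_mu, of "P / 2"] by simp
  moreover have "(\<Sum>d. ?a d n) = (\<Sum>d. moebius_mu d * A (n div d) n) / (real n)\<^sup>2" for n
  proof -
    have "summable (\<lambda>d. moebius_mu d * A (n div d) n)"
    proof (rule summable_finite[of "{..n}"])
      fix d assume "d \<notin> {..n}"
      then have "n div d = 0" by simp
      then show "moebius_mu d * A (n div d) n = 0" using A[of 0 n] by simp
    qed simp
    then show ?thesis by (rule suminf_divide)
  qed
  ultimately show ?thesis by (simp only:)
qed

section \<open>Central limit theorems for all pairs and for coprime pairs\<close>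

context gauss_clt
begin

definition threshold :: "real \<Rightarrow> nat \<Rightarrow> real" where
  "threshold t n = mu * ln (real n) + t * (sqrt sig2 * sqrt (ln (real n)))"

lemma threshold_scaled:
  assumes "2 \<le> n"
  shows "(threshold t n - mu * ln (real n)) / (sqrt sig2 * sqrt (ln (real n))) = t"
proof -
  have "0 < ln (real n)" using assms by simp
  then show ?thesis using sig2_pos by (simp add: threshold_def)
qed

text \<open>The logarithms of n and \<open>n div d\<close> differ by at most ln (2 d), which is
  invisible on the scale sqrt (ln n); the limit is thus the same for every d.\<close>

lemma cost_count_threshold_div:
  assumes d: "1 \<le> d"
  shows "(\<lambda>n. cost_count (n div d) (threshold t n) / ((real (n div d))\<^sup>2 / 2)) \<longlonglongrightarrow> Phi t"
proof (rule cost_count_limit)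
  show M: "filterlim (\<lambda>n. n div d) at_top sequentially"
    unfolding filterlim_at_top
  proof
    fix Z
    show "eventually (\<lambda>n. Z \<le> n div d) sequentially"
      using eventually_ge_at_top[of "Z * d"] by eventually_elim (use d in \<open>simp add: less_eq_div_iff_mult_less_eq\<close>)
  qed
  have s0: "0 < sqrt sig2" using sig2_pos by simp
  have lna: "filterlim (\<lambda>n. ln (real n)) at_top sequentially"
    by (rule filterlim_compose[OF ln_at_top filterlim_real_sequentially])
  have "(\<lambda>n. (threshold t n - mu * ln (real n)) / (sqrt sig2 * sqrt (ln (real n)))) \<longlonglongrightarrow> t"
  proof (rule tendsto_eventually)
    show "eventually (\<lambda>n. (threshold t n - mu * ln (real n)) / (sqrt sig2 * sqrt (ln (real n))) = t) sequentially"
      using eventually_ge_at_top[of 2] by eventually_elim (rule threshold_scaled)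
  qed
  moreover have "eventually (\<lambda>n. 0 \<le> ln (real n) - ln (real (n div d)) \<and> ln (real n) - ln (real (n div d)) \<le> ln (2 * real d)) sequentially"
    using eventually_ge_at_top[of d]
  proof eventually_elim
    case (elim n)
    have "n div d \<noteq> 0" using elim d by (simp add: div_eq_0_iff)
    then have N0: "0 < real (n div d)" by simp
    have "real (n div d) \<le> real n" by simp
    then have 1: "ln (real (n div d)) \<le> ln (real n)" using N0 by (subst ln_le_cancel_iff) linarith+
    have "n < d * (n div d + 1)" using d dividend_less_times_div[of d n] by simp
    also have "\<dots> \<le> d * (2 * (n div d))" using \<open>n div d \<noteq> 0\<close> by (intro mult_le_mono2) simp
    finally have "real n \<le> real (d * (2 * (n div d)))" by (simp only: of_nat_le_iff)
    then have "ln (real n) \<le> ln ((2 * real d) * real (n div d))"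
      using N0 elim d by (subst ln_le_cancel_iff) (auto simp: mult_ac)
    also have "\<dots> = ln (2 * real d) + ln (real (n div d))" using N0 d by (subst ln_mult) auto
    finally show ?case using 1 by simp
  qed
  ultimately show "(\<lambda>n. (threshold t n - mu * ln (real (n div d))) / (sqrt sig2 * sqrt (ln (real (n div d))))) \<longlonglongrightarrow> t"
    using scale_change[where a="\<lambda>n. real n" and b="\<lambda>n. real (n div d)" and e="\<lambda>_. 0" and E=0 and X="threshold t" and F="ln (2 * real d)", OF s0 _ lna] mu_pos
    by simp
qed

lemma cost_count_bounds: "0 \<le> cost_count n X" "cost_count n X \<le> real (card (all_pairs n))" "real (card (all_pairs n)) \<le> (real n)\<^sup>2 / 2"
proof -
  show "0 \<le> cost_count n X" by (simp add: cost_count_def)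
  show "cost_count n X \<le> real (card (all_pairs n))"
    unfolding cost_count_def using finite_all_pairs by (simp add: card_mono)
  show "real (card (all_pairs n)) \<le> (real n)\<^sup>2 / 2"
    unfolding card_all_pairs by (simp add: power2_eq_square right_diff_distrib)
qed

lemma card_all_ratio: "(\<lambda>n. real (card (all_pairs n)) / ((real n)\<^sup>2 / 2)) \<longlonglongrightarrow> 1"
  unfolding card_all_pairs by real_asymp

lemma all_pairs_clt: "(\<lambda>n. cost_count n (threshold t n) / real (card (all_pairs n))) \<longlonglongrightarrow> Phi t"
proof -
  have "(\<lambda>n. (cost_count n (threshold t n) / ((real n)\<^sup>2 / 2)) / (real (card (all_pairs n)) / ((real n)\<^sup>2 / 2))) \<longlonglongrightarrow> Phi t / 1"
    using cost_count_threshold_div[of 1 t] card_all_ratio by (intro tendsto_divide) auto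
  moreover have "eventually (\<lambda>n. (cost_count n (threshold t n) / ((real n)\<^sup>2 / 2)) / (real (card (all_pairs n)) / ((real n)\<^sup>2 / 2)) = cost_count n (threshold t n) / real (card (all_pairs n))) sequentially"
    using eventually_gt_at_top[of 0] by eventually_elim simp
  ultimately show ?thesis using Lim_transform_eventually by fastforce
qed

text \<open>Numerator and denominator both fall under \<open>moebius_limit\<close>, with P =
  \<open>Phi t\<close> and P = 1, and the common factor cancels.\<close>

lemma coprime_pairs_clt:
  "(\<lambda>n. real (card {p \<in> coprime_pairs n. total_cost c (ratio p) \<le> threshold t n}) / real (card (coprime_pairs n))) \<longlonglongrightarrow> Phi t"
proof -
  have sc: "ratio (d * u, d * v) = ratio (u, v)" if "1 \<le> d" for d u v using that by (simp add: ratio_def)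
  have 1: "(\<lambda>n. real (card {p \<in> coprime_pairs n. total_cost c (ratio p) \<le> threshold t n}) / (real n)\<^sup>2) \<longlonglongrightarrow> moebius_sum * Phi t / 2"
  proof -
    have "(\<lambda>n. (\<Sum>d. moebius_mu d * cost_count (n div d) (threshold t n)) / (real n)\<^sup>2) \<longlonglongrightarrow> moebius_sum * Phi t / 2"
      by (rule moebius_limit[where A="\<lambda>m n. cost_count m (threshold t n)"])
        (use cost_count_bounds order_trans[OF cost_count_bounds(2,3)] cost_count_threshold_div in auto)
    moreover have "real (card {p \<in> coprime_pairs n. total_cost c (ratio p) \<le> threshold t n}) = (\<Sum>d. moebius_mu d * cost_count (n div d) (threshold t n))" for n
      unfolding cost_count_def by (rule coprime_count) (simp add: sc)
    ultimately show ?thesis by simp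
  qed
  have 2: "(\<lambda>n. real (card (coprime_pairs n)) / (real n)\<^sup>2) \<longlonglongrightarrow> moebius_sum * 1 / 2"
  proof -
    have "(\<lambda>n. (\<Sum>d. moebius_mu d * real (card (all_pairs (n div d)))) / (real n)\<^sup>2) \<longlonglongrightarrow> moebius_sum * 1 / 2"
    proof (rule moebius_limit[where A="\<lambda>m n. real (card (all_pairs m))"])
      fix d :: nat assume d: "1 \<le> d"
      have "filterlim (\<lambda>n. n div d) at_top sequentially"
        unfolding filterlim_at_top
      proof
        fix Z
        show "eventually (\<lambda>n. Z \<le> n div d) sequentially"
          using eventually_ge_at_top[of "Z * d"] by eventually_elim (use d in \<open>simp add: less_eq_div_iff_mult_less_eq\<close>)
      qed
      from filterlim_compose[OF card_all_ratio this]
      show "(\<lambda>n. real (card (all_pairs (n div d))) / ((real (n div d))\<^sup>2 / 2)) \<longlonglongrightarrow> 1" .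
    qed (use cost_count_bounds(3) in auto)
    moreover have "real (card (coprime_pairs n)) = (\<Sum>d. moebius_mu d * real (card (all_pairs (n div d))))" for n
      using coprime_count[of "\<lambda>_. True" n] by simp
    ultimately show ?thesis by simp
  qed
  have "(\<lambda>n. (real (card {p \<in> coprime_pairs n. total_cost c (ratio p) \<le> threshold t n}) / (real n)\<^sup>2) / (real (card (coprime_pairs n)) / (real n)\<^sup>2))
    \<longlonglongrightarrow> (moebius_sum * Phi t / 2) / (moebius_sum * 1 / 2)"
    using moebius_sum_pos by (intro tendsto_divide 1 2) auto
  moreover have "(moebius_sum * Phi t / 2) / (moebius_sum * 1 / 2) = Phi t" using moebius_sum_pos by simp
  moreover have "eventually (\<lambda>n. (real (card {p \<in> coprime_pairs n. total_cost c (ratio p) \<le> threshold t n}) / (real n)\<^sup>2) / (real (card (coprime_pairs n)) / (real n)\<^sup>2)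
    = real (card {p \<in> coprime_pairs n. total_cost c (ratio p) \<le> threshold t n}) / real (card (coprime_pairs n))) sequentially"
    using eventually_gt_at_top[of 0] by eventually_elim simp
  ultimately show ?thesis using Lim_transform_eventually by fastforce
qed

end

section \<open>From counts to uniform probabilities\<close>

lemma measure_uniform_count:
  assumes "finite A" "X \<subseteq> A"
  shows "measure (uniform_count_measure A) X = real (card X) / real (card A)"
proof (cases "A = {}")
  case True
  then show ?thesis using assms by (simp add: measure_def emeasure_uniform_count_measure)
next
  case False
  then show ?thesis using assms by (simp add: measure_def emeasure_uniform_count_measure)
qed

context gauss_clt
begin

lemma threshold_iff:
  assumes "2 \<le> n"
  shows "(x - mu * ln (real n)) / (sqrt sig2 * sqrt (ln (real n))) \<le> t \<longleftrightarrow> x \<le> threshold t n"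
proof -
  have "0 < sqrt sig2 * sqrt (ln (real n))" using assms sig2_pos by simp
  then show ?thesis by (simp add: pos_divide_le_eq threshold_def algebra_simps)
qed

lemma Phi_integral: "Phi t = 1 / sqrt (2 * pi) * (LBINT x:{..t}. exp (- (x\<^sup>2 / 2)))"
proof -
  interpret real_distribution std_normal_distribution by (rule real_dist_normal_dist)
  have "Phi t = measure std_normal_distribution {..t}" by (simp add: cdf_def)
  also have "\<dots> = (LINT x|std_normal_distribution. indicator {..t} x)" by simp
  also have "\<dots> = (LINT x|lborel. std_normal_density x * indicator {..t} x)"
    by (subst integral_density) auto
  also have "\<dots> = (LBINT x:{..t}. 1 / sqrt (2 * pi) * exp (- (x\<^sup>2 / 2)))"
    unfolding set_lebesgue_integral_def
    by (intro Bochner_Integration.integral_cong) (auto simp: std_normal_density_def indicator_def)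
  also have "\<dots> = 1 / sqrt (2 * pi) * (LBINT x:{..t}. exp (- (x\<^sup>2 / 2)))"
    by (rule set_integral_mult_right)
  finally show ?thesis .
qed

lemma clt_uniform:
  assumes fin: "\<And>n. finite (Q n)"
    and lim: "(\<lambda>n. real (card {p \<in> Q n. total_cost c (ratio p) \<le> threshold t n}) / real (card (Q n))) \<longlonglongrightarrow> Phi t"
  shows "(\<lambda>n. measure (uniform_count_measure (Q n))
      {(u, v) \<in> Q n. (total_cost c (real u / real v) - mu * ln (real n)) / (sqrt sig2 * sqrt (ln (real n))) \<le> t})
    \<longlonglongrightarrow> 1 / sqrt (2 * pi) * (LBINT x:{..t}. exp (- (x\<^sup>2 / 2)))"
proof -
  have "eventually (\<lambda>n. real (card {p \<in> Q n. total_cost c (ratio p) \<le> threshold t n}) / real (card (Q n)) =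
    measure (uniform_count_measure (Q n))
      {(u, v) \<in> Q n. (total_cost c (real u / real v) - mu * ln (real n)) / (sqrt sig2 * sqrt (ln (real n))) \<le> t}) sequentially"
    using eventually_ge_at_top[of 2]
  proof eventually_elim
    case (elim n)
    have "{(u, v) \<in> Q n. (total_cost c (real u / real v) - mu * ln (real n)) / (sqrt sig2 * sqrt (ln (real n))) \<le> t}
      = {p \<in> Q n. total_cost c (ratio p) \<le> threshold t n}"
      unfolding threshold_iff[OF elim] by (auto simp: ratio_def)
    then show ?case using fin by (simp add: measure_uniform_count)
  qed
  from Lim_transform_eventually[OF lim this] show ?thesis unfolding Phi_integral .
qed

end

subsection \<open>The variance as a limit\<close>

lemma gauss_map_branch:
  assumes "x \<in> {0<..<1}"
  shows "gauss_map (branch k x) = x"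
proof -
  have "\<lfloor>real k + 1 + x\<rfloor> = int k + 1" using assms by (simp add: floor_eq_iff)
  moreover have "1 / branch k x = real k + 1 + x" "branch k x \<noteq> 0" using assms by (auto simp: branch_def)
  ultimately show ?thesis by (simp add: gauss_map_def)
qed

context gauss_clt
begin

definition g_ext :: "real \<Rightarrow> real" where "g_ext x = indicator {0..1} x * g x"

text \<open>The observable plus a coboundary. At \<open>branch k x\<close> it becomes the increment
  whose mean over the digit law is zero by the first Poisson equation.\<close>

definition mart_diff :: "real \<Rightarrow> real" where
  "mart_diff y = psi c mu y + g_ext y - g_ext (gauss_map y)"

definition mart_sum :: "nat \<Rightarrow> real \<Rightarrow> real" where
  "mart_sum n y = (\<Sum>k<n. mart_diff ((gauss_map ^^ k) y))"

definition psi_sum :: "nat \<Rightarrow> real \<Rightarrow> real" where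
  "psi_sum n y = (\<Sum>k<n. psi c mu ((gauss_map ^^ k) y))"

definition asymp_var :: real where
  "asymp_var = gauss_mean (branch_mean (\<lambda>k x. (digit_psi k x + g (branch k x) - g x)\<^sup>2))"

lemma asymp_var_eq: "asymp_var = sig2 * mean_log"
  by (simp add: asymp_var_def sig2_eq)

lemma asymp_var_pos: "0 < asymp_var"
  using sig2_pos mean_log_pos by (simp add: asymp_var_eq)

lemma g_ext_measurable [measurable]: "g_ext \<in> borel_measurable borel"
  unfolding g_ext_def[abs_def] by (rule lip_measurable[OF g_lip])

lemma g_ext_bound: "\<bar>g_ext x\<bar> \<le> L"
  using g_bd[of x] L_nonneg by (auto simp: g_ext_def indicator_def)

lemma funpow_gauss_measurable [measurable]: "(gauss_map ^^ k) \<in> borel_measurable borel"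
proof (induction k)
  case (Suc k)
  have "(\<lambda>x. gauss_map ((gauss_map ^^ k) x)) \<in> borel_measurable borel"
    using Suc by measurable
  then show ?case by (simp add: o_def)
qed (simp add: id_def)

lemma mart_sum_measurable [measurable]: "mart_sum n \<in> borel_measurable borel"
  unfolding mart_sum_def[abs_def] mart_diff_def[abs_def] by measurable

lemma psi_sum_measurable [measurable]: "psi_sum n \<in> borel_measurable borel"
  unfolding psi_sum_def[abs_def] by measurable

lemma mart_sum_Suc: "mart_sum (Suc n) y = mart_diff y + mart_sum n (gauss_map y)"
  unfolding mart_sum_def by (subst sum.lessThan_Suc_shift) (simp add: funpow_swap1)

lemma psi_sum_mart_sum: "psi_sum n y = mart_sum n y - g_ext y + g_ext ((gauss_map ^^ n) y)"
  by (induction n) (simp_all add: psi_sum_def mart_sum_def mart_diff_def)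

lemma mart_diff_branch:
  assumes "x \<in> {0<..<1}"
  shows "mart_diff (branch k x) = digit_psi k x + g (branch k x) - g x"
  using assms branch_mem[of x k] by (simp add: mart_diff_def psi_digit_psi gauss_map_branch g_ext_def)

lemma sqrt_lip_mart_diff: "\<exists>A. sqrt_lip (\<lambda>k x. (digit_psi k x + g (branch k x) - g x)\<^sup>2) A" "\<exists>A. sqrt_lip (\<lambda>k x. digit_psi k x + g (branch k x)) A"
proof -
  obtain A where A: "log_lip 1 digit_psi A" using log_lip_digit_psi by blast
  have lgb: "log_lip 0 (\<lambda>k x. g (branch k x)) L" "log_lip 0 (\<lambda>k x. g x) L"
    using log_lip_branch[of g L] g_lip g_bd by blast+
  have h: "log_lip 1 (\<lambda>k x. digit_psi k x + g (branch k x)) (A + L)" by (rule log_lip_add[OF A log_lip_mono[OF lgb(1)]]) simp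
  then show "\<exists>A. sqrt_lip (\<lambda>k x. digit_psi k x + g (branch k x)) A" using log_lip_sqrt_lip[OF h] by auto
  have "log_lip (0 + 0) (\<lambda>k x. (-1) * g x) (2 * (\<bar>-1\<bar> * L))"
    by (rule log_lip_mult[OF log_lip_const lgb(2)])
  then have "log_lip 1 (\<lambda>k x. - g x) (2 * L)" using log_lip_mono[of 0 "\<lambda>k x. - g x" "2 * L" 1] by simp
  from log_lip_add[OF h this] have m: "log_lip 1 (\<lambda>k x. digit_psi k x + g (branch k x) - g x) (A + L + 2 * L)" by simp
  show "\<exists>A. sqrt_lip (\<lambda>k x. (digit_psi k x + g (branch k x) - g x)\<^sup>2) A"
    using log_lip_sqrt_lip[OF log_lip_mult[OF m m]] by (auto simp: power2_eq_square)
qed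

text \<open>Seen backwards in time the Gauss map is the Markov chain, for which the summands of
  \<^term>\<open>mart_sum\<close> are orthogonal martingale differences.\<close>
lemma nn_integral_mart_sum_square: "(\<integral>\<^sup>+y. ennreal ((mart_sum n y)\<^sup>2) \<partial>gauss) = ennreal (real n * asymp_var)"
proof (induction n)
  case 0
  show ?case by (simp add: mart_sum_def)
next
  case (Suc n)
  let ?m = "\<lambda>k x. digit_psi k x + g (branch k x) - g x"
  obtain A1 where n1: "sqrt_lip (\<lambda>k x. (?m k x)\<^sup>2) A1" using sqrt_lip_mart_diff(1) by blast
  obtain A2 where n2: "sqrt_lip (\<lambda>k x. digit_psi k x + g (branch k x)) A2" using sqrt_lip_mart_diff(2) by blast
  have EFm [measurable]: "(\<lambda>x. indicator {0..1} x * branch_mean (\<lambda>k x. (?m k x)\<^sup>2) x) \<in> borel_measurable borel"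
    by (rule lip_measurable[OF branch_mean_lipschitz[OF n1]])
  have EFpos: "0 \<le> indicator {0..1} x * branch_mean (\<lambda>k x. (?m k x)\<^sup>2) x" for x
    by (simp add: branch_mean_def)
  have "(\<integral>\<^sup>+y. ennreal ((mart_sum (Suc n) y)\<^sup>2) \<partial>gauss) = (\<integral>\<^sup>+x. (\<integral>\<^sup>+k. ennreal ((mart_sum (Suc n) (branch k x))\<^sup>2) \<partial>digit_pmf x) \<partial>gauss)"
    by (rule gauss_invariant) measurable
  also have "\<dots> = (\<integral>\<^sup>+x. ennreal (indicator {0..1} x * branch_mean (\<lambda>k x. (?m k x)\<^sup>2) x) + ennreal ((mart_sum n x)\<^sup>2) \<partial>gauss)"
  proof (intro nn_integral_cong_AE gauss_AE_I)
    fix x :: real assume x: "x \<in> {0<..<1}"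
    then have x': "x \<in> {0..1}" by simp
    note i1 = sqrt_lip_integrable[OF n1 x' x'] and i2 = sqrt_lip_integrable[OF n2 x' x']
    have i3: "integrable (digit_pmf x) (\<lambda>k. ?m k x)" using i2 by simp
    have Em: "measure_pmf.expectation (digit_pmf x) (\<lambda>k. ?m k x) = 0"
      using g_eq[OF x'] i2 by (simp add: branch_mean_def)
    have e: "(?m k x + mart_sum n x)\<^sup>2 = (?m k x)\<^sup>2 + 2 * mart_sum n x * ?m k x + (mart_sum n x)\<^sup>2" for k
      by (simp add: power2_eq_square algebra_simps)
    have i4: "integrable (digit_pmf x) (\<lambda>k. (?m k x + mart_sum n x)\<^sup>2)"
      unfolding e by (intro Bochner_Integration.integrable_add integrable_mult_right i1 i3 measure_pmf.integrable_const)
    have "(\<integral>\<^sup>+k. ennreal ((mart_sum (Suc n) (branch k x))\<^sup>2) \<partial>digit_pmf x) = (\<integral>\<^sup>+k. ennreal ((?m k x + mart_sum n x)\<^sup>2) \<partial>digit_pmf x)"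
      using x by (simp add: mart_sum_Suc mart_diff_branch gauss_map_branch)
    also have "\<dots> = ennreal (measure_pmf.expectation (digit_pmf x) (\<lambda>k. (?m k x + mart_sum n x)\<^sup>2))"
      by (rule nn_integral_eq_integral[OF i4]) simp
    also have "measure_pmf.expectation (digit_pmf x) (\<lambda>k. (?m k x + mart_sum n x)\<^sup>2) = branch_mean (\<lambda>k x. (?m k x)\<^sup>2) x + (mart_sum n x)\<^sup>2"
    proof -
      have "measure_pmf.expectation (digit_pmf x) (\<lambda>k. (?m k x + mart_sum n x)\<^sup>2)
        = measure_pmf.expectation (digit_pmf x) (\<lambda>k. (?m k x)\<^sup>2) + 2 * mart_sum n x * measure_pmf.expectation (digit_pmf x) (\<lambda>k. ?m k x) + (mart_sum n x)\<^sup>2"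
        unfolding e
        using Bochner_Integration.integral_add[OF Bochner_Integration.integrable_add[OF i1 integrable_mult_right[OF i3, of "2 * mart_sum n x"]] measure_pmf.integrable_const[of "digit_pmf x" "(mart_sum n x)\<^sup>2"]]
          Bochner_Integration.integral_add[OF i1 integrable_mult_right[OF i3, of "2 * mart_sum n x"]]
          integral_mult_right_zero[of "digit_pmf x" "2 * mart_sum n x" "\<lambda>k. ?m k x"]
        by (simp only: lebesgue_integral_const measure_pmf.prob_space scaleR_one)
      then show ?thesis unfolding Em branch_mean_def by simp
    qed
    finally show "(\<integral>\<^sup>+k. ennreal ((mart_sum (Suc n) (branch k x))\<^sup>2) \<partial>digit_pmf x) =
      ennreal (indicator {0..1} x * branch_mean (\<lambda>k x. (?m k x)\<^sup>2) x) + ennreal ((mart_sum n x)\<^sup>2)"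
      using x EFpos[of x] by (simp add: ennreal_plus)
  qed
  also have "\<dots> = (\<integral>\<^sup>+x. ennreal (indicator {0..1} x * branch_mean (\<lambda>k x. (?m k x)\<^sup>2) x) \<partial>gauss) + (\<integral>\<^sup>+x. ennreal ((mart_sum n x)\<^sup>2) \<partial>gauss)"
    by (rule nn_integral_add) measurable
  also have "(\<integral>\<^sup>+x. ennreal (indicator {0..1} x * branch_mean (\<lambda>k x. (?m k x)\<^sup>2) x) \<partial>gauss) = ennreal asymp_var"
    unfolding asymp_var_def gauss_mean_def using branch_mean_integrable[OF n1] EFpos by (intro nn_integral_eq_integral) auto
  also have "ennreal asymp_var + (\<integral>\<^sup>+x. ennreal ((mart_sum n x)\<^sup>2) \<partial>gauss) = ennreal (real (Suc n) * asymp_var)"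
    unfolding Suc using asymp_var_pos by (simp add: ennreal_plus[symmetric] algebra_simps del: ennreal_plus)
  finally show ?case .
qed

lemma mart_sum_square: "integrable gauss (\<lambda>y. (mart_sum n y)\<^sup>2)" "(LINT y|gauss. (mart_sum n y)\<^sup>2) = real n * asymp_var"
proof -
  show "integrable gauss (\<lambda>y. (mart_sum n y)\<^sup>2)"
    by (rule integrableI_bounded) (simp_all add: nn_integral_mart_sum_square)
  show "(LINT y|gauss. (mart_sum n y)\<^sup>2) = real n * asymp_var"
    using asymp_var_pos by (subst integral_eq_nn_integral) (simp_all add: nn_integral_mart_sum_square)
qed

text \<open>The coboundaries telescope, so the two sums differ by some d with |d| \<le> 2 L and
  their squares by d (2 M + d), where M is the martingale sum. The inequality 2 |M| \<le> M^2 / sqrt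
  n + sqrt n, with weights balanced for a second moment of order n, leaves an error of order sqrt
  n.\<close>

lemma psi_sum_square_diff:
  assumes "1 \<le> n"
  shows "\<bar>(LINT y|gauss. (psi_sum n y)\<^sup>2) - real n * asymp_var\<bar> \<le> 2 * L * sqrt (real n) * (asymp_var + 1) + 4 * L\<^sup>2"
proof -
  have sn: "0 < sqrt (real n)" using assms by simp
  have pt: "\<bar>(psi_sum n y)\<^sup>2 - (mart_sum n y)\<^sup>2\<bar> \<le> 2 * L / sqrt (real n) * (mart_sum n y)\<^sup>2 + (2 * L * sqrt (real n) + 4 * L\<^sup>2)" for y
  proof -
    define d where "d = g_ext ((gauss_map ^^ n) y) - g_ext y"
    have d: "\<bar>d\<bar> \<le> 2 * L" using g_ext_bound[of y] g_ext_bound[of "(gauss_map ^^ n) y"] unfolding d_def by linarith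
    have "(psi_sum n y)\<^sup>2 - (mart_sum n y)\<^sup>2 = d * (2 * mart_sum n y + d)"
      unfolding psi_sum_mart_sum d_def by (simp add: power2_eq_square algebra_simps)
    then have "\<bar>(psi_sum n y)\<^sup>2 - (mart_sum n y)\<^sup>2\<bar> = \<bar>d\<bar> * \<bar>2 * mart_sum n y + d\<bar>" by (simp add: abs_mult)
    also have "\<dots> \<le> (2 * L) * (2 * \<bar>mart_sum n y\<bar> + 2 * L)"
      using d by (intro mult_mono) auto
    also have "2 * \<bar>mart_sum n y\<bar> \<le> (mart_sum n y)\<^sup>2 / sqrt (real n) + sqrt (real n)"
    proof -
      have "0 \<le> (\<bar>mart_sum n y\<bar> - sqrt (real n))\<^sup>2" by simp
      then have "2 * \<bar>mart_sum n y\<bar> * sqrt (real n) \<le> (mart_sum n y)\<^sup>2 + (sqrt (real n))\<^sup>2"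
        by (simp add: power2_diff)
      then have "2 * \<bar>mart_sum n y\<bar> \<le> ((mart_sum n y)\<^sup>2 + (sqrt (real n))\<^sup>2) / sqrt (real n)"
        using sn by (simp only: pos_le_divide_eq)
      also have "\<dots> = (mart_sum n y)\<^sup>2 / sqrt (real n) + sqrt (real n)"
        using sn by (simp add: add_divide_distrib power2_eq_square real_div_sqrt)
      finally show ?thesis .
    qed
    then have "(2 * L) * (2 * \<bar>mart_sum n y\<bar> + 2 * L) \<le> (2 * L) * (((mart_sum n y)\<^sup>2 / sqrt (real n) + sqrt (real n)) + 2 * L)"
      using L_nonneg by (intro mult_left_mono add_right_mono) auto
    also have "\<dots> = 2 * L / sqrt (real n) * (mart_sum n y)\<^sup>2 + (2 * L * sqrt (real n) + 4 * L\<^sup>2)"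
      by (simp add: power2_eq_square algebra_simps)
    finally show ?thesis .
  qed
  have iM: "integrable gauss (\<lambda>y. 2 * L / sqrt (real n) * (mart_sum n y)\<^sup>2 + (2 * L * sqrt (real n) + 4 * L\<^sup>2))"
    using mart_sum_square(1) by simp
  have iD: "integrable gauss (\<lambda>y. (psi_sum n y)\<^sup>2 - (mart_sum n y)\<^sup>2)"
    by (rule Bochner_Integration.integrable_bound[OF iM]) (use pt in \<open>auto intro!: AE_I2 order_trans[OF _ abs_ge_self]\<close>)
  have iS: "integrable gauss (\<lambda>y. (psi_sum n y)\<^sup>2)"
    using Bochner_Integration.integrable_add[OF iD mart_sum_square(1)[of n]] by simp
  have "(LINT y|gauss. (psi_sum n y)\<^sup>2) - real n * asymp_var = (LINT y|gauss. (psi_sum n y)\<^sup>2 - (mart_sum n y)\<^sup>2)"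
    using iS mart_sum_square by simp
  also have "\<bar>\<dots>\<bar> \<le> (LINT y|gauss. \<bar>(psi_sum n y)\<^sup>2 - (mart_sum n y)\<^sup>2\<bar>)"
    using integral_norm_bound[of gauss "\<lambda>y. (psi_sum n y)\<^sup>2 - (mart_sum n y)\<^sup>2"] by simp
  also have "\<dots> \<le> (LINT y|gauss. 2 * L / sqrt (real n) * (mart_sum n y)\<^sup>2 + (2 * L * sqrt (real n) + 4 * L\<^sup>2))"
    using iD iM pt by (intro integral_mono) auto
  also have "\<dots> = 2 * L / sqrt (real n) * (real n * asymp_var) + (2 * L * sqrt (real n) + 4 * L\<^sup>2)"
    using mart_sum_square gauss.prob_space by simp
  also have "\<dots> = 2 * L * sqrt (real n) * (asymp_var + 1) + 4 * L\<^sup>2"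
  proof -
    have "real n / sqrt (real n) = sqrt (real n)" by (simp add: real_div_sqrt)
    then have "2 * L / sqrt (real n) * (real n * asymp_var) = 2 * L * sqrt (real n) * asymp_var"
      by (metis (no_types, opaque_lifting) mult.assoc mult.commute times_divide_eq_left)
    then show ?thesis by (simp add: distrib_left)
  qed
  finally show ?thesis .
qed

lemma variance_limit:
  "(\<lambda>n. 1 / real n * (LBINT x:{0..1}. (\<Sum>k<n. psi c mu ((gauss_map ^^ k) x))\<^sup>2 * gauss_density x)) \<longlonglongrightarrow> asymp_var"
proof -
  have eq: "(LBINT x:{0..1}. (\<Sum>k<n. psi c mu ((gauss_map ^^ k) x))\<^sup>2 * gauss_density x) = (LINT y|gauss. (psi_sum n y)\<^sup>2)" for n
    unfolding psi_sum_def[symmetric] by (rule LBINT_gauss) measurable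
  have "(\<lambda>n. 1 / real n * (LINT y|gauss. (psi_sum n y)\<^sup>2) - asymp_var) \<longlonglongrightarrow> 0"
  proof (rule Lim_null_comparison)
    show "eventually (\<lambda>n. norm (1 / real n * (LINT y|gauss. (psi_sum n y)\<^sup>2) - asymp_var) \<le> 2 * L * (asymp_var + 1) * (sqrt (real n) / real n) + 4 * L\<^sup>2 * (1 / real n)) sequentially"
      using eventually_ge_at_top[of 1]
    proof eventually_elim
      case (elim n)
      have "norm (1 / real n * (LINT y|gauss. (psi_sum n y)\<^sup>2) - asymp_var) = \<bar>(LINT y|gauss. (psi_sum n y)\<^sup>2) - real n * asymp_var\<bar> / real n"
      proof -
        have "1 / real n * (LINT y|gauss. (psi_sum n y)\<^sup>2) - asymp_var = ((LINT y|gauss. (psi_sum n y)\<^sup>2) - real n * asymp_var) / real n"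
          using elim by (simp add: field_simps)
        then show ?thesis by (simp add: abs_divide)
      qed
      also have "\<dots> \<le> (2 * L * sqrt (real n) * (asymp_var + 1) + 4 * L\<^sup>2) / real n"
        using psi_sum_square_diff[OF elim] by (intro divide_right_mono) auto
      also have "\<dots> = 2 * L * (asymp_var + 1) * (sqrt (real n) / real n) + 4 * L\<^sup>2 * (1 / real n)"
        by (simp add: add_divide_distrib)
      finally show ?case .
    qed
    have "(\<lambda>n. sqrt (real n) / real n) \<longlonglongrightarrow> 0" "(\<lambda>n. 1 / real n) \<longlonglongrightarrow> 0" by real_asymp+
    from tendsto_add[OF tendsto_mult[OF tendsto_const[of "2 * L * (asymp_var + 1)"] this(1)] tendsto_mult[OF tendsto_const[of "4 * L\<^sup>2"] this(2)]]
    show "(\<lambda>n. 2 * L * (asymp_var + 1) * (sqrt (real n) / real n) + 4 * L\<^sup>2 * (1 / real n)) \<longlonglongrightarrow> 0" by simp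
  qed
  then show ?thesis unfolding eq by (rule LIM_zero_cancel)
qed

lemma entropy_mean_log: "gauss_entropy = 2 * mean_log"
  by (simp add: gauss_entropy_eq mean_log_def)

end

theorem theorem1:
  fixes c :: "nat \<Rightarrow> real"
  assumes "\<And>n. 1 \<le> n \<Longrightarrow> 0 \<le> c n"
    and "bounded (c ` {1..})"
    and "\<exists>n\<ge>1. c n \<noteq> 0"
  shows "gauss_entropy = pi\<^sup>2 / (6 * ln 2) \<and>
    (\<exists>\<mu> \<sigma>2 :: real. \<mu> > 0 \<and> \<sigma>2 > 0 \<and>
      (\<forall>t::real. (\<lambda>n::nat. measure (uniform_count_measure (coprime_pairs n))
          {(u, v) \<in> coprime_pairs n.
             (total_cost c (real u / real v) - \<mu> * ln (real n)) / (sqrt \<sigma>2 * sqrt (ln (real n))) \<le> t})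
        \<longlonglongrightarrow> 1 / sqrt (2 * pi) * (LBINT x:{..t}. exp (- (x\<^sup>2 / 2)))) \<and>
      (\<forall>t::real. (\<lambda>n::nat. measure (uniform_count_measure (all_pairs n))
          {(u, v) \<in> all_pairs n.
             (total_cost c (real u / real v) - \<mu> * ln (real n)) / (sqrt \<sigma>2 * sqrt (ln (real n))) \<le> t})
        \<longlonglongrightarrow> 1 / sqrt (2 * pi) * (LBINT x:{..t}. exp (- (x\<^sup>2 / 2)))) \<and>
      (\<exists>S::real.
        (\<lambda>k::nat. c (Suc k) *
           (LBINT x:{1 / (real (Suc k) + 1)..1 / real (Suc k)}. gauss_density x)) sums S \<and>
        \<mu> = 2 / gauss_entropy * S) \<and>
      (\<exists>L::real.
        (\<lambda>n::nat. 1 / real n *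
           (LBINT x:{0..1}. (\<Sum>k<n. psi c \<mu> ((gauss_map ^^ k) x))\<^sup>2 * gauss_density x))
          \<longlonglongrightarrow> L \<and>
        \<sigma>2 = 2 / gauss_entropy * L))"
proof -
  obtain B where "\<forall>x\<in>c ` {1..}. norm x \<le> B" using assms(2) by (auto simp: bounded_iff)
  then have "c n \<le> B" if "1 \<le> n" for n using that by force
  then have bc: "bounded_cost c B" using assms(1,3) by unfold_locales auto
  then obtain g u L sig2 where "gauss_clt c B g u L sig2" using bounded_cost.ex_gauss_clt by blast
  then interpret gauss_clt c B g u L sig2 .
  have "gauss_entropy \<noteq> 0" using entropy_mean_log mean_log_pos by simp
  show ?thesis
  proof (rule conjI[OF gauss_entropy_eq], rule exI[of _ mu], rule exI[of _ sig2], intro conjI allI)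
    show "0 < mu" "0 < sig2" by (rule mu_pos, rule sig2_pos)
    fix t
    show "(\<lambda>n::nat. measure (uniform_count_measure (coprime_pairs n))
          {(u, v) \<in> coprime_pairs n.
             (total_cost c (real u / real v) - mu * ln (real n)) / (sqrt sig2 * sqrt (ln (real n))) \<le> t})
        \<longlonglongrightarrow> 1 / sqrt (2 * pi) * (LBINT x:{..t}. exp (- (x\<^sup>2 / 2)))"
      by (rule clt_uniform[OF finite_coprime_pairs coprime_pairs_clt])
    show "(\<lambda>n::nat. measure (uniform_count_measure (all_pairs n))
          {(u, v) \<in> all_pairs n.
             (total_cost c (real u / real v) - mu * ln (real n)) / (sqrt sig2 * sqrt (ln (real n))) \<le> t})
        \<longlonglongrightarrow> 1 / sqrt (2 * pi) * (LBINT x:{..t}. exp (- (x\<^sup>2 / 2)))"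
      by (rule clt_uniform[OF finite_all_pairs all_pairs_clt[unfolded cost_count_def]])
  next
    \<comment> \<open>The factor \<open>2 / gauss_entropy\<close> is \<open>1 / mean_log\<close>,
      which turns quantities per digit into quantities per unit of \<open>ln q\<close>, here and for
      the variance.\<close>
    show "\<exists>S::real.
        (\<lambda>k::nat. c (Suc k) *
           (LBINT x:{1 / (real (Suc k) + 1)..1 / real (Suc k)}. gauss_density x)) sums S \<and>
        mu = 2 / gauss_entropy * S"
      using mean_cost_sums by (intro exI[of _ mean_cost]) (simp add: cell_weight_def mu_def entropy_mean_log)
    show "\<exists>L::real.
        (\<lambda>n::nat. 1 / real n *
           (LBINT x:{0..1}. (\<Sum>k<n. psi c mu ((gauss_map ^^ k) x))\<^sup>2 * gauss_density x))
          \<longlonglongrightarrow> L \<and>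
        sig2 = 2 / gauss_entropy * L"
      using variance_limit mean_log_pos by (intro exI[of _ asymp_var] conjI) (simp_all add: asymp_var_eq entropy_mean_log)
  qed
qed

end
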